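(* Let $\mathcal{A}$ be a separable sub-$\sigma$-algebra of $\sigma([k])$ on ${\bf X}^k$. Then there is a separable realization $\phi:{\bf X}^k\to [0,1]^{r([k])}$ such that for every $A\in\mathcal{A}$ there is a measurable set $B\subseteq[0,1]^{2^k-1}=[0,1]^{r([k])}$ with $\mu_{[k]}(\phi^{-1}(B)\triangle A)=0$.
   Context: Let $X_1,X_2,\dots$ be finite sets with $|X_1|<|X_2|<\dots$, let $\omega$ be a nonprincipal ultrafilter on $\mathbb{N}$, and let ${\bf X}$ be the ultraproduct of the $X_i$. For a nonempty $A\subseteq[k]=\{1,\dots,k\}$, ${\bf X}^A$ is the ultraproduct of the finite sets $X_i^A$ equipped with the normalized counting measures; the ultraproducts of subsets form a Boolean algebra, a set is a nullset if it is contained in ultraproduct sets of arbitrarily small (ultralimit) measure, and the measurable sets (those differing from an ultraproduct set by a nullset) form a $\sigma$-algebra $\mathcal{B}_A$ with probability measure $\mu_A$ (the Loeb measure). $\sigma(A)=p_A^{-1}(\mathcal{B}_A)$ is the $\sigma$-algebra on ${\bf X}^k$ of measurable sets depending only on the $A$-coordinates ($p_A$ the projection ${\bf X}^{[k]}\to{\bf X}^A$), and $\sigma(A)^*$ is the $\sigma$-algebra generated by the $\sigma(B)$ for $B\subseteq A$, $|B|=|A|-1$. $r([k])$ denotes the set of nonempty subsets of $[k]$; $S_k$ acts on ${\bf X}^k$ by permuting coordinates and on $[0,1]^{r([k])}$ by permuting coordinates via the induced action on $r([k])$. A measurable set is independent from a $\sigma$-algebra $\mathcal{B}$ if its conditional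 expectation with respect to $\mathcal{B}$ is constant. A separable realization is a measure preserving map $\phi:{\bf X}^k\to[0,1]^{r([k])}$ (with $\mu_{[k]}$ on the source and Lebesgue measure on the target) such that (1) $\phi({\bf x})^\pi=\phi({\bf x}^\pi)$ for every $\pi\in S_k$, and (2) for every $D\in r([k])$ and measurable $I\subseteq[0,1]$ the set $\phi_D^{-1}(I)$ (with $\phi_D$ the $D$-coordinate function of $\phi$) lies in $\sigma(D)$ and is independent from $\sigma(D)^*$. *)

theory Defs
  imports "HOL-Probability.Probability" "HOL-Combinatorics.Permutations"
begin

section \<open>Ultraproducts\<close>

definition nonprincipal_ultrafilter :: "nat filter \<Rightarrow> bool" where
  "nonprincipal_ultrafilter \<omega> \<longleftrightarrow>
     \<omega> \<noteq> bot \<and>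
     (\<forall>P. eventually P \<omega> \<or> eventually (\<lambda>i. \<not> P i) \<omega>) \<and>
     (\<forall>n. \<omega> \<noteq> principal {n})"

definition ueq :: "nat filter \<Rightarrow> ((nat \<Rightarrow> 'b) \<times> (nat \<Rightarrow> 'b)) set" where
  "ueq \<omega> = {(f, g). eventually (\<lambda>i. f i = g i) \<omega>}"

text \<open>Sequences are only required to lie in \<open>S i\<close> for almost all \<open>i\<close>, so that the same definition
  yields the ultraproduct of the ambient sets and that of arbitrary (possibly empty) subsets of
  them, the latter being literally a subset of the former.\<close>

definition ultraproduct :: "nat filter \<Rightarrow> (nat \<Rightarrow> 'b set) \<Rightarrow> (nat \<Rightarrow> 'b) set set" where
  "ultraproduct \<omega> S = {f. eventually (\<lambda>i. f i \<in> S i) \<omega>} // ueq \<omega>"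

definition umap :: "nat filter \<Rightarrow> ('b \<Rightarrow> 'c) \<Rightarrow> (nat \<Rightarrow> 'b) set \<Rightarrow> (nat \<Rightarrow> 'c) set" where
  "umap \<omega> h x = (\<Union>f\<in>x. ueq \<omega> `` {\<lambda>i. h (f i)})"

lemma umap_class: "umap \<omega> h (ueq \<omega> `` {f}) = ueq \<omega> `` {\<lambda>i. h (f i)}"
proof -
  have eq: "ueq \<omega> `` {\<lambda>i. h (g i)} = ueq \<omega> `` {\<lambda>i. h (f i)}"
    if g: "g \<in> ueq \<omega> `` {f}" for g
  proof -
    have "eventually (\<lambda>i. h (f i) = h (g i)) \<omega>"
      using g unfolding ueq_def by (simp add: eventually_mono)
    then have "eventually (\<lambda>i. h (g i) = u i) \<omega> \<longleftrightarrow> eventually (\<lambda>i. h (f i) = u i) \<omega>" for u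
      by (rule eventually_cong) simp
    then show ?thesis
      by (simp add: ueq_def Image_def)
  qed
  have "f \<in> ueq \<omega> `` {f}"
    by (simp add: ueq_def)
  then show ?thesis
    unfolding umap_def using eq by blast
qed


section \<open>Loeb measures on the powers\<close>

text \<open>A point of \<open>X i\<close> to the power \<open>A\<close> is an extensional function on \<open>A\<close>, so that a point of the
  ultraproduct is a class of sequences of such functions.\<close>

type_synonym 'a upoint = "(nat \<Rightarrow> nat \<Rightarrow> 'a) set"

definition fpower :: "(nat \<Rightarrow> 'a set) \<Rightarrow> nat set \<Rightarrow> nat \<Rightarrow> (nat \<Rightarrow> 'a) set" where
  "fpower X A i = PiE A (\<lambda>_. X i)"

definition upower :: "nat filter \<Rightarrow> (nat \<Rightarrow> 'a set) \<Rightarrow> nat set \<Rightarrow> 'a upoint set" where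
  "upower \<omega> X A = ultraproduct \<omega> (fpower X A)"

definition umeasure :: "nat filter \<Rightarrow> (nat \<Rightarrow> 'a set) \<Rightarrow> nat set \<Rightarrow> (nat \<Rightarrow> (nat \<Rightarrow> 'a) set) \<Rightarrow> real" where
  "umeasure \<omega> X A S = Lim \<omega> (\<lambda>i. real (card (S i)) / real (card (fpower X A i)))"

definition loeb_null :: "nat filter \<Rightarrow> (nat \<Rightarrow> 'a set) \<Rightarrow> nat set \<Rightarrow> 'a upoint set \<Rightarrow> bool" where
  "loeb_null \<omega> X A N \<longleftrightarrow>
     (\<forall>\<epsilon>>0. \<exists>S. (\<forall>i. S i \<subseteq> fpower X A i) \<and> N \<subseteq> ultraproduct \<omega> S \<and> umeasure \<omega> X A S < \<epsilon>)"

definition loeb_approx ::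
    "nat filter \<Rightarrow> (nat \<Rightarrow> 'a set) \<Rightarrow> nat set \<Rightarrow> 'a upoint set \<Rightarrow> (nat \<Rightarrow> (nat \<Rightarrow> 'a) set) \<Rightarrow> bool" where
  "loeb_approx \<omega> X A M S \<longleftrightarrow>
     (\<forall>i. S i \<subseteq> fpower X A i) \<and> loeb_null \<omega> X A (sym_diff M (ultraproduct \<omega> S))"

definition loeb_sets :: "nat filter \<Rightarrow> (nat \<Rightarrow> 'a set) \<Rightarrow> nat set \<Rightarrow> 'a upoint set set" where
  "loeb_sets \<omega> X A = {M. M \<subseteq> upower \<omega> X A \<and> (\<exists>S. loeb_approx \<omega> X A M S)}"

definition loeb :: "nat filter \<Rightarrow> (nat \<Rightarrow> 'a set) \<Rightarrow> nat set \<Rightarrow> 'a upoint measure" where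
  "loeb \<omega> X A =
     measure_of (upower \<omega> X A) (loeb_sets \<omega> X A)
       (\<lambda>M. ennreal (THE r. \<exists>S. loeb_approx \<omega> X A M S \<and> r = umeasure \<omega> X A S))"


section \<open>The sigma-algebras on the \<open>k\<close>-th power\<close>

text \<open>These are represented by measures of which only the space and the measurable sets matter.\<close>

definition sigma_coord :: "nat filter \<Rightarrow> (nat \<Rightarrow> 'a set) \<Rightarrow> nat \<Rightarrow> nat set \<Rightarrow> 'a upoint measure" where
  "sigma_coord \<omega> X k A =
     vimage_algebra (upower \<omega> X {1..k}) (umap \<omega> (\<lambda>v. restrict v A)) (loeb \<omega> X A)"

text \<open>For a singleton \<open>A\<close> the only \<open>B\<close> is the empty set; since the empty power is a single point,
  the generated sigma-algebra is then trivial.\<close>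

definition sigma_coord_star :: "nat filter \<Rightarrow> (nat \<Rightarrow> 'a set) \<Rightarrow> nat \<Rightarrow> nat set \<Rightarrow> 'a upoint measure" where
  "sigma_coord_star \<omega> X k A =
     sigma (upower \<omega> X {1..k})
       (\<Union>B\<in>{B. B \<subseteq> A \<and> card B = card A - 1}. sets (sigma_coord \<omega> X k B))"

definition independent_from :: "'b measure \<Rightarrow> 'b measure \<Rightarrow> 'b set \<Rightarrow> bool" where
  "independent_from M F S \<longleftrightarrow>
     (\<exists>c. AE x in M. real_cond_exp M F (indicator S) x = c)"

text \<open>Separability with respect to the pseudometric given by the measure of the symmetric
  difference.\<close>

definition separable_algebra :: "'b measure \<Rightarrow> 'b set set \<Rightarrow> bool" where
  "separable_algebra M \<A> \<longleftrightarrow>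
     (\<exists>\<C>\<subseteq>\<A>. countable \<C> \<and> (\<forall>A\<in>\<A>. \<forall>\<epsilon>>0. \<exists>C\<in>\<C>. measure M (sym_diff A C) < \<epsilon>))"


section \<open>Separable realizations\<close>

definition nonempty_subsets :: "nat \<Rightarrow> nat set set" where
  "nonempty_subsets k = {D. D \<subseteq> {1..k} \<and> D \<noteq> {}}"

definition cube :: "nat \<Rightarrow> (nat set \<Rightarrow> real) measure" where
  "cube k = completion (PiM (nonempty_subsets k) (\<lambda>_. restrict_space lborel {0..1}))"

definition perm_point :: "nat filter \<Rightarrow> nat \<Rightarrow> (nat \<Rightarrow> nat) \<Rightarrow> 'a upoint \<Rightarrow> 'a upoint" where
  "perm_point \<omega> k \<pi> = umap \<omega> (\<lambda>v. \<lambda>j\<in>{1..k}. v (\<pi> j))"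

definition perm_cube :: "nat \<Rightarrow> (nat \<Rightarrow> nat) \<Rightarrow> (nat set \<Rightarrow> real) \<Rightarrow> nat set \<Rightarrow> real" where
  "perm_cube k \<pi> y = (\<lambda>D\<in>nonempty_subsets k. y (\<pi> ` D))"

definition measure_preserving_map :: "'b measure \<Rightarrow> 'c measure \<Rightarrow> ('b \<Rightarrow> 'c) \<Rightarrow> bool" where
  "measure_preserving_map M N f \<longleftrightarrow> f \<in> measurable M N \<and> distr M N f = N"

definition separable_realization ::
    "nat filter \<Rightarrow> (nat \<Rightarrow> 'a set) \<Rightarrow> nat \<Rightarrow> ('a upoint \<Rightarrow> nat set \<Rightarrow> real) \<Rightarrow> bool" where
  "separable_realization \<omega> X k \<phi> \<longleftrightarrow>
     measure_preserving_map (loeb \<omega> X {1..k}) (cube k) \<phi> \<and>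
     (\<forall>\<pi>. \<pi> permutes {1..k} \<longrightarrow>
        (\<forall>x\<in>upower \<omega> X {1..k}. perm_cube k \<pi> (\<phi> x) = \<phi> (perm_point \<omega> k \<pi> x))) \<and>
     (\<forall>D\<in>nonempty_subsets k. \<forall>I\<in>sets (lebesgue_on {0..1}).
        let P = {x \<in> upower \<omega> X {1..k}. \<phi> x D \<in> I}
        in P \<in> sets (sigma_coord \<omega> X k D) \<and>
           independent_from (loeb \<omega> X {1..k}) (sigma_coord_star \<omega> X k D) P)"

end

theory Submission
  imports Defs
begin

text \<open>Countable saturation of the ultraproduct makes the internal sets generate a complete
  probability space in which every measurable set is almost everywhere internal. Let \<open>r \<ge> 1\<close> and let
  \<open>S\<^sub>r\<close> be the sigma-algebra generated by the sets depending on fewer than \<open>r\<close> coordinates of the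
  \<open>r\<close>-th power. A random subset of the finite power \<open>X\<^sub>i\<^sup>r\<close> fails to halve a given set up to a small error
  with probability exponentially small in \<open>|X\<^sub>i|\<^sup>r\<close>, while there are only \<open>exp (O(|X\<^sub>i|\<^sup>r\<^sup>-\<^sup>1))\<close>
  cylinders; hence the Loeb sigma-algebra is atomless relative to \<open>S\<^sub>r\<close>.
  Refining a given countable family by such halvings and applying the conditional distribution
  function given \<open>S\<^sub>r\<close> yields a uniform function \<open>h\<^sub>r\<close> that is independent of \<open>S\<^sub>r\<close> and generates the
  family together with countably many sets of \<open>S\<^sub>r\<close>; these sets are passed on to level \<open>r - 1\<close>.
  An auxiliary uniform function on the first power sorts the coordinates of almost every point, so \<open>h\<^sub>r\<close>
  may be replaced by the symmetric function that evaluates \<open>h\<^sub>r\<close> at the sorted point.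
  Joint independence follows by freezing, at each finite stage, the coordinates outside of \<open>D\<close> at
  the worst value.\<close>

text \<open>The two demands on a realization pull apart. Equivariance forces the coordinate
  functions of all \<open>D\<close> with \<open>r\<close> elements to come from one symmetric
  function on the \<open>r\<close>-th power, while the given sets have no symmetry. Sorting
  reconciles them: on the sorted points a symmetric function can carry everything that
  \<open>h\<^sub>r\<close> carries, and the other orderings are reached because all permuted copies
  of the given sets are fed into the construction. The price is that the set of sorted points must
  itself be generated by the realization; this is why rational level sets of the auxiliary function
  join the countable family handed to the lower level. The second obstacle is that the Loeb
  sigma-algebra of a power is in general larger than the product of those of its factors, so product
  measures give no joint independence. Only the finite counting measures split into products; such
  arguments are carried out there and passed to the ultralimit. Equivariance is moreover required at
  every point, so the exceptional points with ties receive a default value that is symmetric as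
  well.\<close>

section \<open>Generated sigma-algebras: proportional measures and countable generators\<close>

text \<open>The sets on which two finite measures are proportional form a Dynkin class, so an
  intersection-stable generator suffices. Keeping both \<open>S\<close> and \<open>T\<close> serves
  two uses: with \<open>S\<close> a part of \<open>T\<close> and \<open>c = 1 / 2\<close> the
  identity expresses halving, with \<open>T\<close> the whole space it expresses
  independence.\<close>

lemma (in prob_space) prob_proportional_sigma_sets:
  assumes "Int_stable \<G>" and sub: "\<G> \<subseteq> events" and sp: "space M \<in> \<G>"
    and S: "S \<in> events" "T \<in> events"
    and eq: "\<And>G. G \<in> \<G> \<Longrightarrow> prob (S \<inter> G) = c * prob (T \<inter> G)"
    and G: "G \<in> sigma_sets (space M) \<G>"
  shows "prob (S \<inter> G) = c * prob (T \<inter> G)"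
proof -
  have "\<G> \<subseteq> Pow (space M)"
    using sub sets.space_closed by blast
  from assms(1) this G show ?thesis
  proof (induction rule: sigma_sets_induct_disjoint)
    case (basic A)
    then show ?case by (rule eq)
  next
    case empty
    then show ?case by simp
  next
    case (compl A)
    have A: "A \<in> events"
      using compl(1) sub sets.sigma_sets_subset by blast
    have "prob (S \<inter> (space M - A)) = prob S - prob (S \<inter> A)" if "S \<in> events" for S
    proof -
      have "S \<inter> (space M - A) = S - S \<inter> A"
        using sets.sets_into_space[OF that] by auto
      then show ?thesis
        using finite_measure_Diff[of S "S \<inter> A"] that A by auto
    qed
    then have "prob (S \<inter> (space M - A)) = prob S - prob (S \<inter> A)"
      "prob (T \<inter> (space M - A)) = prob T - prob (T \<inter> A)"
      using S by auto
    moreover have "prob S = c * prob T"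
      using eq[OF sp] S by (simp add: sets.Int_space_eq2)
    ultimately show ?case
      using compl(2) by (simp add: right_diff_distrib)
  next
    case (union A)
    have A: "range A \<subseteq> events"
      using union(2) sub sets.sigma_sets_subset by blast
    have sums: "(\<lambda>i. prob (S \<inter> A i)) sums prob (S \<inter> \<Union> (range A))" if "S \<in> events" for S
    proof -
      have "(\<lambda>i. prob (S \<inter> A i)) sums prob (\<Union>i. S \<inter> A i)"
      proof (rule finite_measure_UNION)
        show "range (\<lambda>i. S \<inter> A i) \<subseteq> events"
          using A that by (simp add: image_subset_iff sets.Int)
        show "disjoint_family (\<lambda>i. S \<inter> A i)"
          using union(1) unfolding disjoint_family_on_def by blast
      qed
      moreover have "(\<Union>i. S \<inter> A i) = S \<inter> \<Union> (range A)"
        by blast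
      ultimately show ?thesis
        by (simp only:)
    qed
    have "(\<lambda>i. prob (S \<inter> A i)) sums (c * prob (T \<inter> \<Union> (range A)))"
      using sums_mult[OF sums[OF S(2)], of c] union(3) by simp
    then show ?case
      using sums[OF S(1)] sums_unique2 by blast
  qed
qed

text \<open>The sets generated by some countable subfamily already form a sigma-algebra, since a
  countable union of countable families is countable. This lets the recursion over the levels pass
  on only countably many sets.\<close>

lemma sigma_sets_countable_generator:
  assumes "E \<in> sigma_sets \<Omega> \<G>"
  obtains \<G>' where "countable \<G>'" "\<G>' \<subseteq> \<G>" "E \<in> sigma_sets \<Omega> \<G>'"
proof -
  have "\<exists>\<G>'. countable \<G>' \<and> \<G>' \<subseteq> \<G> \<and> E \<in> sigma_sets \<Omega> \<G>'"
    using assms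
  proof induction
    case (Basic a)
    then show ?case
      by (intro exI[of _ "{a}"]) auto
  next
    case Empty
    then show ?case
      by (intro exI[of _ "{}"]) (auto intro: sigma_sets.Empty)
  next
    case (Compl a)
    then show ?case
      by (auto intro: sigma_sets.Compl)
  next
    case (Union a)
    then obtain g where g: "\<And>i. countable (g i)" "\<And>i. g i \<subseteq> \<G>" "\<And>i. a i \<in> sigma_sets \<Omega> (g i)"
      by metis
    have "a i \<in> sigma_sets \<Omega> (\<Union>i. g i)" for i :: nat
      using g(3)[of i] sigma_sets_mono'[of "g i" "\<Union>i. g i"] by blast
    then show ?case
      using g(1,2) by (intro exI[of _ "\<Union>i. g i"] conjI sigma_sets.Union) auto
  qed
  then show ?thesis
    using that by blast
qed


section \<open>The conditional distribution function transform\<close>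

text \<open>A single product formula encodes both the uniform law (\<open>G\<close> the whole space)
  and independence from \<open>F\<close>. The range condition is imposed at every point, because the
  realization must map every point into the cube.\<close>

definition uniform_over :: "'b measure \<Rightarrow> 'b measure \<Rightarrow> ('b \<Rightarrow> real) \<Rightarrow> bool" where
  "uniform_over M F h \<longleftrightarrow>
     h \<in> borel_measurable M \<and> (\<forall>x\<in>space M. h x \<in> {0..1}) \<and>
     (\<forall>G\<in>sets F. \<forall>t\<in>{0..1}. measure M ({x\<in>space M. h x \<le> t} \<inter> G) = t * measure M G)"

text \<open>Relative atomlessness in a form without conditional expectations: inside each of
  finitely many sets at once, one \<open>V\<close> takes half of the conditional probability given
  \<open>F\<close>.\<close>

definition halving_over :: "'b measure \<Rightarrow> 'b measure \<Rightarrow> bool" where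
  "halving_over M F \<longleftrightarrow>
     (\<forall>\<S>. finite \<S> \<and> \<S> \<subseteq> sets M \<longrightarrow>
        (\<exists>V\<in>sets M. \<forall>S\<in>\<S>. \<forall>G\<in>sets F. measure M (S \<inter> V \<inter> G) = 1 / 2 * measure M (S \<inter> G)))"

definition sigma_join :: "'b measure \<Rightarrow> 'b measure \<Rightarrow> ('b \<Rightarrow> real) \<Rightarrow> 'b measure" where
  "sigma_join M F h =
     sigma (space M) (sets F \<union> {{x \<in> space M. h x \<in> I} | I. I \<in> sets borel})"

text \<open>Keeping exactly the cells whose left end is at most \<open>t\<close> overshoots
  \<open>t\<close> by at most one cell, hence by at most \<open>\<epsilon>\<close>. The third
  conjunct carries the induction: before \<open>t\<close> is passed nothing has been dropped,
  afterwards nothing is added. It is applied with \<open>p\<close> the conditional probabilities of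
  the cells.\<close>

lemma sum_truncated_partition:
  fixes p :: "nat \<Rightarrow> real"
  assumes "0 \<le> t" "0 \<le> \<epsilon>" and p: "\<And>j. j < N \<Longrightarrow> 0 \<le> p j \<and> p j \<le> \<epsilon>"
  defines "Z n \<equiv> \<Sum>j<n. p j * of_bool ((\<Sum>i<j. p i) \<le> t)"
  shows "min t (\<Sum>i<N. p i) \<le> Z N \<and> Z N \<le> t + \<epsilon> \<and> ((\<Sum>i<N. p i) \<le> t \<longrightarrow> Z N = (\<Sum>i<N. p i))"
  using p
proof (induction N)
  case 0
  then show ?case
    using assms(1,2) by (simp add: Z_def)
next
  case (Suc N)
  have IH: "min t (\<Sum>i<N. p i) \<le> Z N" "Z N \<le> t + \<epsilon>" "(\<Sum>i<N. p i) \<le> t \<Longrightarrow> Z N = (\<Sum>i<N. p i)"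
    using Suc by auto
  have ZS: "Z (Suc N) = Z N + p N * of_bool ((\<Sum>i<N. p i) \<le> t)"
    by (simp add: Z_def)
  have pN: "0 \<le> p N" "p N \<le> \<epsilon>"
    using Suc.prems by auto
  show ?case
  proof (cases "(\<Sum>i<N. p i) \<le> t")
    case True
    then show ?thesis
      using ZS IH(3) pN by auto
  next
    case False
    then show ?thesis
      using ZS IH pN by auto
  qed
qed

context finite_measure_subalgebra
begin

text \<open>Slabs of height \<open>1 / N\<close> of the values of \<open>s\<close> lie in
  \<open>F\<close>; within a slab, \<open>h = s\<close> confines \<open>h\<close> to an interval of
  length \<open>1 / N\<close>, which by independence costs a factor \<open>1 / N\<close>. Summing
  over the disjoint slabs gives a bound that tends to 0.\<close>

lemma uniform_over_null_graph:
  assumes h: "uniform_over M F h" and s: "s \<in> borel_measurable F" and "prob_space M"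
  shows "{x \<in> space M. h x = s x} \<in> null_sets M"
proof -
  interpret prob_space M by fact
  have FM: "sets F \<subseteq> sets M" and spF: "space F = space M"
    using subalg by (auto simp: subalgebra_def)
  have [measurable]: "h \<in> borel_measurable M" "s \<in> borel_measurable M"
    using h measurable_from_subalg[OF subalg s] by (auto simp: uniform_over_def)
  have le: "measure M {x \<in> space M. h x = s x} \<le> 2 / real (Suc n)" for n
  proof -
    define N where "N = real (Suc n)"
    have N: "N > 0"
      by (simp add: N_def)
    define G where "G j = {x \<in> space M. (real j - 1) / N < s x \<and> s x \<le> real j / N}" for j
    have "G j = {x \<in> space F. (real j - 1) / N < s x \<and> s x \<le> real j / N}" for j
      by (simp add: G_def spF)
    then have GF: "G j \<in> sets F" for j
      using s by simp
    have GM [measurable]: "G j \<in> sets M" for j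
      using GF FM by auto
    define H where "H t = {x \<in> space M. h x \<le> t}" for t
    have HM [measurable]: "H t \<in> sets M" for t
      unfolding H_def by measurable
    have Hm: "measure M (H t \<inter> G j) = t * measure M (G j)" if "0 \<le> t" "t \<le> 1" for t j
      using h GF that by (auto simp: uniform_over_def H_def)
    \<comment> \<open>The slab \<open>j = 0\<close> is treated apart: there \<open>h = s\<close>
      forces \<open>h = 0\<close>, and \<open>- 1 / N\<close> is no admissible level in
      \<open>uniform_over\<close>.\<close>
    define P where "P j = (if j = 0 then H 0 else H (real j / N) - H ((real j - 1) / N)) \<inter> G j" for j :: nat
    have PM [measurable]: "P j \<in> sets M" for j
      using HM GM by (auto simp: P_def)
    have Pm: "measure M (P j) \<le> measure M (G j) / N" if "j \<le> Suc n" for j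
    proof (cases "j = 0")
      case True
      then show ?thesis
        using Hm[of 0 0] N by (simp add: P_def)
    next
      case False
      have b: "0 \<le> (real j - 1) / N" "(real j - 1) / N \<le> 1" "0 \<le> real j / N" "real j / N \<le> 1"
        using that False N by (auto simp: N_def field_simps)
      have "P j = (H (real j / N) \<inter> G j) - (H ((real j - 1) / N) \<inter> G j)"
        using False by (auto simp: P_def)
      moreover have "H ((real j - 1) / N) \<inter> G j \<subseteq> H (real j / N) \<inter> G j"
        using N by (auto simp: H_def field_simps)
      ultimately have "measure M (P j) = real j / N * measure M (G j) - (real j - 1) / N * measure M (G j)"
        using Hm[OF b(1,2), of j] Hm[OF b(3,4), of j] by (simp add: finite_measure_Diff)
      also have "\<dots> = (real j / N - (real j - 1) / N) * measure M (G j)"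
        by (simp add: left_diff_distrib)
      also have "real j / N - (real j - 1) / N = 1 / N"
        by (simp add: diff_divide_distrib)
      finally show ?thesis
        by simp
    qed
    have cover: "{x \<in> space M. h x = s x} \<subseteq> (\<Union>j\<in>{..Suc n}. P j)"
    proof
      fix x
      assume "x \<in> {x \<in> space M. h x = s x}"
      then have x: "x \<in> space M" "h x = s x" "0 \<le> h x" "h x \<le> 1"
        using h by (auto simp: uniform_over_def)
      define j where "j = nat \<lceil>s x * N\<rceil>"
      have j: "real j - 1 < s x * N" "s x * N \<le> real j"
      proof -
        have "0 \<le> s x * N"
          using x N by simp
        then have "real j = real_of_int \<lceil>s x * N\<rceil>"
          by (simp add: j_def)
        then show "real j - 1 < s x * N" "s x * N \<le> real j"
          using ceiling_correct[of "s x * N"] by simp_all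
      qed
      have "s x * N \<le> N"
        using x N by (simp add: mult_left_le_one_le)
      moreover have "real_of_int (int (Suc n)) = N"
        by (simp add: N_def)
      ultimately have "\<lceil>s x * N\<rceil> \<le> int (Suc n)"
        by (metis ceiling_le)
      then have jn: "j \<le> Suc n"
        by (simp only: j_def nat_le_iff)
      have xG: "x \<in> G j"
        using x(1) j N by (simp add: G_def field_simps)
      have "x \<in> P j"
      proof (cases "j = 0")
        case True
        then show ?thesis
          using xG x N by (simp add: P_def H_def G_def)
      next
        case False
        then show ?thesis
          using xG x N by (simp add: P_def H_def G_def)
      qed
      then show "x \<in> (\<Union>j\<in>{..Suc n}. P j)"
        using jn by blast
    qed
    have disj: "disjoint_family_on G {..Suc n}"
    proof -
      have "i = j" if "x \<in> G i" "x \<in> G j" for x i j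
      proof -
        have "real i - 1 < real j" "real j - 1 < real i"
          using that N less_le_trans by (fastforce simp: G_def field_simps)+
        then show ?thesis
          by linarith
      qed
      then show ?thesis
        by (auto simp: disjoint_family_on_def)
    qed
    have "measure M {x \<in> space M. h x = s x} \<le> measure M (\<Union>j\<in>{..Suc n}. P j)"
      using cover by (intro finite_measure_mono) auto
    also have "\<dots> \<le> (\<Sum>j\<le>Suc n. measure M (P j))"
      by (intro finite_measure_subadditive_finite) auto
    also have "\<dots> \<le> (\<Sum>j\<le>Suc n. measure M (G j) / N)"
      using Pm by (intro sum_mono) auto
    also have "\<dots> = measure M (\<Union>j\<in>{..Suc n}. G j) / N"
      using disj GM by (subst finite_measure_finite_Union) (auto simp: sum_divide_distrib[symmetric] simp del: sum.atMost_Suc)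
    also have "\<dots> \<le> 1 / N"
      using N prob_le_1 by (simp add: divide_right_mono)
    also have "\<dots> \<le> 2 / N"
      using N by (simp add: field_simps)
    finally show ?thesis
      by (simp add: N_def)
  qed
  have "(\<lambda>n. 2 / real (Suc n)) \<longlonglongrightarrow> 0"
    using LIMSEQ_Suc[OF lim_const_over_n[of 2]] by simp
  then have "measure M {x \<in> space M. h x = s x} \<le> 0"
    using le by (intro LIMSEQ_le_const) auto
  then show ?thesis
    by (intro null_setsI) (auto simp: emeasure_eq_measure measure_le_0_iff)
qed

lemma real_cond_exp_halving:
  assumes "S \<in> sets M" "V \<in> sets M"
    and half: "\<And>G. G \<in> sets F \<Longrightarrow> measure M (S \<inter> V \<inter> G) = 1 / 2 * measure M (S \<inter> G)"
  shows "AE x in M. real_cond_exp M F (indicator (S \<inter> V)) x = 1 / 2 * real_cond_exp M F (indicator S) x"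
proof -
  have FM: "sets F \<subseteq> sets M"
    using subalg by (auto simp: subalgebra_def)
  have ind: "integrable M (indicator S :: _ \<Rightarrow> real)" if "S \<in> sets M" for S
    using that by (simp add: integrable_real_indicator less_top[symmetric])
  have int: "(\<integral>x\<in>A. indicator T x \<partial>M) = (measure M (T \<inter> A) :: real)"
    if "T \<in> sets M" and AM: "A \<in> sets M" for A T
  proof -
    have "(\<integral>x\<in>A. indicator T x \<partial>M) = (\<integral>x. indicator (T \<inter> A) x \<partial>M :: real)"
      by (auto simp: set_lebesgue_integral_def indicator_def intro!: Bochner_Integration.integral_cong)
    also have "\<dots> = measure M (T \<inter> A)"
      using that sets.sets_into_space[OF that(1)] by (simp add: Int_absorb2 le_infI1)
    finally show ?thesis .
  qed
  show ?thesis
  proof (rule real_cond_exp_charact)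
    fix A
    assume A: "A \<in> sets F"
    then have AM: "A \<in> sets M"
      using FM by auto
    have "(\<integral>x\<in>A. 1 / 2 * real_cond_exp M F (indicator S) x \<partial>M)
        = 1 / 2 * (\<integral>x\<in>A. real_cond_exp M F (indicator S) x \<partial>M)"
      by (rule set_integral_mult_right)
    also have "\<dots> = 1 / 2 * measure M (S \<inter> A)"
      using real_cond_exp_intA[OF ind[OF assms(1)] A] int[OF assms(1) AM] by simp
    finally show "(\<integral>x\<in>A. indicator (S \<inter> V) x \<partial>M)
        = (\<integral>x\<in>A. 1 / 2 * real_cond_exp M F (indicator S) x \<partial>M)"
      using half[OF A] int[of "S \<inter> V", OF _ AM] assms by simp
  next
    show "integrable M (indicator (S \<inter> V) :: _ \<Rightarrow> real)"
      using ind[of "S \<inter> V"] assms by auto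
    show "integrable M (\<lambda>x. 1 / 2 * real_cond_exp M F (indicator S) x)"
      using real_cond_exp_int(1)[OF ind[OF assms(1)]] by simp
  qed simp
qed

text \<open>The values of \<open>a n\<close> number the cells of the \<open>n\<close>-th of a sequence of refining partitions, and
  \<open>h\<close> is the limit of the conditional probability of the union of the cells preceding that of \<open>x\<close>.
  The \<open>j\<close>-th cell is then recovered as the set where \<open>h\<close> lies between two functions measurable with
  respect to \<open>F\<close>.\<close>

lemma cond_distribution_transform:
  fixes a :: "nat \<Rightarrow> 'a \<Rightarrow> nat"
  assumes "prob_space M"
    and am [measurable]: "\<And>n. a n \<in> measurable M (count_space UNIV)"
    and bound: "\<And>n x. x \<in> space M \<Longrightarrow> a n x < 4 ^ n"
    and refine: "\<And>n x. x \<in> space M \<Longrightarrow> a (Suc n) x div 4 = a n x"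
    and small: "\<And>n j. AE x in M. real_cond_exp M F (indicator {x \<in> space M. a n x = j}) x \<le> (1 / 2) ^ n"
  obtains h where "uniform_over M F h"
    "\<And>n j. \<exists>E\<in>sets (sigma_join M F h). AE x in M. x \<in> E \<longleftrightarrow> a n x = j"
proof -
  interpret prob_space M by fact
  have FM: "sets F \<subseteq> sets M" and spF: "space F = space M"
    using subalg by (auto simp: subalgebra_def)
  define P where "P n j = {x \<in> space M. a n x = j}" for n j
  have PM [measurable]: "P n j \<in> sets M" for n j
    unfolding P_def by measurable
  have ind: "integrable M (indicator S :: _ \<Rightarrow> real)" if "S \<in> sets M" for S
    using that by (simp add: integrable_real_indicator less_top[symmetric])
  define p where "p n j = real_cond_exp M F (indicator (P n j))" for n j
  have pF [measurable]: "p n j \<in> borel_measurable F" for n j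
    by (simp add: p_def)
  have pM [measurable]: "p n j \<in> borel_measurable M" for n j
    using measurable_from_subalg[OF subalg pF] .
  \<comment> \<open>\<open>s n j\<close> is the conditional probability of the first
    \<open>j\<close> cells, that is, the left end of cell \<open>j\<close>. These ends are
    measurable with respect to \<open>F\<close>, so they can be compared with \<open>h\<close>
    inside \<open>sigma_join\<close>.\<close>
  define s where "s n j x = (\<Sum>i<j. p n i x)" for n j x
  have sF [measurable]: "s n j \<in> borel_measurable F" for n j
    unfolding s_def by measurable
  have sM [measurable]: "s n j \<in> borel_measurable M" for n j
    using measurable_from_subalg[OF subalg sF] .
  have rce_sum: "AE x in M. real_cond_exp M F (\<lambda>x. \<Sum>i\<in>I. indicator (P n (f i)) x) x = (\<Sum>i\<in>I. p n (f i) x)"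
    for I :: "nat set" and f n
    unfolding p_def using ind[OF PM] by (intro real_cond_exp_sum) auto
  have total: "AE x in M. s n (4 ^ n) x = 1" for n
  proof -
    have "AE x in M. real_cond_exp M F (\<lambda>x. \<Sum>i<4 ^ n. indicator (P n i) x) x
        = real_cond_exp M F (\<lambda>x. 1) x"
    proof (rule real_cond_exp_cong)
      have "(\<Sum>i<4 ^ n. indicator (P n i) x :: real) = 1" if "x \<in> space M" for x
        using bound[OF that, of n] that
        by (simp add: P_def indicator_def of_bool_def sum.delta if_distrib cong: if_cong)
      then show "AE x in M. (\<Sum>i<4 ^ n. indicator (P n i) x :: real) = 1"
        by auto
    qed auto
    moreover have "AE x in M. real_cond_exp M F (\<lambda>x. 1) x = 1"
      by (rule real_cond_exp_F_meas) auto
    ultimately show ?thesis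
      using rce_sum[of n "\<lambda>i. i" "{..<4 ^ n}"] by eventually_elim (simp add: s_def)
  qed
  \<comment> \<open>The four children of cell \<open>j\<close> are numbered \<open>4 * j\<close> to
    \<open>4 * j + 3\<close>, so the ends of the coarse cells reappear among those of the fine
    ones.\<close>
  have split: "AE x in M. p n j x = (\<Sum>d<4. p (Suc n) (4 * j + d) x)" for n j
  proof -
    have "AE x in M. real_cond_exp M F (\<lambda>x. \<Sum>d<4. indicator (P (Suc n) (4 * j + d)) x) x
        = real_cond_exp M F (indicator (P n j)) x"
    proof (rule real_cond_exp_cong)
      have "(\<Sum>d<4. indicator (P (Suc n) (4 * j + d)) x :: real) = indicator (P n j) x" if "x \<in> space M" for x
      proof -
        have "(\<Sum>d<4. indicator (P (Suc n) (4 * j + d)) x :: real)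
            = (\<Sum>d<4. if d = a (Suc n) x mod 4 then of_bool (a (Suc n) x div 4 = j) else 0)"
        proof (intro sum.cong refl)
          fix d :: nat
          assume "d \<in> {..<4}"
          then have "a (Suc n) x = 4 * j + d \<longleftrightarrow> d = a (Suc n) x mod 4 \<and> a (Suc n) x div 4 = j"
            by auto
          then show "(indicator (P (Suc n) (4 * j + d)) x :: real)
              = (if d = a (Suc n) x mod 4 then of_bool (a (Suc n) x div 4 = j) else 0)"
            using that by (auto simp: P_def indicator_def)
        qed
        also have "\<dots> = of_bool (a (Suc n) x div 4 = j)"
          by (simp add: sum.delta)
        finally show ?thesis
          using refine[OF that, of n] that by (simp add: P_def indicator_def)
      qed
      then show "AE x in M. (\<Sum>d<4. indicator (P (Suc n) (4 * j + d)) x :: real) = indicator (P n j) x"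
        by auto
    qed auto
    then show ?thesis
      using rce_sum[of "Suc n" "\<lambda>d. 4 * j + d" "{..<4}"] by eventually_elim (simp add: p_def)
  qed
  have pos: "AE x in M. 0 \<le> p n j x" for n j
    unfolding p_def by (rule real_cond_exp_pos) (auto simp: PM)
  have small': "AE x in M. p n j x \<le> (1 / 2) ^ n" for n j
    using small[of n j] by (simp add: p_def P_def)
  have good: "AE x in M. (\<forall>n j. 0 \<le> p n j x \<and> p n j x \<le> (1 / 2) ^ n) \<and> (\<forall>n. s n (4 ^ n) x = 1)
      \<and> (\<forall>n j. s (Suc n) (4 * j) x = s n j x)"
  proof -
    have "AE x in M. \<forall>n j. p n j x = (\<Sum>d<4. p (Suc n) (4 * j + d) x)"
      using split by (simp add: AE_all_countable)
    moreover have imp: "s (Suc n) (4 * j) x = s n j x"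
      if "\<forall>n j. p n j x = (\<Sum>d<4. p (Suc n) (4 * j + d) x)" for x n j
    proof (induction j)
      case 0
      then show ?case by (simp add: s_def)
    next
      case (Suc j)
      have "s (Suc n) (4 * Suc j) x = s (Suc n) (4 * j) x + (\<Sum>d<4. p (Suc n) (4 * j + d) x)"
        by (simp add: s_def eval_nat_numeral)
      also have "\<dots> = s n j x + p n j x"
        using Suc that[rule_format, of n j] by simp
      finally show ?case
        by (simp add: s_def)
    qed
    ultimately have "AE x in M. \<forall>n j. s (Suc n) (4 * j) x = s n j x"
      by (elim eventually_mono) blast
    moreover have "AE x in M. \<forall>n j. 0 \<le> p n j x" "AE x in M. \<forall>n j. p n j x \<le> (1 / 2) ^ n"
      "AE x in M. \<forall>n. s n (4 ^ n) x = 1"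
      using pos small' total by (simp_all only: AE_all_countable) blast+
    ultimately show ?thesis
      by eventually_elim blast
  qed
  define hn where "hn n x = s n (a n x) x" for n x
  have hnM [measurable]: "hn n \<in> borel_measurable M" for n
  proof -
    have "hn n = (\<lambda>x. s n (a n x) x)"
      by (auto simp: hn_def)
    then show ?thesis
      by (simp add: measurable_compose_countable'[where I = UNIV and f = "\<lambda>j x. s n j x"])
  qed
  \<comment> \<open>Clamping keeps the values in the unit interval also on the null set where the
    limit is arbitrary; almost everywhere it changes nothing.\<close>
  define h where "h x = max 0 (min 1 (lim (\<lambda>n. hn n x)))" for x
  have hM [measurable]: "h \<in> borel_measurable M"
    unfolding h_def by measurable
  \<comment> \<open>The intervals from \<open>s n (a n x)\<close> to
    \<open>s n (Suc (a n x))\<close> are nested and of length at most \<open>(1 / 2) ^ n\<close>;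
    \<open>h x\<close> is their common point.\<close>
  have approx: "AE x in M. \<forall>n. s n (a n x) x \<le> h x \<and> h x \<le> s n (Suc (a n x)) x \<and> hn n x \<le> h x \<and> h x \<le> hn n x + (1 / 2) ^ n"
  proof -
    have imp: "\<forall>n. s n (a n x) x \<le> h x \<and> h x \<le> s n (Suc (a n x)) x \<and> hn n x \<le> h x \<and> h x \<le> hn n x + (1 / 2) ^ n"
      if p: "\<forall>n j. 0 \<le> p n j x \<and> p n j x \<le> (1 / 2) ^ n" and tot: "\<forall>n. s n (4 ^ n) x = 1"
        and sp: "\<forall>n j. s (Suc n) (4 * j) x = s n j x" and x: "x \<in> space M" for x
    proof -
      have mono: "s n i x \<le> s n j x" if "i \<le> j" for n i j
        unfolding s_def using p that by (intro sum_mono2) auto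
      have up: "hn n x \<le> hn (Suc n) x" "s (Suc n) (Suc (a (Suc n) x)) x \<le> s n (Suc (a n x)) x" for n
      proof -
        obtain r where "a (Suc n) x = 4 * a n x + r" "r < 4"
          using refine[OF x, of n] by (metis mult_div_mod_eq mod_less_divisor zero_less_numeral)
        then have "4 * a n x \<le> a (Suc n) x" "Suc (a (Suc n) x) \<le> 4 * Suc (a n x)"
          by auto
        then show "hn n x \<le> hn (Suc n) x" "s (Suc n) (Suc (a (Suc n) x)) x \<le> s n (Suc (a n x)) x"
          using mono sp unfolding hn_def by metis+
      qed
      have inc: "incseq (\<lambda>n. hn n x)" and dec: "decseq (\<lambda>n. s n (Suc (a n x)) x)"
        using up by (auto intro: incseq_SucI decseq_SucI)
      have sum: "s n (Suc (a n x)) x = hn n x + p n (a n x) x" for n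
        by (simp add: hn_def s_def)
      have le: "hn m x \<le> s n (Suc (a n x)) x" for m n
      proof -
        have "hn m x \<le> hn (max m n) x"
          using inc by (simp add: incseq_def)
        also have "\<dots> \<le> s (max m n) (Suc (a (max m n) x)) x"
          using sum p by simp
        also have "\<dots> \<le> s n (Suc (a n x)) x"
          using dec by (simp add: decseq_def)
        finally show ?thesis .
      qed
      have "convergent (\<lambda>n. hn n x)"
        using inc le[of _ 0] by (meson incseq_convergent convergentI)
      then have lim: "(\<lambda>n. hn n x) \<longlonglongrightarrow> lim (\<lambda>n. hn n x)"
        by (simp add: convergent_LIMSEQ_iff)
      have lo: "hn n x \<le> lim (\<lambda>n. hn n x)" for n
        using incseq_le[OF inc lim] .
      have hi: "lim (\<lambda>n. hn n x) \<le> s n (Suc (a n x)) x" for n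
        using lim le by (intro LIMSEQ_le_const2) auto
      have "0 \<le> hn 0 x"
        using mono[of 0 "a 0 x" 0] by (simp add: hn_def s_def)
      moreover have "s 0 (Suc (a 0 x)) x \<le> 1"
        using bound[OF x, of 0] tot[rule_format, of 0] by simp
      ultimately have "h x = lim (\<lambda>n. hn n x)"
        using lo[of 0] hi[of 0] by (simp add: h_def)
      moreover have "s n (Suc (a n x)) x \<le> hn n x + (1 / 2) ^ n" for n
        using sum p by simp
      ultimately show ?thesis
        using lo hi by (metis hn_def order.trans)
    qed
    show ?thesis
      using good AE_space by eventually_elim (use imp in blast)
  qed
  have uni: "uniform_over M F h"
    unfolding uniform_over_def
  proof (intro conjI ballI)
    fix G and t :: real
    assume G: "G \<in> sets F" and t: "t \<in> {0..1}"
    then have [measurable]: "G \<in> sets M"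
      using FM by auto
    define m where "m n t = measure M ({x \<in> space M. hn n x \<le> t} \<inter> G)" for n t
    \<comment> \<open>All factors but \<open>indicator (P n j)\<close> are measurable with respect
      to \<open>F\<close>, so under the integral this indicator may be replaced by its conditional
      expectation \<open>p n j\<close>; the integrand becomes the truncated sum
      \<open>Z\<close>.\<close>
    have m: "min t 1 * measure M G \<le> m n t" "m n t \<le> (t + (1 / 2) ^ n) * measure M G" if t: "0 \<le> t" for n t
    proof -
      define Z where "Z x = (\<Sum>j<4 ^ n. p n j x * of_bool (s n j x \<le> t))" for x
      have int1: "integrable M (\<lambda>x. indicator G x * of_bool (s n j x \<le> t) * indicator (P n j) x :: real)" for j
        by (rule integrable_const_bound[where B = 1]) (auto simp: indicator_def)
      have rce: "(\<integral>x. indicator G x * of_bool (s n j x \<le> t) * p n j x \<partial>M)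
          = (\<integral>x. indicator G x * of_bool (s n j x \<le> t) * indicator (P n j) x \<partial>M)"
        "integrable M (\<lambda>x. indicator G x * of_bool (s n j x \<le> t) * p n j x)" for j
      proof -
        have [measurable]: "(\<lambda>x. indicator G x * of_bool (s n j x \<le> t) :: real) \<in> borel_measurable F"
          using G by measurable
        show "(\<integral>x. indicator G x * of_bool (s n j x \<le> t) * p n j x \<partial>M)
          = (\<integral>x. indicator G x * of_bool (s n j x \<le> t) * indicator (P n j) x \<partial>M)"
          "integrable M (\<lambda>x. indicator G x * of_bool (s n j x \<le> t) * p n j x)"
          unfolding p_def using int1[of j] by (intro real_cond_exp_intg; simp)+
      qed
      have "m n t = (\<integral>x. indicator ({x \<in> space M. hn n x \<le> t} \<inter> G) x \<partial>M)"
        by (simp add: m_def)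
      also have "\<dots> = (\<integral>x. (\<Sum>j<4 ^ n. indicator G x * of_bool (s n j x \<le> t) * indicator (P n j) x) \<partial>M)"
      proof (rule Bochner_Integration.integral_cong)
        fix x
        assume x: "x \<in> space M"
        have "(\<Sum>j<4 ^ n. indicator G x * of_bool (s n j x \<le> t) * indicator (P n j) x)
            = (\<Sum>j<4 ^ n. if j = a n x then indicator G x * of_bool (s n (a n x) x \<le> t) else 0 :: real)"
          using x by (intro sum.cong) (auto simp: P_def)
        also have "\<dots> = indicator G x * of_bool (s n (a n x) x \<le> t)"
          using bound[OF x, of n] by (simp add: sum.delta)
        also have "\<dots> = indicator ({x \<in> space M. hn n x \<le> t} \<inter> G) x"
          using x by (auto simp: hn_def indicator_def)
        finally show "indicator ({x \<in> space M. hn n x \<le> t} \<inter> G) x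
            = (\<Sum>j<4 ^ n. indicator G x * of_bool (s n j x \<le> t) * indicator (P n j) x :: real)"
          by simp
      qed simp
      also have "\<dots> = (\<Sum>j<4 ^ n. \<integral>x. indicator G x * of_bool (s n j x \<le> t) * indicator (P n j) x \<partial>M)"
        using int1 by (intro Bochner_Integration.integral_sum) auto
      also have "\<dots> = (\<Sum>j<4 ^ n. \<integral>x. indicator G x * of_bool (s n j x \<le> t) * p n j x \<partial>M)"
        using rce(1) by simp
      also have "\<dots> = (\<integral>x. (\<Sum>j<4 ^ n. indicator G x * of_bool (s n j x \<le> t) * p n j x) \<partial>M)"
        using rce(2) by (intro Bochner_Integration.integral_sum[symmetric]) auto
      also have "\<dots> = (\<integral>x. Z x * indicator G x \<partial>M)"
        unfolding Z_def sum_distrib_right by (simp only: mult_ac)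
      finally have mZ: "m n t = (\<integral>x. Z x * indicator G x \<partial>M)" .
      have Zb: "AE x in M. min t 1 \<le> Z x \<and> Z x \<le> t + (1 / 2) ^ n"
      proof -
        have imp: "min t 1 \<le> Z x \<and> Z x \<le> t + (1 / 2) ^ n"
          if "(\<forall>n j. 0 \<le> p n j x \<and> p n j x \<le> (1 / 2) ^ n) \<and> (\<forall>n. s n (4 ^ n) x = 1)
            \<and> (\<forall>n j. s (Suc n) (4 * j) x = s n j x)" for x
          using sum_truncated_partition[of t "(1 / 2) ^ n" "4 ^ n" "\<lambda>j. p n j x"] that t
          by (simp add: Z_def s_def)
        show ?thesis
          using good by eventually_elim (use imp in blast)
      qed
      have Gi: "integrable M (\<lambda>x. c * indicator G x :: real)" "(\<integral>x. c * indicator G x \<partial>M) = c * measure M G" for c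
        using ind[of G] by auto
      have Zi: "integrable M (\<lambda>x. Z x * indicator G x)"
      proof (rule integrable_const_bound[where B = "t + 1"])
        have pow: "(1 / 2 :: real) ^ n \<le> 1"
          by (simp add: power_le_one)
        show "AE x in M. norm (Z x * indicator G x) \<le> t + 1"
          using Zb by eventually_elim (use t pow in \<open>auto simp: indicator_def\<close>)
        show "(\<lambda>x. Z x * indicator G x) \<in> borel_measurable M"
          unfolding Z_def by measurable
      qed
      have "AE x in M. min t 1 * indicator G x \<le> Z x * indicator G x"
        "AE x in M. Z x * indicator G x \<le> (t + (1 / 2) ^ n) * indicator G x"
        using Zb by (eventually_elim, simp add: indicator_def)+
      note Z_le = this
      have "(\<integral>x. min t 1 * indicator G x \<partial>M) \<le> m n t"
        unfolding mZ by (intro integral_mono_AE Gi Zi Z_le)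
      then show "min t 1 * measure M G \<le> m n t"
        by (simp add: Gi)
      have "m n t \<le> (\<integral>x. (t + (1 / 2) ^ n) * indicator G x \<partial>M)"
        unfolding mZ by (intro integral_mono_AE Gi Zi Z_le)
      then show "m n t \<le> (t + (1 / 2) ^ n) * measure M G"
        by (simp add: Gi)
    qed
    let ?m = "measure M ({x \<in> space M. h x \<le> t} \<inter> G)"
    have lim0: "(\<lambda>n. (1 / 2 :: real) ^ n) \<longlonglongrightarrow> 0"
      by (rule LIMSEQ_power_zero) simp
    have "?m \<le> (t + (1 / 2) ^ n) * measure M G" for n
    proof -
      have "?m \<le> m n t"
        unfolding m_def
      proof (rule finite_measure_mono_AE)
        show "AE x in M. x \<in> {x \<in> space M. h x \<le> t} \<inter> G \<longrightarrow> x \<in> {x \<in> space M. hn n x \<le> t} \<inter> G"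
          using approx by eventually_elim (auto intro: order.trans)
      qed measurable
      then show ?thesis
        using m(2)[of t n] t by simp
    qed
    moreover have "(\<lambda>n. (t + (1 / 2) ^ n) * measure M G) \<longlonglongrightarrow> (t + 0) * measure M G"
      by (intro tendsto_intros lim0)
    ultimately have 1: "?m \<le> t * measure M G"
      using LIMSEQ_le_const[of _ "(t + 0) * measure M G" ?m] by fastforce
    have 2: "t * measure M G \<le> ?m"
    proof -
      \<comment> \<open>\<open>h\<close> may exceed \<open>hn n\<close> by
        \<open>(1 / 2) ^ n\<close>, so the lower bound is taken at a level lowered by this amount;
        if that level is negative, the bound is trivial.\<close>
      have "(t - (1 / 2) ^ n) * measure M G \<le> ?m" for n
      proof (cases "0 \<le> t - (1 / 2) ^ n")
        case True
        have "t - (1 / 2) ^ n \<le> 1"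
          using t by (simp add: algebra_simps add_increasing2)
        then have "(t - (1 / 2) ^ n) * measure M G \<le> m n (t - (1 / 2) ^ n)"
          using m(1)[OF True, of n] by simp
        also have "\<dots> \<le> ?m"
          unfolding m_def
        proof (rule finite_measure_mono_AE)
          show "AE x in M. x \<in> {x \<in> space M. hn n x \<le> t - (1 / 2) ^ n} \<inter> G \<longrightarrow> x \<in> {x \<in> space M. h x \<le> t} \<inter> G"
            using approx
          proof eventually_elim
            case (elim x)
            then have "h x \<le> hn n x + (1 / 2) ^ n"
              by blast
            then show ?case
              by auto
          qed
        qed measurable
        finally show ?thesis .
      next
        case False
        then have "(t - (1 / 2) ^ n) * measure M G \<le> 0"
          by (intro mult_nonpos_nonneg) auto
        then show ?thesis
          using measure_nonneg order.trans by blast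
      qed
      moreover have "(\<lambda>n. (t - (1 / 2) ^ n) * measure M G) \<longlonglongrightarrow> (t - 0) * measure M G"
        by (intro tendsto_intros lim0)
      ultimately show ?thesis
        using LIMSEQ_le_const2[of _ "(t - 0) * measure M G" ?m] by fastforce
    qed
    show "?m = t * measure M G"
      using 1 2 by simp
  qed (auto simp: h_def hM)
  have "\<exists>E\<in>sets (sigma_join M F h). AE x in M. x \<in> E \<longleftrightarrow> a n x = j" for n j
  proof -
    \<comment> \<open>Neighbouring closed intervals share an end point, but \<open>h\<close> meets
      the ends only on null graphs, so almost every point lies in the interval of its own cell
      only.\<close>
    define E where "E = {x \<in> space M. s n j x \<le> h x \<and> h x \<le> s n (Suc j) x}"
    let ?J = "sigma_join M F h"
    have gen: "sets F \<union> {{x \<in> space M. h x \<in> I} | I. I \<in> sets borel} \<subseteq> Pow (space M)"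
      using FM sets.space_closed by blast
    have spJ: "space ?J = space M"
      unfolding sigma_join_def using gen by (rule space_measure_of)
    have setsJ: "sets ?J = sigma_sets (space M) (sets F \<union> {{x \<in> space M. h x \<in> I} | I. I \<in> sets borel})"
      unfolding sigma_join_def using gen by (rule sets_measure_of)
    have FJ: "subalgebra ?J F"
      by (auto simp: subalgebra_def spF spJ setsJ)
    have [measurable]: "s n j \<in> borel_measurable ?J" for n j
      using measurable_from_subalg[OF FJ sF] .
    have [measurable]: "h \<in> borel_measurable ?J"
    proof (rule measurableI)
      fix I :: "real set"
      assume "I \<in> sets borel"
      then have "{x \<in> space M. h x \<in> I} \<in> sets ?J"
        by (auto simp: setsJ)
      moreover have "h -` I \<inter> space ?J = {x \<in> space M. h x \<in> I}"
        using spJ by auto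
      ultimately show "h -` I \<inter> space ?J \<in> sets ?J"
        by simp
    qed simp
    have "E = {x \<in> space ?J. s n j x \<le> h x \<and> h x \<le> s n (Suc j) x}"
      by (simp add: E_def spJ)
    then have "E \<in> sets ?J"
      by simp
    moreover have "AE x in M. \<forall>i. h x \<noteq> s n i x"
      unfolding AE_all_countable
    proof
      fix i
      show "AE x in M. h x \<noteq> s n i x"
        by (rule AE_I'[OF uniform_over_null_graph[OF uni sF prob_space_axioms, of n i]]) auto
    qed
    then have "AE x in M. x \<in> E \<longleftrightarrow> a n x = j"
      using approx good AE_space
    proof eventually_elim
      case (elim x)
      have mono: "s n i x \<le> s n j x" if "i \<le> j" for i j
        unfolding s_def using elim(3) that by (intro sum_mono2) auto
      have x: "s n (a n x) x < h x" "h x < s n (Suc (a n x)) x"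
        using elim by (metis order_le_less)+
      show ?case
      proof
        assume "x \<in> E"
        then have "s n j x \<le> h x" "h x \<le> s n (Suc j) x" "h x \<noteq> s n j x" "h x \<noteq> s n (Suc j) x"
          using elim(1) by (auto simp: E_def)
        then have "s n j x < h x" "h x < s n (Suc j) x"
          by linarith+
        then have "s n j x < s n (Suc (a n x)) x" "s n (a n x) x < s n (Suc j) x"
          using x by auto
        then have "\<not> Suc (a n x) \<le> j" "\<not> Suc j \<le> a n x"
          using mono by (meson not_le)+
        then show "a n x = j"
          by simp
      next
        assume "a n x = j"
        then show "x \<in> E"
          using x elim(4) by (auto simp: E_def)
      qed
    qed
    ultimately show ?thesis
      by blast
  qed
  then show ?thesis
    using uni that by blast
qed

text \<open>Each base-4 digit of \<open>a\<close> records membership in \<open>C n\<close> and in a set halving all current cells; the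
  latter makes the conditional probabilities of the cells tend to \<open>0\<close>.\<close>

lemma uniform_over_generating:
  fixes C :: "nat \<Rightarrow> 'a set"
  assumes "prob_space M" and half: "halving_over M F" and C: "\<And>n. C n \<in> sets M"
  obtains h where "uniform_over M F h"
    "\<And>n. \<exists>E\<in>sets (sigma_join M F h). AE x in M. x \<in> E \<longleftrightarrow> x \<in> C n"
proof -
  interpret prob_space M by fact
  have FM: "sets F \<subseteq> sets M" and spF: "space F = space M"
    using subalg by (auto simp: subalgebra_def)
  define good where "good n a \<longleftrightarrow> a \<in> measurable M (count_space UNIV) \<and> (\<forall>x\<in>space M. a x < (4 :: nat) ^ n)
      \<and> (\<forall>j. AE x in M. real_cond_exp M F (indicator {x \<in> space M. a x = j}) x \<le> (1 / 2) ^ n)" for n a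
  \<comment> \<open>The last base-4 digit of the new number is 2 or 3 exactly on \<open>C n\<close>.
    The halving set stays existential, because only its effect, recorded in \<open>good\<close>, is
    used later.\<close>
  define step where "step n a a' \<longleftrightarrow> (\<exists>V. a' = (\<lambda>x. 4 * a x + 2 * of_bool (x \<in> C n) + of_bool (x \<in> V)))"
    for n :: nat and a a' :: "'a \<Rightarrow> nat"
  have ind: "integrable M (indicator S :: _ \<Rightarrow> real)" if "S \<in> sets M" for S
    using that by (simp add: integrable_real_indicator less_top[symmetric])
  have "\<exists>a. \<forall>n. good n (a n) \<and> step n (a n) (a (Suc n))"
  proof (rule dependent_nat_choice)
    have "AE x in M. real_cond_exp M F (indicator {x \<in> space M. (0 :: nat) = j}) x \<le> 1" for j
      by (rule real_cond_exp_le_c) (auto intro!: ind)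
    then show "\<exists>a. good 0 a"
      by (intro exI[of _ "\<lambda>_. 0"]) (simp add: good_def)
  next
    fix a n
    assume a: "good n a"
    then have [measurable]: "a \<in> measurable M (count_space UNIV)"
      by (simp add: good_def)
    note C[of n, measurable]
    define P where "P j c = {x \<in> space M. a x = j \<and> (x \<in> C n \<longleftrightarrow> c)}" for j c
    have PM [measurable]: "P j c \<in> sets M" for j c
      unfolding P_def by measurable
    \<comment> \<open>The parts of all current cells inside and outside \<open>C n\<close> must be
      halved by the same \<open>V\<close>; this is why finitely many sets have to be halved at
      once.\<close>
    define \<S> where "\<S> = case_prod P ` ({..<4 ^ n} \<times> UNIV)"
    have "finite \<S> \<and> \<S> \<subseteq> sets M"
      by (auto simp: \<S>_def)
    moreover have "finite \<S> \<and> \<S> \<subseteq> sets M \<longrightarrow>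
        (\<exists>V\<in>sets M. \<forall>S\<in>\<S>. \<forall>G\<in>sets F. measure M (S \<inter> V \<inter> G) = 1 / 2 * measure M (S \<inter> G))"
      using half unfolding halving_over_def by (rule spec)
    ultimately obtain V where V [measurable]: "V \<in> sets M" 
      and hV: "\<And>S G. S \<in> \<S> \<Longrightarrow> G \<in> sets F \<Longrightarrow> measure M (S \<inter> V \<inter> G) = 1 / 2 * measure M (S \<inter> G)"
      by blast
    have half': "measure M (P j c \<inter> V \<inter> G) = 1 / 2 * measure M (P j c \<inter> G)"
      if "j < 4 ^ n" "G \<in> sets F" for j c G
      using that by (intro hV) (auto simp: \<S>_def)
    have V': "measure M (P j c \<inter> (space M - V) \<inter> G) = 1 / 2 * measure M (P j c \<inter> G)"
      if "j < 4 ^ n" "G \<in> sets F" for j c G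
    proof -
      have G [measurable]: "G \<in> sets M"
        using that FM by auto
      have "P j c \<inter> (space M - V) \<inter> G = P j c \<inter> G - P j c \<inter> V \<inter> G"
        by (auto simp: P_def)
      then show ?thesis
        using half'[OF that, of c] finite_measure_Diff[of "P j c \<inter> G" "P j c \<inter> V \<inter> G"] by fastforce
    qed
    define a' where "a' x = 4 * a x + 2 * of_bool (x \<in> C n) + of_bool (x \<in> V)" for x
    have a'M: "a' \<in> measurable M (count_space UNIV)"
      unfolding a'_def by measurable
    have "AE x in M. real_cond_exp M F (indicator {x \<in> space M. a' x = i}) x \<le> (1 / 2) ^ Suc n" for i
    proof (cases "i < 4 * 4 ^ n")
      case True
      define j c where "j = i div 4" and "c \<longleftrightarrow> i mod 4 \<ge> 2"
      define W where "W = (if odd i then V else space M - V)"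
      have j: "j < 4 ^ n"
        using True by (simp add: j_def less_mult_imp_div_less mult.commute)
      have i: "i = 4 * j + 2 * of_bool c + of_bool (odd i)"
      proof -
        have "i = 4 * j + i mod 4"
          by (simp add: j_def)
        moreover have "i mod 4 = 2 * of_bool c + of_bool (odd i)"
          unfolding c_def by (cases "odd i") (simp_all, presburger+)
        ultimately show ?thesis by simp
      qed
      have W: "W \<in> sets M"
        by (simp add: W_def)
      have eqP: "{x \<in> space M. a' x = i} = P j c \<inter> W"
      proof (intro set_eqI)
        fix x
        have "a' x = i \<longleftrightarrow> a x = j \<and> (x \<in> C n \<longleftrightarrow> c) \<and> (x \<in> V \<longleftrightarrow> odd i)"
        proof
          assume "a' x = i"
          then have eq: "4 * a x + 2 * of_bool (x \<in> C n) + of_bool (x \<in> V) = 4 * j + 2 * of_bool c + (of_bool (odd i) :: nat)"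
            using i by (simp add: a'_def)
          show "a x = j \<and> (x \<in> C n \<longleftrightarrow> c) \<and> (x \<in> V \<longleftrightarrow> odd i)"
            using eq by (cases "x \<in> C n"; cases "x \<in> V"; cases c; cases "odd i"; simp; presburger)
        next
          assume "a x = j \<and> (x \<in> C n \<longleftrightarrow> c) \<and> (x \<in> V \<longleftrightarrow> odd i)"
          then show "a' x = i"
            using i by (simp add: a'_def)
        qed
        then show "x \<in> {x \<in> space M. a' x = i} \<longleftrightarrow> x \<in> P j c \<inter> W"
          by (auto simp: P_def W_def)
      qed
      have "measure M (P j c \<inter> W \<inter> G) = 1 / 2 * measure M (P j c \<inter> G)" if "G \<in> sets F" for G
        using half'[OF j that] V'[OF j that] by (simp add: W_def)
      then have "AE x in M. real_cond_exp M F (indicator (P j c \<inter> W)) x = 1 / 2 * real_cond_exp M F (indicator (P j c)) x"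
        by (intro real_cond_exp_halving PM W)
      moreover have "AE x in M. real_cond_exp M F (indicator (P j c)) x
          \<le> real_cond_exp M F (indicator {x \<in> space M. a x = j}) x"
        by (intro real_cond_exp_mono) (auto intro!: ind simp: P_def indicator_def)
      moreover have "AE x in M. real_cond_exp M F (indicator {x \<in> space M. a x = j}) x \<le> (1 / 2) ^ n"
        using a by (simp add: good_def)
      ultimately show ?thesis
        unfolding eqP by eventually_elim simp
    next
      case False
      have "a' x \<noteq> i" if "x \<in> space M" for x
      proof -
        have "a x + 1 \<le> 4 ^ n"
          using a that by (simp add: good_def Suc_le_eq)
        then have "4 * (a x + 1) \<le> 4 * 4 ^ n"
          by simp
        moreover have "a' x < 4 * (a x + 1)"
          by (simp add: a'_def)
        ultimately show ?thesis
          using False by linarith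
      qed
      then have "{x \<in> space M. a' x = i} = {}"
        by auto
      then have empty: "{x \<in> space M. a' x = i} = {}" .
      show ?thesis
        unfolding empty by (intro real_cond_exp_le_c) (simp_all add: ind)
    qed
    moreover have "a' x < 4 ^ Suc n" if "x \<in> space M" for x
    proof -
      have "a x + 1 \<le> 4 ^ n"
        using a that by (simp add: good_def Suc_le_eq)
      moreover have "a' x < 4 * (a x + 1)"
        by (simp add: a'_def)
      ultimately show ?thesis
        by simp
    qed
    ultimately have "good (Suc n) a'"
      using a'M by (simp add: good_def del: power_Suc)
    moreover have "step n a a'"
      unfolding step_def a'_def by blast
    ultimately show "\<exists>a'. good (Suc n) a' \<and> step n a a'"
      by blast
  qed
  then obtain a where a: "\<And>n. good n (a n)" "\<And>n. step n (a n) (a (Suc n))"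
    by blast
  have div: "a (Suc n) x div 4 = a n x" and bit: "x \<in> C n \<longleftrightarrow> a (Suc n) x mod 4 \<in> {2, 3}" for n x
  proof -
    obtain V where V: "a (Suc n) = (\<lambda>x. 4 * a n x + 2 * of_bool (x \<in> C n) + of_bool (x \<in> V))"
      using a(2)[of n] by (auto simp: step_def)
    show "a (Suc n) x div 4 = a n x" "x \<in> C n \<longleftrightarrow> a (Suc n) x mod 4 \<in> {2, 3}"
      unfolding V by (cases "x \<in> C n"; cases "x \<in> V"; simp; presburger)+
  qed
  obtain h where h: "uniform_over M F h"
    and E: "\<And>n j. \<exists>E\<in>sets (sigma_join M F h). AE x in M. x \<in> E \<longleftrightarrow> a n x = j"
  proof (rule cond_distribution_transform[OF prob_space_axioms, of a])
    show "AE x in M. real_cond_exp M F (indicator {x \<in> space M. a n x = j}) x \<le> (1 / 2) ^ n" for n j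
      using a(1)[of n] by (simp add: good_def)
  qed (use a(1) div in \<open>auto simp: good_def\<close>)
  have "\<exists>E\<in>sets (sigma_join M F h). AE x in M. x \<in> E \<longleftrightarrow> x \<in> C n" for n
  proof -
    obtain D where D: "\<And>j. D j \<in> sets (sigma_join M F h)" "\<And>j. AE x in M. x \<in> D j \<longleftrightarrow> a (Suc n) x = j"
      using E[of "Suc n"] by metis
    have "AE x in M. \<forall>j. x \<in> D j \<longleftrightarrow> a (Suc n) x = j"
      using D(2) by (simp add: AE_all_countable)
    \<comment> \<open>\<open>C n\<close> is the union of the cells of level \<open>Suc n\<close>
      whose last digit is 2 or 3, and each of these cells is known up to a null set.\<close>
    then have "AE x in M. x \<in> (\<Union>j\<in>{j. j mod 4 \<in> {2, 3}}. D j) \<longleftrightarrow> x \<in> C n"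
      by (rule AE_mp) (use bit in \<open>auto intro!: AE_I2\<close>)
    moreover have "(\<Union>j\<in>{j. j mod 4 \<in> {2, 3}}. D j) \<in> sets (sigma_join M F h)"
      using D(1) by (intro sets.countable_UN') auto
    ultimately show ?thesis
      by blast
  qed
  then show ?thesis
    using h that by blast
qed

end

section \<open>Loeb measure spaces\<close>

locale ultra_powers =
  fixes \<omega> :: "nat filter" and X :: "nat \<Rightarrow> 'a set"
  assumes finite_X: "finite (X i)"
    and card_X_less: "card (X i) < card (X (Suc i))"
    and ultrafilter: "nonprincipal_ultrafilter \<omega>"
begin

section \<open>The ultrafilter as a quantifier, and the sizes of the finite powers\<close>

lemma omega_not_bot: "\<omega> \<noteq> bot"
  using ultrafilter by (simp add: nonprincipal_ultrafilter_def)

lemma eventually_not_iff: "eventually (\<lambda>i. \<not> P i) \<omega> \<longleftrightarrow> \<not> eventually P \<omega>"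
proof
  assume "eventually (\<lambda>i. \<not> P i) \<omega>"
  then show "\<not> eventually P \<omega>"
    using eventually_conj[of P \<omega> "\<lambda>i. \<not> P i"] omega_not_bot by (auto simp: trivial_limit_def)
next
  assume "\<not> eventually P \<omega>"
  then show "eventually (\<lambda>i. \<not> P i) \<omega>"
    using ultrafilter by (auto simp: nonprincipal_ultrafilter_def)
qed

lemma eventually_disj_omega: "eventually (\<lambda>i. P i \<or> Q i) \<omega> \<longleftrightarrow> eventually P \<omega> \<or> eventually Q \<omega>"
proof -
  have "\<not> eventually (\<lambda>i. P i \<or> Q i) \<omega> \<longleftrightarrow> \<not> eventually P \<omega> \<and> \<not> eventually Q \<omega>"
    unfolding eventually_not_iff[symmetric] by (simp add: eventually_conj_iff)
  then show ?thesis
    by blast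
qed

text \<open>An ultrafilter containing a singleton is the principal one at that point. Hence finite
  initial segments are negligible and limits along \<open>\<omega>\<close> see only large
  \<open>i\<close>.\<close>

lemma eventually_ge: "eventually (\<lambda>i. n \<le> i) \<omega>"
proof -
  have "eventually (\<lambda>i. i \<noteq> m) \<omega>" for m
  proof (rule ccontr)
    assume "\<not> eventually (\<lambda>i. i \<noteq> m) \<omega>"
    then have m: "eventually (\<lambda>i. i = m) \<omega>"
      using eventually_not_iff[of "\<lambda>i. i = m"] by auto
    have "\<omega> = principal {m}"
    proof (rule filter_eqI)
      fix P
      show "eventually P \<omega> \<longleftrightarrow> eventually P (principal {m})"
      proof
        assume "eventually P \<omega>"
        then have "eventually (\<lambda>i. P i \<and> i = m) \<omega>"
          using m by (rule eventually_conj)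
        then have "P m"
          using omega_not_bot by (metis (mono_tags, lifting) eventually_elim2 eventually_happens m)
        then show "eventually P (principal {m})"
          by (simp add: eventually_principal)
      next
        assume "eventually P (principal {m})"
        then show "eventually P \<omega>"
          using m by (auto simp: eventually_principal elim: eventually_mono)
      qed
    qed
    then show False
      using ultrafilter by (simp add: nonprincipal_ultrafilter_def)
  qed
  then have "eventually (\<lambda>i. \<forall>m\<in>{..<n}. i \<noteq> m) \<omega>"
    by (intro eventually_ball_finite) auto
  then show ?thesis
    by (rule eventually_mono) (auto intro: leI)
qed

lemma card_X_ge: "i \<le> card (X i)"
proof (induction i)
  case (Suc i)
  then show ?case
    using card_X_less[of i] by simp
qed simp

lemma finite_fpower: "finite A \<Longrightarrow> finite (fpower X A i)"
  unfolding fpower_def by (intro finite_PiE finite_X)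

lemma card_fpower: "finite A \<Longrightarrow> card (fpower X A i) = card (X i) ^ card A"
  by (simp add: fpower_def card_PiE)

lemma fpower_nonempty: "0 < i \<Longrightarrow> fpower X A i \<noteq> {}"
  using card_X_ge[of i] by (auto simp: fpower_def PiE_eq_empty_iff)

subsection \<open>Internal sets\<close>

abbreviation cls :: "(nat \<Rightarrow> 'b) \<Rightarrow> (nat \<Rightarrow> 'b) set" where
  "cls f \<equiv> ueq \<omega> `` {f}"

lemma equiv_ueq: "equiv UNIV (ueq \<omega>)"
proof (rule equivI)
  show "sym (ueq \<omega>)"
    by (auto simp: sym_def ueq_def eq_commute)
  show "trans (ueq \<omega>)"
    by (auto simp: trans_def ueq_def elim: eventually_elim2)
qed (auto simp: refl_on_def ueq_def)

lemma cls_eq_iff: "cls f = cls g \<longleftrightarrow> eventually (\<lambda>i. f i = g i) \<omega>"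
  using eq_equiv_class_iff[OF equiv_ueq, of f g] by (simp add: ueq_def)

lemma cls_in_ultraproduct: "cls f \<in> ultraproduct \<omega> S \<longleftrightarrow> eventually (\<lambda>i. f i \<in> S i) \<omega>"
proof
  assume "cls f \<in> ultraproduct \<omega> S"
  then obtain g where "eventually (\<lambda>i. g i \<in> S i) \<omega>" "cls f = cls g"
    by (auto simp: ultraproduct_def quotient_def)
  then show "eventually (\<lambda>i. f i \<in> S i) \<omega>"
    unfolding cls_eq_iff by eventually_elim simp
qed (auto simp: ultraproduct_def quotient_def)

lemma ultraproductE:
  assumes "x \<in> ultraproduct \<omega> S"
  obtains f where "x = cls f" "eventually (\<lambda>i. f i \<in> S i) \<omega>"
  using assms by (auto simp: ultraproduct_def quotient_def)

text \<open>The representative is chosen from \<open>x\<close> alone and does not depend on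
  \<open>S\<close>. With it every Boolean identity between ultraproducts reduces to one for
  \<open>eventually\<close>.\<close>

lemma ultraproduct_iff:
  "x \<in> ultraproduct \<omega> S \<longleftrightarrow> (\<exists>f. x = cls f) \<and> eventually (\<lambda>i. (SOME f. x = cls f) i \<in> S i) \<omega>"
proof (cases "\<exists>f. x = cls f")
  case True
  define g where "g = (SOME f. x = cls f)"
  have x: "x = cls g"
    unfolding g_def using True by (rule someI_ex)
  have "x \<in> ultraproduct \<omega> S \<longleftrightarrow> eventually (\<lambda>i. g i \<in> S i) \<omega>"
    by (subst x) (rule cls_in_ultraproduct)
  then show ?thesis
    using True by (simp only: g_def[symmetric]) simp
next
  case False
  then show ?thesis
    by (auto elim: ultraproductE)
qed

lemma ultraproduct_subset_iff:
  "ultraproduct \<omega> S \<subseteq> ultraproduct \<omega> T \<longleftrightarrow> eventually (\<lambda>i. S i \<subseteq> T i) \<omega>"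
proof
  assume sub: "ultraproduct \<omega> S \<subseteq> ultraproduct \<omega> T"
  show "eventually (\<lambda>i. S i \<subseteq> T i) \<omega>"
  proof (rule ccontr)
    assume "\<not> eventually (\<lambda>i. S i \<subseteq> T i) \<omega>"
    then have ev: "eventually (\<lambda>i. \<not> S i \<subseteq> T i) \<omega>"
      by (simp add: eventually_not_iff)
    \<comment> \<open>Witnesses in \<open>S i - T i\<close>, taken wherever there are any, form a
      point of the first ultraproduct that the second one misses.\<close>
    define f where "f i = (SOME v. v \<in> S i - T i)" for i
    have f: "f i \<in> S i \<and> f i \<notin> T i" if "\<not> S i \<subseteq> T i" for i
    proof -
      have "\<exists>v. v \<in> S i - T i"
        using that by blast
      then show ?thesis
        unfolding f_def using someI_ex[of "\<lambda>v. v \<in> S i - T i"] by blast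
    qed
    have "eventually (\<lambda>i. f i \<in> S i) \<omega>" "eventually (\<lambda>i. f i \<notin> T i) \<omega>"
      using ev by (eventually_elim, use f in blast)+
    then show False
      using sub cls_in_ultraproduct eventually_not_iff by blast
  qed
next
  assume "eventually (\<lambda>i. S i \<subseteq> T i) \<omega>"
  then show "ultraproduct \<omega> S \<subseteq> ultraproduct \<omega> T"
    unfolding subset_iff ultraproduct_iff by (auto elim: eventually_elim2)
qed

lemma ultraproduct_Int: "ultraproduct \<omega> (\<lambda>i. S i \<inter> T i) = ultraproduct \<omega> S \<inter> ultraproduct \<omega> T"
  unfolding set_eq_iff Int_iff ultraproduct_iff eventually_conj_iff by blast

lemma ultraproduct_Un: "ultraproduct \<omega> (\<lambda>i. S i \<union> T i) = ultraproduct \<omega> S \<union> ultraproduct \<omega> T"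
  unfolding set_eq_iff Un_iff ultraproduct_iff eventually_disj_omega by blast

lemma ultraproduct_Diff: "ultraproduct \<omega> (\<lambda>i. S i - T i) = ultraproduct \<omega> S - ultraproduct \<omega> T"
  unfolding set_eq_iff Diff_iff ultraproduct_iff eventually_conj_iff eventually_not_iff by blast

lemma ultraproduct_empty: "ultraproduct \<omega> (\<lambda>i. {}) = {}"
  using omega_not_bot by (auto elim!: ultraproductE simp: trivial_limit_def)

lemma ultraproduct_INT:
  "finite J \<Longrightarrow> J \<noteq> {} \<Longrightarrow> ultraproduct \<omega> (\<lambda>i. \<Inter>j\<in>J. S j i) = (\<Inter>j\<in>J. ultraproduct \<omega> (S j))"
  by (induction J rule: finite_ne_induct) (simp_all add: ultraproduct_Int)

lemma ultraproduct_UN_le: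
  "ultraproduct \<omega> (\<lambda>i. \<Union>m\<le>n. S m i) = (\<Union>m\<le>(n :: nat). ultraproduct \<omega> (S m))"
  by (induction n) (simp_all add: ultraproduct_Un atMost_Suc)

definition internal :: "nat set \<Rightarrow> (nat \<Rightarrow> (nat \<Rightarrow> 'a) set) \<Rightarrow> bool" where
  "internal A S \<longleftrightarrow> (\<forall>i. S i \<subseteq> fpower X A i)"

lemma internalI: "(\<And>i. S i \<subseteq> fpower X A i) \<Longrightarrow> internal A S"
  by (simp add: internal_def)

lemma internalD: "internal A S \<Longrightarrow> S i \<subseteq> fpower X A i"
  by (simp add: internal_def)

lemma internal_finite: "finite A \<Longrightarrow> internal A S \<Longrightarrow> finite (S i)"
  by (rule finite_subset[OF internalD finite_fpower])

lemma ultraproduct_subset_upower: "internal A S \<Longrightarrow> ultraproduct \<omega> S \<subseteq> upower \<omega> X A"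
  unfolding upower_def ultraproduct_subset_iff by (simp add: internal_def)

section \<open>Ultralimits of normalized counting measures\<close>

text \<open>By compactness the image filter has a cluster point; for an ultrafilter every cluster
  point is a limit.\<close>

lemma ultrafilter_bounded_limit:
  fixes f :: "nat \<Rightarrow> real"
  assumes "\<And>i. f i \<in> {a..b}"
  obtains l where "(f \<longlongrightarrow> l) \<omega>"
proof -
  let ?F = "filtermap f \<omega>"
  have "?F \<noteq> bot"
    using omega_not_bot by (simp add: filtermap_bot_iff)
  moreover have "eventually (\<lambda>x. x \<in> {a..b}) ?F"
    using assms by (simp add: eventually_filtermap)
  ultimately obtain l where l: "inf (nhds l) ?F \<noteq> bot"
    using compact_Icc[of a b] unfolding compact_filter by meson
  have "(f \<longlongrightarrow> l) \<omega>"
  proof (rule topological_tendstoI)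
    fix U
    assume U: "open U" "l \<in> U"
    show "eventually (\<lambda>i. f i \<in> U) \<omega>"
    proof (rule ccontr)
      assume "\<not> eventually (\<lambda>i. f i \<in> U) \<omega>"
      then have "eventually (\<lambda>x. x \<notin> U) ?F"
        by (simp add: eventually_filtermap eventually_not_iff)
      moreover have "eventually (\<lambda>x. x \<in> U) (nhds l)"
        using U by (auto simp: eventually_nhds)
      ultimately have "eventually (\<lambda>x. False) (inf (nhds l) ?F)"
        unfolding eventually_inf by blast
      then show False
        using l by (simp add: trivial_limit_def)
    qed
  qed
  then show ?thesis
    by (rule that)
qed

abbreviation um :: "nat set \<Rightarrow> (nat \<Rightarrow> (nat \<Rightarrow> 'a) set) \<Rightarrow> real" where
  "um \<equiv> umeasure \<omega> X"

definition frac :: "nat set \<Rightarrow> (nat \<Rightarrow> (nat \<Rightarrow> 'a) set) \<Rightarrow> nat \<Rightarrow> real" where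
  "frac A S i = real (card (S i)) / real (card (fpower X A i))"

lemma frac_nonneg: "0 \<le> frac A S i"
  by (simp add: frac_def)

lemma frac_le_1: "finite A \<Longrightarrow> internal A S \<Longrightarrow> frac A S i \<le> 1"
  unfolding frac_def by (intro divide_le_eq_1[THEN iffD2])
    (auto simp: internal_def intro: card_mono finite_fpower)

lemma frac_tendsto:
  assumes "finite A" "internal A S"
  shows "(frac A S \<longlongrightarrow> um A S) \<omega>"
proof -
  have "frac A S i \<in> {0..1}" for i
    using frac_nonneg frac_le_1[OF assms] by simp
  then obtain l where l: "(frac A S \<longlongrightarrow> l) \<omega>"
    by (rule ultrafilter_bounded_limit)
  moreover have "um A S = Lim \<omega> (frac A S)"
    by (simp add: umeasure_def frac_def[abs_def])
  ultimately show ?thesis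
    using tendsto_Lim[OF omega_not_bot l] by simp
qed

lemma um_eqI: "(frac A S \<longlongrightarrow> l) \<omega> \<Longrightarrow> um A S = l"
  using tendsto_Lim[OF omega_not_bot, of "frac A S" l] by (simp add: umeasure_def frac_def[abs_def])

lemma um_nonneg: "finite A \<Longrightarrow> internal A S \<Longrightarrow> 0 \<le> um A S"
  by (rule tendsto_lowerbound[OF frac_tendsto]) (simp_all add: frac_nonneg omega_not_bot)

lemma um_le_1: "finite A \<Longrightarrow> internal A S \<Longrightarrow> um A S \<le> 1"
  by (rule tendsto_upperbound[OF frac_tendsto]) (simp_all add: frac_le_1 omega_not_bot)

lemma frac_mono: "finite A \<Longrightarrow> internal A T \<Longrightarrow> S i \<subseteq> T i \<Longrightarrow> frac A S i \<le> frac A T i"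
  unfolding frac_def
  by (intro divide_right_mono of_nat_mono card_mono internal_finite) simp_all

lemma um_mono:
  assumes "finite A" "internal A S" "internal A T" "eventually (\<lambda>i. S i \<subseteq> T i) \<omega>"
  shows "um A S \<le> um A T"
proof (rule tendsto_le[OF omega_not_bot frac_tendsto frac_tendsto])
  show "eventually (\<lambda>i. frac A S i \<le> frac A T i) \<omega>"
    using assms(4) by eventually_elim (rule frac_mono[OF assms(1,3)])
qed fact+

lemma um_Un_Int:
  assumes "finite A" "internal A S" "internal A T"
  shows "um A (\<lambda>i. S i \<union> T i) + um A (\<lambda>i. S i \<inter> T i) = um A S + um A T"
proof -
  have int: "internal A (\<lambda>i. S i \<union> T i)" "internal A (\<lambda>i. S i \<inter> T i)"
    using assms by (auto simp: internal_def)
  have "frac A (\<lambda>i. S i \<union> T i) i + frac A (\<lambda>i. S i \<inter> T i) i = frac A S i + frac A T i" for i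
  proof -
    have "finite (S i)" "finite (T i)"
      by (rule internal_finite[OF assms(1)], fact)+
    then have "card (S i) + card (T i) = card (S i \<union> T i) + card (S i \<inter> T i)"
      by (rule card_Un_Int)
    then show ?thesis
      unfolding frac_def add_divide_distrib[symmetric] by (metis of_nat_add)
  qed
  moreover have "((\<lambda>i. frac A (\<lambda>i. S i \<union> T i) i + frac A (\<lambda>i. S i \<inter> T i) i) \<longlongrightarrow>
      um A (\<lambda>i. S i \<union> T i) + um A (\<lambda>i. S i \<inter> T i)) \<omega>"
    by (intro tendsto_add frac_tendsto assms int)
  moreover have "((\<lambda>i. frac A S i + frac A T i) \<longlongrightarrow> um A S + um A T) \<omega>"
    by (intro tendsto_add frac_tendsto assms)
  ultimately show ?thesis
    using tendsto_unique[OF omega_not_bot] by simp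
qed

lemma um_empty: "um A (\<lambda>i. {}) = 0"
  by (rule um_eqI) (simp add: frac_def[abs_def])

lemma um_full: 
  assumes "finite A"
  shows "um A (fpower X A) = 1"
proof (rule um_eqI)
  \<comment> \<open>Index 0 is left out because \<open>X 0\<close> may be empty.\<close>
  have "eventually (\<lambda>i. frac A (fpower X A) i = 1) \<omega>"
    using eventually_ge[of 1]
  proof eventually_elim
    case (elim i)
    then have "card (fpower X A i) \<noteq> 0"
      using finite_fpower[OF assms] fpower_nonempty[of i A] by (simp add: card_eq_0_iff)
    then show ?case
      by (simp add: frac_def)
  qed
  then show "(frac A (fpower X A) \<longlongrightarrow> 1) \<omega>"
    by (rule tendsto_eventually)
qed

lemma internal_full: "internal A (fpower X A)"
  by (simp add: internal_def)

lemma internal_empty: "internal A (\<lambda>i. {})"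
  by (simp add: internal_def)

lemma internal_Diff: "internal A S \<Longrightarrow> internal A (\<lambda>i. S i - T i)"
  by (auto simp: internal_def)

lemma internal_Int: "internal A S \<Longrightarrow> internal A (\<lambda>i. S i \<inter> T i)"
  by (auto simp: internal_def)

lemma internal_UN: "(\<And>m. internal A (S m)) \<Longrightarrow> internal A (\<lambda>i. \<Union>m\<in>J. S m i)"
  unfolding internal_def by blast

lemma um_Un_le:
  assumes "finite A" "internal A S" "internal A T"
  shows "um A (\<lambda>i. S i \<union> T i) \<le> um A S + um A T"
  using um_Un_Int[OF assms] um_nonneg[OF assms(1) internal_Int[OF assms(2)], of T] by linarith

lemma um_Diff:
  assumes "finite A" "internal A S" "internal A T"
  shows "um A (\<lambda>i. S i - T i) = um A S - um A (\<lambda>i. S i \<inter> T i)"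
proof -
  have "(\<lambda>i. (S i - T i) \<union> (S i \<inter> T i)) = S" "(\<lambda>i. (S i - T i) \<inter> (S i \<inter> T i)) = (\<lambda>i. {})"
    by auto
  then show ?thesis
    using um_Un_Int[OF assms(1) internal_Diff[OF assms(2)] internal_Int[OF assms(2)], of T T]
    by (simp add: um_empty)
qed

text \<open>At stage \<open>i\<close> the sets up to index \<open>k i\<close> are joined, where
  \<open>k i\<close> is as large as possible while every partial union up to
  \<open>m \<le> k i\<close> has a fraction of at most \<open>L + 1 / (m + 1)\<close>, with
  \<open>L\<close> the supremum of the measures of the finite unions. As \<open>k\<close> tends to
  infinity along \<open>\<omega>\<close>, this diagonal union swallows every \<open>S n\<close> and
  still has measure at most \<open>L\<close>.\<close>

lemma countable_saturation:
  assumes A: "finite A" and S: "\<And>n. internal A (S n)"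
  obtains T where "internal A T" "\<And>n :: nat. ultraproduct \<omega> (S n) \<subseteq> ultraproduct \<omega> T"
    "\<And>c. (\<And>n. um A (\<lambda>i. \<Union>m\<le>n. S m i) \<le> c) \<Longrightarrow> um A T \<le> c"
proof -
  define S' where "S' n i = (\<Union>m\<le>n. S m i)" for n i
  have S': "internal A (S' n)" for n
    unfolding S'_def[abs_def] using S by (rule internal_UN)
  define L where "L = (SUP n. um A (S' n))"
  have bdd: "bdd_above (range (\<lambda>n. um A (S' n)))"
    using um_le_1[OF A S'] by (intro bdd_aboveI[of _ 1]) auto
  have L: "um A (S' n) \<le> L" for n
    unfolding L_def by (rule cSUP_upper[OF _ bdd]) simp
  have L0: "0 \<le> L"
    using L[of 0] um_nonneg[OF A S', of 0] by linarith
  define good where "good i m \<longleftrightarrow> frac A (S' m) i \<le> L + 1 / real (Suc m)" for i m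
  \<comment> \<open>The bound \<open>n \<le> i\<close> makes \<open>K i\<close> finite; 0 always
    belongs to it, because fractions are at most 1 and the tolerance at \<open>m = 0\<close> is
    1.\<close>
  define K where "K i = {n. n \<le> i \<and> (\<forall>m\<le>n. good i m)}" for i
  have K0: "0 \<in> K i" for i
    using frac_le_1[OF A S', of 0 i] L0 by (simp add: K_def good_def)
  have finK: "finite (K i)" for i
    by (rule finite_subset[of _ "{..i}"]) (auto simp: K_def)
  define k where "k i = Max (K i)" for i
  have k: "k i \<in> K i" for i
    unfolding k_def using finK K0 by (intro Max_in) auto
  have kge: "eventually (\<lambda>i. n \<le> k i) \<omega>" for n
  proof -
    have "eventually (\<lambda>i. good i m) \<omega>" for m
    proof -
      have "eventually (\<lambda>i. frac A (S' m) i < L + 1 / real (Suc m)) \<omega>"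
        by (rule order_tendstoD(2)[OF frac_tendsto[OF A S'] le_less_trans[OF L]]) simp
      then show ?thesis
        by (rule eventually_mono) (simp add: good_def)
    qed
    then have "eventually (\<lambda>i. \<forall>m\<in>{..n}. good i m) \<omega>"
      by (intro eventually_ball_finite) auto
    then show ?thesis
      using eventually_ge[of n]
    proof eventually_elim
      case (elim i)
      then have "n \<in> K i"
        by (simp add: K_def)
      then show ?case
        unfolding k_def using finK by simp
    qed
  qed
  define T where "T i = S' (k i) i" for i
  have T: "internal A T"
    using S' by (auto simp: internal_def T_def)
  show ?thesis
  proof (rule that[OF T])
    show "ultraproduct \<omega> (S n) \<subseteq> ultraproduct \<omega> T" for n
      unfolding ultraproduct_subset_iff using kge[of n] by eventually_elim (auto simp: T_def S'_def)
    fix c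
    assume c: "\<And>n. um A (\<lambda>i. \<Union>m\<le>n. S m i) \<le> c"
    have "um A T \<le> L + 1 / real (Suc n)" for n
    proof (rule tendsto_upperbound[OF frac_tendsto[OF A T] _ omega_not_bot])
      show "eventually (\<lambda>i. frac A T i \<le> L + 1 / real (Suc n)) \<omega>"
        using kge[of n]
      proof eventually_elim
        case (elim i)
        have "frac A T i = frac A (S' (k i)) i"
          by (simp add: frac_def T_def)
        also have "\<dots> \<le> L + 1 / real (Suc (k i))"
          using k[of i] by (simp add: K_def good_def)
        also have "\<dots> \<le> L + 1 / real (Suc n)"
          using elim by (simp add: frac_le)
        finally show ?case .
      qed
    qed
    moreover have "(\<lambda>n. L + 1 / real (Suc n)) \<longlonglongrightarrow> L + 0"
      by (intro tendsto_add tendsto_const LIMSEQ_Suc[OF lim_const_over_n])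
    ultimately have "um A T \<le> L"
      using LIMSEQ_le_const by fastforce
    also have "L \<le> c"
      unfolding L_def using c by (intro cSUP_least) (auto simp: S'_def[abs_def])
    finally show "um A T \<le> c" .
  qed
qed

subsection \<open>Null sets\<close>

lemma loeb_nullI:
  assumes "\<And>\<epsilon>. 0 < \<epsilon> \<Longrightarrow> \<exists>S. internal A S \<and> N \<subseteq> ultraproduct \<omega> S \<and> um A S < \<epsilon>"
  shows "loeb_null \<omega> X A N"
  using assms unfolding loeb_null_def internal_def by blast

lemma loeb_nullE:
  assumes "loeb_null \<omega> X A N" "0 < \<epsilon>"
  obtains S where "internal A S" "N \<subseteq> ultraproduct \<omega> S" "um A S < \<epsilon>"
  using assms unfolding loeb_null_def internal_def by blast

lemma loeb_null_subset: "loeb_null \<omega> X A N \<Longrightarrow> M \<subseteq> N \<Longrightarrow> loeb_null \<omega> X A M"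
  unfolding loeb_null_def by (meson order_trans)

text \<open>Internal covers whose measures are bounded by a geometric series are merged into one
  internal cover by saturation.\<close>

lemma loeb_null_UN:
  assumes A: "finite A" and N: "\<And>n :: nat. loeb_null \<omega> X A (N n)"
  shows "loeb_null \<omega> X A (\<Union>n. N n)"
proof (rule loeb_nullI)
  fix \<epsilon> :: real
  assume \<epsilon>: "0 < \<epsilon>"
  \<comment> \<open>The extra factor 1/2 keeps the saturated cover, for which only a weak bound is
    available, strictly below \<open>\<epsilon>\<close>.\<close>
  have "\<exists>S. internal A S \<and> N n \<subseteq> ultraproduct \<omega> S \<and> um A S < \<epsilon> / 2 * (1 / 2) ^ Suc n" for n
    using loeb_nullE[OF N, of "\<epsilon> / 2 * (1 / 2) ^ Suc n"] \<epsilon> by (metis half_gt_zero mult_pos_pos zero_less_power zero_less_divide_1_iff zero_less_numeral)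
  then obtain S where S: "\<And>n. internal A (S n)" "\<And>n. N n \<subseteq> ultraproduct \<omega> (S n)"
    "\<And>n. um A (S n) < \<epsilon> / 2 * (1 / 2) ^ Suc n"
    by metis
  obtain T where T: "internal A T" "\<And>n. ultraproduct \<omega> (S n) \<subseteq> ultraproduct \<omega> T"
    "\<And>c. (\<And>n. um A (\<lambda>i. \<Union>m\<le>n. S m i) \<le> c) \<Longrightarrow> um A T \<le> c"
    using countable_saturation[OF A, of S] S(1) by blast
  have "um A (\<lambda>i. \<Union>m\<le>n. S m i) \<le> \<epsilon> / 2 * (1 - (1 / 2) ^ Suc n)" for n
  proof (induction n)
    case 0
    then show ?case
      using S(3)[of 0] by simp
  next
    case (Suc n)
    have "um A (\<lambda>i. \<Union>m\<le>Suc n. S m i) = um A (\<lambda>i. S (Suc n) i \<union> (\<Union>m\<le>n. S m i))"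
      by (simp add: atMost_Suc)
    also have "\<dots> \<le> um A (S (Suc n)) + um A (\<lambda>i. \<Union>m\<le>n. S m i)"
      using S(1) A by (intro um_Un_le internal_UN) auto
    also have "\<dots> \<le> \<epsilon> / 2 * (1 / 2) ^ Suc (Suc n) + \<epsilon> / 2 * (1 - (1 / 2) ^ Suc n)"
      using Suc S(3)[of "Suc n"] by linarith
    also have "\<dots> = \<epsilon> / 2 * (1 - (1 / 2) ^ Suc (Suc n))"
      by (simp add: field_simps)
    finally show ?case .
  qed
  moreover have "\<epsilon> / 2 * (1 - (1 / 2) ^ Suc n) \<le> \<epsilon> / 2" for n
    using \<epsilon> by (simp add: field_simps)
  ultimately have "um A T \<le> \<epsilon> / 2"
    by (intro T(3)) (meson order_trans)
  then show "\<exists>S. internal A S \<and> (\<Union>n. N n) \<subseteq> ultraproduct \<omega> S \<and> um A S < \<epsilon>"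
    using T(1,2) S(2) \<epsilon> by (intro exI[of _ T]) force
qed

lemma loeb_null_Un:
  assumes "finite A" "loeb_null \<omega> X A M" "loeb_null \<omega> X A N"
  shows "loeb_null \<omega> X A (M \<union> N)"
proof -
  have "loeb_null \<omega> X A (\<Union>n. if n = (0 :: nat) then M else N)"
    using assms by (intro loeb_null_UN) auto
  then show ?thesis
    by (rule loeb_null_subset) (auto split: if_splits intro: exI[of _ "0 :: nat"] exI[of _ "1 :: nat"])
qed

lemma loeb_null_ultraproduct:
  assumes "finite A" "internal A S"
  shows "loeb_null \<omega> X A (ultraproduct \<omega> S) \<longleftrightarrow> um A S = 0"
proof
  assume null: "loeb_null \<omega> X A (ultraproduct \<omega> S)"
  have "um A S < \<epsilon>" if \<epsilon>: "0 < \<epsilon>" for \<epsilon>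
  proof -
    obtain T where "internal A T" "ultraproduct \<omega> S \<subseteq> ultraproduct \<omega> T" "um A T < \<epsilon>"
      using loeb_nullE[OF null \<epsilon>] .
    then show ?thesis
      using um_mono[OF assms, of T] by (simp add: ultraproduct_subset_iff)
  qed
  then show "um A S = 0"
    using um_nonneg[OF assms] by (metis less_irrefl order_le_less)
next
  assume "um A S = 0"
  then show "loeb_null \<omega> X A (ultraproduct \<omega> S)"
    using assms by (intro loeb_nullI) auto
qed

lemma loeb_null_empty: "finite A \<Longrightarrow> loeb_null \<omega> X A {}"
  using loeb_null_ultraproduct[OF _ internal_empty] by (simp add: ultraproduct_empty um_empty)

subsection \<open>The measure\<close>

lemma loeb_approx_iff: "loeb_approx \<omega> X A M S \<longleftrightarrow> internal A S \<and> loeb_null \<omega> X A (sym_diff M (ultraproduct \<omega> S))"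
  by (auto simp: loeb_approx_def internal_def)

lemma loeb_approx_ultraproduct: "finite A \<Longrightarrow> internal A S \<Longrightarrow> loeb_approx \<omega> X A (ultraproduct \<omega> S) S"
  by (simp add: loeb_approx_iff loeb_null_empty)

lemma um_eq_of_null:
  assumes A: "finite A" and S: "internal A S" and T: "internal A T"
    and null: "loeb_null \<omega> X A (sym_diff (ultraproduct \<omega> S) (ultraproduct \<omega> T))"
  shows "um A S = um A T"
proof -
  have "loeb_null \<omega> X A (ultraproduct \<omega> (\<lambda>i. S i - T i))" "loeb_null \<omega> X A (ultraproduct \<omega> (\<lambda>i. T i - S i))"
    by (rule loeb_null_subset[OF null]; simp add: ultraproduct_Diff)+
  then have "um A (\<lambda>i. S i - T i) = 0" "um A (\<lambda>i. T i - S i) = 0"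
    using loeb_null_ultraproduct A S T internal_Diff by blast+
  then show ?thesis
    using um_Diff[OF A S T] um_Diff[OF A T S] by (simp add: Int_commute)
qed

lemma loeb_approx_um_unique:
  assumes A: "finite A" and "loeb_approx \<omega> X A M S" "loeb_approx \<omega> X A M T"
  shows "um A S = um A T"
proof (rule um_eq_of_null[OF A])
  show "loeb_null \<omega> X A (sym_diff (ultraproduct \<omega> S) (ultraproduct \<omega> T))"
    by (rule loeb_null_subset[OF loeb_null_Un[OF A, of "sym_diff M (ultraproduct \<omega> S)" "sym_diff M (ultraproduct \<omega> T)"]])
      (use assms in \<open>auto simp: loeb_approx_iff\<close>)
qed (use assms in \<open>auto simp: loeb_approx_iff\<close>)

lemma loeb_approx_the:
  assumes A: "finite A" and "loeb_approx \<omega> X A M S"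
  shows "(THE r. \<exists>S. loeb_approx \<omega> X A M S \<and> r = um A S) = um A S"
  using assms loeb_approx_um_unique[OF A] by (intro the_equality) blast+

text \<open>The saturated \<open>T\<close> may exceed the union of the ultraproducts, but the excess
  lies in each \<open>T - S' n\<close>, whose measure tends to 0. So a countable union of almost
  internal sets is almost internal, with measure the limit over the finite unions.\<close>

lemma loeb_approx_UN:
  assumes A: "finite A" and S: "\<And>n :: nat. loeb_approx \<omega> X A (M n) (S n)"
  obtains T where "loeb_approx \<omega> X A (\<Union>n. M n) T" "(\<lambda>n. um A (\<lambda>i. \<Union>m\<le>n. S m i)) \<longlonglongrightarrow> um A T"
proof -
  have int: "internal A (S n)" for n
    using S by (simp add: loeb_approx_iff)
  obtain T where T: "internal A T" "\<And>n. ultraproduct \<omega> (S n) \<subseteq> ultraproduct \<omega> T"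
    "\<And>c. (\<And>n. um A (\<lambda>i. \<Union>m\<le>n. S m i) \<le> c) \<Longrightarrow> um A T \<le> c"
    using countable_saturation[OF A, of S] int by blast
  define S' where "S' n i = (\<Union>m\<le>n. S m i)" for n i
  have S': "internal A (S' n)" for n
    unfolding S'_def[abs_def] using int by (rule internal_UN)
  have sub: "ultraproduct \<omega> (S' n) \<subseteq> ultraproduct \<omega> T" for n
    using T(2) by (auto simp: S'_def[abs_def] ultraproduct_UN_le)
  have le: "um A (S' n) \<le> um A T" for n
    using um_mono[OF A S' T(1)] sub by (simp add: ultraproduct_subset_iff)
  have inc: "incseq (\<lambda>n. um A (S' n))"
    unfolding S'_def[abs_def]
    by (intro incseq_SucI um_mono[OF A internal_UN internal_UN] always_eventually allI UN_mono int) auto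
  obtain l where l: "(\<lambda>n. um A (S' n)) \<longlonglongrightarrow> l" "\<forall>n. um A (S' n) \<le> l"
    using incseq_convergent[OF inc] le by metis
  have "um A T \<le> l"
    using l(2) by (intro T(3)) (simp add: S'_def[abs_def])
  moreover have "l \<le> um A T"
    using l(1) le by (intro LIMSEQ_le_const2) auto
  ultimately have lim: "(\<lambda>n. um A (S' n)) \<longlonglongrightarrow> um A T"
    using l(1) by simp
  have "loeb_null \<omega> X A (ultraproduct \<omega> T - (\<Union>n. ultraproduct \<omega> (S n)))"
  proof (rule loeb_nullI)
    fix \<epsilon> :: real
    assume "0 < \<epsilon>"
    then have "eventually (\<lambda>n. um A T - \<epsilon> < um A (S' n)) sequentially"
      using order_tendstoD(1)[OF lim, of "um A T - \<epsilon>"] by simp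
    then obtain n where n: "um A T - \<epsilon> < um A (S' n)"
      by (auto simp: eventually_sequentially)
    have "um A (\<lambda>i. S' n i \<inter> T i) = um A (S' n)"
    proof (rule um_eq_of_null[OF A internal_Int[OF S'] S'])
      show "loeb_null \<omega> X A (sym_diff (ultraproduct \<omega> (\<lambda>i. S' n i \<inter> T i)) (ultraproduct \<omega> (S' n)))"
        using sub[of n] by (simp add: ultraproduct_Int Int_absorb2 loeb_null_empty[OF A])
    qed
    then have "um A (\<lambda>i. T i - S' n i) < \<epsilon>"
      using um_Diff[OF A T(1) S', of n] n by (simp add: Int_commute)
    moreover have "ultraproduct \<omega> T - (\<Union>n. ultraproduct \<omega> (S n)) \<subseteq> ultraproduct \<omega> (\<lambda>i. T i - S' n i)"
      by (auto simp: ultraproduct_Diff S'_def[abs_def] ultraproduct_UN_le)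
    ultimately show "\<exists>R. internal A R \<and> ultraproduct \<omega> T - (\<Union>n. ultraproduct \<omega> (S n)) \<subseteq> ultraproduct \<omega> R \<and> um A R < \<epsilon>"
      using internal_Diff[OF T(1)] by blast
  qed
  moreover have "loeb_null \<omega> X A (\<Union>n. sym_diff (M n) (ultraproduct \<omega> (S n)))"
    using S by (intro loeb_null_UN[OF A]) (simp add: loeb_approx_iff)
  ultimately have "loeb_null \<omega> X A ((ultraproduct \<omega> T - (\<Union>n. ultraproduct \<omega> (S n)))
      \<union> (\<Union>n. sym_diff (M n) (ultraproduct \<omega> (S n))))"
    by (rule loeb_null_Un[OF A])
  then have "loeb_null \<omega> X A (sym_diff (\<Union>n. M n) (ultraproduct \<omega> T))"
    by (rule loeb_null_subset) (use T(2) in blast)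
  then show ?thesis
    using that[of T] T(1) lim by (simp add: loeb_approx_iff S'_def[abs_def])
qed

lemma loeb_approx_compl:
  assumes "loeb_approx \<omega> X A M S" "M \<subseteq> upower \<omega> X A"
  shows "loeb_approx \<omega> X A (upower \<omega> X A - M) (\<lambda>i. fpower X A i - S i)"
proof -
  have "ultraproduct \<omega> S \<subseteq> upower \<omega> X A"
    using assms by (intro ultraproduct_subset_upower) (simp add: loeb_approx_iff)
  then have "sym_diff (upower \<omega> X A - M) (ultraproduct \<omega> (\<lambda>i. fpower X A i - S i)) = sym_diff M (ultraproduct \<omega> S)"
    using assms by (auto simp: ultraproduct_Diff upower_def)
  then show ?thesis
    using assms by (simp add: loeb_approx_iff internal_Diff internal_full)
qed

lemma sigma_algebra_loeb_sets:
  assumes A: "finite A"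
  shows "sigma_algebra (upower \<omega> X A) (loeb_sets \<omega> X A)"
  unfolding sigma_algebra_iff2
proof (intro conjI ballI allI impI)
  show "loeb_sets \<omega> X A \<subseteq> Pow (upower \<omega> X A)"
    by (auto simp: loeb_sets_def)
  show "{} \<in> loeb_sets \<omega> X A"
    using loeb_approx_ultraproduct[OF A internal_empty] by (auto simp: loeb_sets_def ultraproduct_empty)
  show "upower \<omega> X A - M \<in> loeb_sets \<omega> X A" if "M \<in> loeb_sets \<omega> X A" for M
    using that loeb_approx_compl by (auto simp: loeb_sets_def)
next
  fix M :: "nat \<Rightarrow> 'a upoint set"
  assume M: "range M \<subseteq> loeb_sets \<omega> X A"
  then have "\<forall>n. \<exists>S. loeb_approx \<omega> X A (M n) S"
    by (auto simp: loeb_sets_def)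
  then obtain S where "\<And>n. loeb_approx \<omega> X A (M n) (S n)"
    by metis
  then obtain T where "loeb_approx \<omega> X A (\<Union>n. M n) T"
    using loeb_approx_UN[OF A, of M S] by blast
  then show "\<Union> (range M) \<in> loeb_sets \<omega> X A"
    using M by (auto simp: loeb_sets_def)
qed

lemma space_loeb [simp]: "space (loeb \<omega> X A) = upower \<omega> X A"
proof -
  have "loeb_sets \<omega> X A \<subseteq> Pow (upower \<omega> X A)"
    by (auto simp: loeb_sets_def)
  then show ?thesis
    by (simp add: loeb_def)
qed

lemma sets_loeb:
  assumes "finite A"
  shows "sets (loeb \<omega> X A) = loeb_sets \<omega> X A"
  unfolding loeb_def using sigma_algebra.sets_measure_of_eq[OF sigma_algebra_loeb_sets[OF assms]] .

lemma emeasure_loeb: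
  assumes A: "finite A" and M: "loeb_approx \<omega> X A M S" "M \<subseteq> upower \<omega> X A"
  shows "emeasure (loeb \<omega> X A) M = ennreal (um A S)"
proof -
  define \<mu> where "\<mu> M = ennreal (THE r. \<exists>S. loeb_approx \<omega> X A M S \<and> r = um A S)" for M
  have \<mu>: "\<mu> M = ennreal (um A S)" if "loeb_approx \<omega> X A M S" for M S
    unfolding \<mu>_def using loeb_approx_the[OF A that] by simp
  have "countably_additive (loeb_sets \<omega> X A) \<mu>"
  proof (rule countably_additiveI)
    fix M :: "nat \<Rightarrow> 'a upoint set"
    assume M: "range M \<subseteq> loeb_sets \<omega> X A" "disjoint_family M"
    then have "\<forall>n. \<exists>S. loeb_approx \<omega> X A (M n) S"
      by (auto simp: loeb_sets_def)
    then obtain S where S: "\<And>n. loeb_approx \<omega> X A (M n) (S n)"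
      by metis
    have int: "internal A (S n)" for n
      using S by (simp add: loeb_approx_iff)
    obtain T where T: "loeb_approx \<omega> X A (\<Union>n. M n) T" "(\<lambda>n. um A (\<lambda>i. \<Union>m\<le>n. S m i)) \<longlonglongrightarrow> um A T"
      using loeb_approx_UN[OF A S] .
    have "um A (\<lambda>i. \<Union>m\<le>n. S m i) = (\<Sum>m\<le>n. um A (S m))" for n
    proof (induction n)
      case (Suc n)
      have "loeb_null \<omega> X A (\<Union>n. sym_diff (M n) (ultraproduct \<omega> (S n)))"
        using S by (intro loeb_null_UN[OF A]) (simp add: loeb_approx_iff)
      \<comment> \<open>Approximants of disjoint sets need not be disjoint, yet every point of an
        overlap lies in one of the error sets.\<close>
      moreover have "ultraproduct \<omega> (\<lambda>i. S (Suc n) i \<inter> (\<Union>m\<le>n. S m i)) \<subseteq> (\<Union>n. sym_diff (M n) (ultraproduct \<omega> (S n)))"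
      proof
        fix x
        assume "x \<in> ultraproduct \<omega> (\<lambda>i. S (Suc n) i \<inter> (\<Union>m\<le>n. S m i))"
        then obtain m where m: "m \<le> n" "x \<in> ultraproduct \<omega> (S m)" "x \<in> ultraproduct \<omega> (S (Suc n))"
          by (auto simp: ultraproduct_Int ultraproduct_UN_le)
        have "M m \<inter> M (Suc n) = {}"
          using M(2) m(1) by (simp add: disjoint_family_on_def)
        then have "x \<notin> M m \<or> x \<notin> M (Suc n)"
          by blast
        then show "x \<in> (\<Union>n. sym_diff (M n) (ultraproduct \<omega> (S n)))"
          using m by blast
      qed
      ultimately have "loeb_null \<omega> X A (ultraproduct \<omega> (\<lambda>i. S (Suc n) i \<inter> (\<Union>m\<le>n. S m i)))"
        by (rule loeb_null_subset)
      then have "um A (\<lambda>i. S (Suc n) i \<inter> (\<Union>m\<le>n. S m i)) = 0"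
        using loeb_null_ultraproduct[OF A internal_Int[OF int, of "Suc n" "\<lambda>i. \<Union>m\<le>n. S m i"]] by simp
      then have "um A (\<lambda>i. S (Suc n) i \<union> (\<Union>m\<le>n. S m i)) = um A (S (Suc n)) + um A (\<lambda>i. \<Union>m\<le>n. S m i)"
        using um_Un_Int[OF A int[of "Suc n"] internal_UN[of A S "{..n}"]] int by simp
      then show ?case
        using Suc by (simp add: atMost_Suc)
    qed simp
    then have "(\<lambda>m. um A (S m)) sums um A T"
      using T(2) by (simp add: sums_def_le)
    then have "(\<lambda>m. ennreal (um A (S m))) sums ennreal (um A T)"
      using um_nonneg[OF A int] T(1) um_nonneg[OF A, of T] by (subst sums_ennreal) (auto simp: loeb_approx_iff)
    then have "(\<Sum>m. \<mu> (M m)) = \<mu> (\<Union>n. M n)"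
      using \<mu>[OF S] \<mu>[OF T(1)] by (simp add: sums_iff)
    then show "(\<Sum>m. \<mu> (M m)) = \<mu> (\<Union> (range M))" .
  qed
  moreover have "positive (loeb_sets \<omega> X A) \<mu>"
    using \<mu>[OF loeb_approx_ultraproduct[OF A internal_empty]] by (simp add: positive_def ultraproduct_empty um_empty)
  moreover have "M \<in> loeb_sets \<omega> X A"
    using M by (auto simp: loeb_sets_def)
  ultimately have "emeasure (measure_of (upower \<omega> X A) (loeb_sets \<omega> X A) \<mu>) M = \<mu> M"
    using emeasure_measure_of_sigma[OF sigma_algebra_loeb_sets[OF A]] by blast
  then show ?thesis
    using \<mu>[OF M(1)] by (simp add: loeb_def \<mu>_def[abs_def])
qed

lemma measure_loeb:
  assumes "finite A" "loeb_approx \<omega> X A M S" "M \<subseteq> upower \<omega> X A"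
  shows "measure (loeb \<omega> X A) M = um A S"
  using emeasure_loeb[OF assms] um_nonneg[OF assms(1), of S] assms(2) by (simp add: measure_def loeb_approx_iff)

lemma ultraproduct_in_sets:
  assumes "finite A" "internal A S"
  shows "ultraproduct \<omega> S \<in> sets (loeb \<omega> X A)"
  using loeb_approx_ultraproduct[OF assms] ultraproduct_subset_upower[OF assms(2)]
  by (auto simp: sets_loeb[OF assms(1)] loeb_sets_def)

lemma measure_ultraproduct:
  assumes "finite A" "internal A S"
  shows "measure (loeb \<omega> X A) (ultraproduct \<omega> S) = um A S"
  using measure_loeb[OF assms(1) loeb_approx_ultraproduct[OF assms] ultraproduct_subset_upower[OF assms(2)]] .

lemma prob_space_loeb:
  assumes "finite A"
  shows "prob_space (loeb \<omega> X A)"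
proof (rule prob_spaceI)
  show "emeasure (loeb \<omega> X A) (space (loeb \<omega> X A)) = 1"
    using emeasure_loeb[OF assms loeb_approx_ultraproduct[OF assms internal_full]]
    by (simp add: upower_def[symmetric] um_full[OF assms])
qed

lemma null_sets_loeb:
  assumes A: "finite A"
  shows "N \<in> null_sets (loeb \<omega> X A) \<longleftrightarrow> N \<subseteq> upower \<omega> X A \<and> loeb_null \<omega> X A N"
proof
  assume N: "N \<in> null_sets (loeb \<omega> X A)"
  then obtain S where S: "N \<subseteq> upower \<omega> X A" "loeb_approx \<omega> X A N S"
    by (auto simp: null_sets_def sets_loeb[OF A] loeb_sets_def)
  then have "um A S = 0"
    using N emeasure_loeb[OF A S(2,1)] um_nonneg[OF A, of S] by (simp add: null_sets_def loeb_approx_iff)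
  then have "loeb_null \<omega> X A (ultraproduct \<omega> S)"
    using S loeb_null_ultraproduct[OF A] by (simp add: loeb_approx_iff)
  then have "loeb_null \<omega> X A (ultraproduct \<omega> S \<union> sym_diff N (ultraproduct \<omega> S))"
    by (rule loeb_null_Un[OF A]) (use S in \<open>simp add: loeb_approx_iff\<close>)
  then show "N \<subseteq> upower \<omega> X A \<and> loeb_null \<omega> X A N"
    using S loeb_null_subset by blast
next
  assume N: "N \<subseteq> upower \<omega> X A \<and> loeb_null \<omega> X A N"
  then have app: "loeb_approx \<omega> X A N (\<lambda>i. {})"
    by (simp add: loeb_approx_iff internal_empty ultraproduct_empty)
  show "N \<in> null_sets (loeb \<omega> X A)"
    using emeasure_loeb[OF A app] N app by (auto simp: null_sets_def um_empty sets_loeb[OF A] loeb_sets_def)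
qed

text \<open>Nullity is defined through covers and so passes to arbitrary subsets. Completeness is
  what later admits Lebesgue sets and the completed cube as targets.\<close>

lemma complete_measure_loeb:
  assumes "finite A"
  shows "complete_measure (loeb \<omega> X A)"
proof
  fix M N
  assume "M \<subseteq> N" "N \<in> null_sets (loeb \<omega> X A)"
  then have "M \<in> null_sets (loeb \<omega> X A)"
    unfolding null_sets_loeb[OF assms] using loeb_null_subset by blast
  then show "M \<in> sets (loeb \<omega> X A)"
    by auto
qed

text \<open>The gate to the finite stages: once measurable sets are replaced by internal ones,
  measures become ultralimits of counts.\<close>

lemma ae_internal:
  assumes A: "finite A" and M: "M \<in> sets (loeb \<omega> X A)"
  obtains S where "internal A S" "AE x in loeb \<omega> X A. x \<in> M \<longleftrightarrow> x \<in> ultraproduct \<omega> S"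
proof -
  obtain S where S: "loeb_approx \<omega> X A M S" "M \<subseteq> upower \<omega> X A"
    using M by (auto simp: sets_loeb[OF A] loeb_sets_def)
  then have "sym_diff M (ultraproduct \<omega> S) \<in> null_sets (loeb \<omega> X A)"
    using ultraproduct_subset_upower[of A S] by (auto simp: null_sets_loeb[OF A] loeb_approx_iff)
  then have "AE x in loeb \<omega> X A. x \<in> M \<longleftrightarrow> x \<in> ultraproduct \<omega> S"
    by (rule AE_I') auto
  then show ?thesis
    using that S by (auto simp: loeb_approx_iff)
qed

end

section \<open>Changing coordinates\<close>

(* The index sets are written {1..k}; the simplifier must not turn them into {Suc 0..k}. *)
declare One_nat_def [simp del]

text \<open>The identification of a power over \<open>B\<close> with the product of a power over
  \<open>A\<close> and one over the coordinates outside of the image of \<open>e\<close>: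
  \<open>z\<close> is moved along \<open>e\<close>, and \<open>y\<close> fills the rest.\<close>

definition merge_points :: "nat set \<Rightarrow> nat set \<Rightarrow> (nat \<Rightarrow> nat) \<Rightarrow> (nat \<Rightarrow> 'a) \<Rightarrow> (nat \<Rightarrow> 'a) \<Rightarrow> nat \<Rightarrow> 'a" where
  "merge_points B A e z y = (\<lambda>m\<in>B. if m \<in> e ` A then z (inv_into A e m) else y m)"

lemma merge_points_on_range:
  "inj_on e A \<Longrightarrow> e ` A \<subseteq> B \<Longrightarrow> j \<in> A \<Longrightarrow> merge_points B A e z y (e j) = z j"
  by (auto simp: merge_points_def)

lemma restrict_merge_points:
  assumes "inj_on e A" "e ` A \<subseteq> B" "z \<in> A \<rightarrow>\<^sub>E Y"
  shows "(\<lambda>j\<in>A. merge_points B A e z y (e j)) = z"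
proof
  fix j
  show "(\<lambda>j\<in>A. merge_points B A e z y (e j)) j = z j"
    using merge_points_on_range[OF assms(1,2), of j] PiE_arb[OF assms(3), of j] by (cases "j \<in> A") simp_all
qed

lemma bij_betw_merge_points:
  assumes e: "inj_on e A" "e ` A \<subseteq> B"
  shows "bij_betw (\<lambda>(z, y). merge_points B A e z y)
    ((A \<rightarrow>\<^sub>E Y) \<times> ((B - e ` A) \<rightarrow>\<^sub>E Y)) (B \<rightarrow>\<^sub>E Y)"
proof (rule bij_betwI[where g = "\<lambda>v. (\<lambda>j\<in>A. v (e j), restrict v (B - e ` A))"])
  show "(\<lambda>(z, y). merge_points B A e z y) \<in> (A \<rightarrow>\<^sub>E Y) \<times> ((B - e ` A) \<rightarrow>\<^sub>E Y) \<rightarrow> (B \<rightarrow>\<^sub>E Y)"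
  proof (clarsimp, rule PiE_I)
    fix z y m
    assume zy: "z \<in> A \<rightarrow>\<^sub>E Y" "y \<in> (B - e ` A) \<rightarrow>\<^sub>E Y"
    show "merge_points B A e z y m \<in> Y" if "m \<in> B"
      using zy that PiE_mem[OF zy(2), of m] PiE_mem[OF zy(1) inv_into_into, of m e]
      by (auto simp: merge_points_def)
  qed (simp add: merge_points_def)
  show "(\<lambda>v. (\<lambda>j\<in>A. v (e j), restrict v (B - e ` A))) \<in> (B \<rightarrow>\<^sub>E Y) \<rightarrow> (A \<rightarrow>\<^sub>E Y) \<times> ((B - e ` A) \<rightarrow>\<^sub>E Y)"
    using e by (auto simp: PiE_def Pi_def)
next
  fix p
  assume p: "p \<in> (A \<rightarrow>\<^sub>E Y) \<times> ((B - e ` A) \<rightarrow>\<^sub>E Y)"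
  obtain z y where zy: "p = (z, y)" "z \<in> A \<rightarrow>\<^sub>E Y" "y \<in> (B - e ` A) \<rightarrow>\<^sub>E Y"
    using p by auto
  have "(\<lambda>j\<in>A. merge_points B A e z y (e j)) = z"
    by (rule restrict_merge_points[OF e zy(2)])
  moreover have "restrict (merge_points B A e z y) (B - e ` A) = y"
    using PiE_arb[OF zy(3)] by (force simp: fun_eq_iff merge_points_def restrict_def)
  ultimately show "(\<lambda>j\<in>A. (case p of (z, y) \<Rightarrow> merge_points B A e z y) (e j),
      restrict (case p of (z, y) \<Rightarrow> merge_points B A e z y) (B - e ` A)) = p"
    using zy by simp
next
  fix v
  assume v: "v \<in> B \<rightarrow>\<^sub>E Y"
  have "merge_points B A e (\<lambda>j\<in>A. v (e j)) (restrict v (B - e ` A)) m = v m" for m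
    using PiE_arb[OF v, of m] by (simp add: merge_points_def inv_into_into f_inv_into_f)
  then show "(case (\<lambda>j\<in>A. v (e j), restrict v (B - e ` A)) of (z, y) \<Rightarrow> merge_points B A e z y) = v"
    by auto
qed

section \<open>Pull-backs along injections of index sets\<close>

context ultra_powers
begin

text \<open>Reindexing covers projections (\<open>e\<close> the identity on a subset), permutations
  of the coordinates and enumerations of a set of coordinates by an initial segment, so one calculus
  serves all of them.\<close>

definition pull :: "nat set \<Rightarrow> (nat \<Rightarrow> nat) \<Rightarrow> 'a upoint \<Rightarrow> 'a upoint" where
  "pull A e = umap \<omega> (\<lambda>v. \<lambda>j\<in>A. v (e j))"

definition pre :: "nat set \<Rightarrow> nat set \<Rightarrow> (nat \<Rightarrow> nat) \<Rightarrow> 'a upoint set \<Rightarrow> 'a upoint set" where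
  "pre B A e M = {x \<in> upower \<omega> X B. pull A e x \<in> M}"

definition ipre :: "nat set \<Rightarrow> nat set \<Rightarrow> (nat \<Rightarrow> nat) \<Rightarrow> (nat \<Rightarrow> (nat \<Rightarrow> 'a) set) \<Rightarrow> nat \<Rightarrow> (nat \<Rightarrow> 'a) set" where
  "ipre B A e S i = {v \<in> fpower X B i. (\<lambda>j\<in>A. v (e j)) \<in> S i}"

definition coord_inj :: "nat set \<Rightarrow> nat set \<Rightarrow> (nat \<Rightarrow> nat) \<Rightarrow> bool" where
  "coord_inj A B e \<longleftrightarrow> finite B \<and> inj_on e A \<and> e ` A \<subseteq> B"

lemma coord_inj_finite: "coord_inj A B e \<Longrightarrow> finite A"
  unfolding coord_inj_def using finite_imageD finite_subset by blast

lemma coord_inj_id: "finite B \<Longrightarrow> A \<subseteq> B \<Longrightarrow> coord_inj A B (\<lambda>j. j)"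
  by (simp add: coord_inj_def)

lemma coord_inj_comp: "coord_inj A B e \<Longrightarrow> coord_inj B C g \<Longrightarrow> coord_inj A C (\<lambda>j. g (e j))"
  unfolding coord_inj_def using comp_inj_on[of e A g] inj_on_subset[of g B "e ` A"] by (auto simp: comp_def)

lemma pull_cls: "pull A e (cls f) = cls (\<lambda>i. \<lambda>j\<in>A. f i (e j))"
  by (simp add: pull_def umap_class)

lemma internal_ipre: "internal B (ipre B A e S)"
  by (auto simp: internal_def ipre_def)

lemma pre_subset: "pre B A e M \<subseteq> upower \<omega> X B"
  by (auto simp: pre_def)

lemma pre_mono: "M \<subseteq> N \<Longrightarrow> pre B A e M \<subseteq> pre B A e N"
  by (auto simp: pre_def)

lemma restrict_fpower:
  assumes "e ` A \<subseteq> B" "v \<in> fpower X B i"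
  shows "(\<lambda>j\<in>A. v (e j)) \<in> fpower X A i"
  using assms by (auto simp: fpower_def PiE_def Pi_def)

lemma pull_upower:
  assumes "e ` A \<subseteq> B" "x \<in> upower \<omega> X B"
  shows "pull A e x \<in> upower \<omega> X A"
proof -
  obtain f where f: "x = cls f" "eventually (\<lambda>i. f i \<in> fpower X B i) \<omega>"
    using assms(2) unfolding upower_def by (rule ultraproductE)
  then show ?thesis
    unfolding upower_def f(1) pull_cls cls_in_ultraproduct
    by (elim eventually_mono) (rule restrict_fpower[OF assms(1)])
qed

lemma pull_cong: "(\<And>j. j \<in> A \<Longrightarrow> e j = e' j) \<Longrightarrow> pull A e x = pull A e' x"
  unfolding pull_def by (simp cong: restrict_cong)

lemma pull_pull:
  assumes "e ` A \<subseteq> B" "x \<in> upower \<omega> X C"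
  shows "pull A e (pull B g x) = pull A (\<lambda>j. g (e j)) x"
proof -
  obtain f where f: "x = cls f"
    using assms(2) unfolding upower_def by (rule ultraproductE)
  have "(\<lambda>j\<in>A. (\<lambda>j\<in>B. f i (g j)) (e j)) = (\<lambda>j\<in>A. f i (g (e j)))" for i
    using assms(1) by (auto simp: fun_eq_iff restrict_def)
  then show ?thesis
    by (simp add: f pull_cls)
qed

lemma pull_id:
  assumes "x \<in> upower \<omega> X A"
  shows "pull A (\<lambda>j. j) x = x"
proof -
  obtain f where f: "x = cls f" "eventually (\<lambda>i. f i \<in> fpower X A i) \<omega>"
    using assms unfolding upower_def by (rule ultraproductE)
  show ?thesis
    unfolding f(1) pull_cls cls_eq_iff
    using f(2) by eventually_elim (simp add: fpower_def PiE_restrict)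
qed

lemma pre_pre:
  assumes "e ` A \<subseteq> B" "g ` B \<subseteq> C"
  shows "pre C B g (pre B A e M) = pre C A (\<lambda>j. g (e j)) M"
  using assms by (auto simp: pre_def pull_pull pull_upower)

lemma pre_cong: "(\<And>j. j \<in> A \<Longrightarrow> e j = e' j) \<Longrightarrow> pre B A e M = pre B A e' M"
  unfolding pre_def using pull_cong[of A e e'] by simp

lemma pre_id: "M \<subseteq> upower \<omega> X A \<Longrightarrow> pre A A (\<lambda>j. j) M = M"
  by (auto simp: pre_def pull_id)

lemma pre_Int: "pre B A e (M \<inter> N) = pre B A e M \<inter> pre B A e N"
  by (auto simp: pre_def)

lemma pre_ultraproduct: "pre B A e (ultraproduct \<omega> S) = ultraproduct \<omega> (ipre B A e S)"
proof -
  have "cls f \<in> pre B A e (ultraproduct \<omega> S) \<longleftrightarrow> cls f \<in> ultraproduct \<omega> (ipre B A e S)" for f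
    by (simp add: pre_def pull_cls cls_in_ultraproduct upower_def ipre_def eventually_conj_iff)
  moreover have "\<exists>f. x = cls f" if "x \<in> pre B A e (ultraproduct \<omega> S) \<or> x \<in> ultraproduct \<omega> (ipre B A e S)" for x
    using that by (auto simp: pre_def upower_def elim: ultraproductE)
  ultimately show ?thesis
    by blast
qed

lemma ipre_eq_merge:
  assumes e: "inj_on e A" "e ` A \<subseteq> B" and S: "S i \<subseteq> fpower X A i"
  shows "ipre B A e S i = (\<lambda>(z, y). merge_points B A e z y) ` (S i \<times> fpower X (B - e ` A) i)"
proof -
  have bij: "bij_betw (\<lambda>(z, y). merge_points B A e z y) (fpower X A i \<times> fpower X (B - e ` A) i) (fpower X B i)"
    unfolding fpower_def by (rule bij_betw_merge_points[OF e])
  have rel: "(\<lambda>j\<in>A. merge_points B A e z y (e j)) = z" if "z \<in> fpower X A i" for z y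
    using restrict_merge_points[OF e] that by (simp add: fpower_def)
  show ?thesis
  proof (intro set_eqI iffI)
    fix v
    assume v: "v \<in> ipre B A e S i"
    then obtain z y where "z \<in> fpower X A i" "y \<in> fpower X (B - e ` A) i" "v = merge_points B A e z y"
      using bij_betw_imp_surj_on[OF bij] by (force simp: ipre_def)
    then show "v \<in> (\<lambda>(z, y). merge_points B A e z y) ` (S i \<times> fpower X (B - e ` A) i)"
      using v rel by (auto simp: ipre_def)
  next
    fix v
    assume "v \<in> (\<lambda>(z, y). merge_points B A e z y) ` (S i \<times> fpower X (B - e ` A) i)"
    then obtain z y where zy: "z \<in> S i" "y \<in> fpower X (B - e ` A) i" "v = merge_points B A e z y"
      by auto
    then have "z \<in> fpower X A i"
      using S by auto
    then show "v \<in> ipre B A e S i"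
      using zy rel bij_betwE[OF bij] by (auto simp: ipre_def)
  qed
qed

lemma card_fpower_split:
  assumes "coord_inj A B e"
  shows "card (fpower X B i) = card (fpower X A i) * card (fpower X (B - e ` A) i)"
  using bij_betw_same_card[OF bij_betw_merge_points[of e A B "X i"]] assms
  by (simp add: fpower_def coord_inj_def card_cartesian_product)

text \<open>Over each point of the \<open>A\<close>-th power the reindexing map has a fibre of the
  same size, so the fractions are preserved exactly at every stage from 1 on.\<close>

lemma um_ipre:
  assumes e: "coord_inj A B e" and S: "internal A S"
  shows "um B (ipre B A e S) = um A S"
proof (rule um_eqI)
  have fin: "finite A" "finite B"
    using e coord_inj_finite by (auto simp: coord_inj_def)
  have "eventually (\<lambda>i. frac A S i = frac B (ipre B A e S) i) \<omega>"
    using eventually_ge[of 1]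
  proof eventually_elim
    case (elim i)
    have bij: "inj_on (\<lambda>(z, y). merge_points B A e z y) (fpower X A i \<times> fpower X (B - e ` A) i)"
      unfolding fpower_def using bij_betw_merge_points[of e A B] e by (auto simp: bij_betw_def coord_inj_def)
    have "card (ipre B A e S i) = card (S i \<times> fpower X (B - e ` A) i)"
      using e internalD[OF S, of i] ipre_eq_merge[of e A B S i]
      by (simp add: coord_inj_def) (intro card_image inj_on_subset[OF bij], auto)
    moreover have "card (fpower X (B - e ` A) i) \<noteq> 0"
      using finite_fpower[of "B - e ` A" i] fin fpower_nonempty[of i "B - e ` A"] elim by (simp add: card_eq_0_iff)
    ultimately show ?case
      using card_fpower_split[OF e, of i] by (simp add: frac_def card_cartesian_product)
  qed
  then show "(frac B (ipre B A e S) \<longlongrightarrow> um A S) \<omega>"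
    using frac_tendsto[OF fin(1) S] by (rule tendsto_cong[THEN iffD1])
qed

lemma loeb_null_pre:
  assumes e: "coord_inj A B e" and N: "loeb_null \<omega> X A N"
  shows "loeb_null \<omega> X B (pre B A e N)"
proof (rule loeb_nullI)
  fix \<epsilon> :: real
  assume "0 < \<epsilon>"
  with N obtain S where S: "internal A S" "N \<subseteq> ultraproduct \<omega> S" "um A S < \<epsilon>"
    by (rule loeb_nullE)
  then have "um B (ipre B A e S) < \<epsilon>" "pre B A e N \<subseteq> ultraproduct \<omega> (ipre B A e S)"
    using um_ipre[OF e] by (simp_all add: pre_mono pre_ultraproduct[symmetric])
  then show "\<exists>S. internal B S \<and> pre B A e N \<subseteq> ultraproduct \<omega> S \<and> um B S < \<epsilon>"
    using internal_ipre by blast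
qed

lemma loeb_approx_pre:
  assumes e: "coord_inj A B e" and M: "loeb_approx \<omega> X A M S"
  shows "loeb_approx \<omega> X B (pre B A e M) (ipre B A e S)"
proof -
  have "sym_diff (pre B A e M) (ultraproduct \<omega> (ipre B A e S)) = pre B A e (sym_diff M (ultraproduct \<omega> S))"
    unfolding pre_ultraproduct[symmetric] by (auto simp: pre_def)
  then show ?thesis
    using M loeb_null_pre[OF e] by (simp add: loeb_approx_iff internal_ipre)
qed

lemma pre_in_sets:
  assumes e: "coord_inj A B e" and M: "M \<in> sets (loeb \<omega> X A)"
  shows "pre B A e M \<in> sets (loeb \<omega> X B)"
proof -
  have fin: "finite A" "finite B"
    using e coord_inj_finite by (auto simp: coord_inj_def)
  show ?thesis
    using M loeb_approx_pre[OF e] pre_subset[of B A e M]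
    unfolding sets_loeb[OF fin(1)] sets_loeb[OF fin(2)] loeb_sets_def by blast
qed

lemma measure_pre:
  assumes e: "coord_inj A B e" and M: "M \<in> sets (loeb \<omega> X A)"
  shows "measure (loeb \<omega> X B) (pre B A e M) = measure (loeb \<omega> X A) M"
proof -
  have fin: "finite A" "finite B"
    using e coord_inj_finite by (auto simp: coord_inj_def)
  obtain S where S: "loeb_approx \<omega> X A M S" "M \<subseteq> upower \<omega> X A"
    using M by (auto simp: sets_loeb[OF fin(1)] loeb_sets_def)
  show ?thesis
    using measure_loeb[OF fin(2) loeb_approx_pre[OF e S(1)] pre_subset] measure_loeb[OF fin(1) S] um_ipre[OF e, of S] S(1)
    by (simp add: loeb_approx_iff)
qed

lemma pull_measurable:
  assumes "coord_inj A B e"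
  shows "pull A e \<in> measurable (loeb \<omega> X B) (loeb \<omega> X A)"
proof (rule measurableI)
  show "pull A e x \<in> space (loeb \<omega> X A)" if "x \<in> space (loeb \<omega> X B)" for x
    using that assms by (auto simp: coord_inj_def intro: pull_upower)
  show "pull A e -` M \<inter> space (loeb \<omega> X B) \<in> sets (loeb \<omega> X B)" if "M \<in> sets (loeb \<omega> X A)" for M
    using pre_in_sets[OF assms that] by (simp add: pre_def vimage_def Collect_conj_eq Int_commute)
qed

lemma distr_pull:
  assumes "coord_inj A B e"
  shows "distr (loeb \<omega> X B) (loeb \<omega> X A) (pull A e) = loeb \<omega> X A"
proof (rule measure_eqI)
  have fin: "finite A" "finite B"
    using assms coord_inj_finite by (auto simp: coord_inj_def)
  interpret A: prob_space "loeb \<omega> X A"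
    by (rule prob_space_loeb[OF fin(1)])
  interpret B: prob_space "loeb \<omega> X B"
    by (rule prob_space_loeb[OF fin(2)])
  fix M
  assume "M \<in> sets (distr (loeb \<omega> X B) (loeb \<omega> X A) (pull A e))"
  then have M: "M \<in> sets (loeb \<omega> X A)"
    by simp
  have "pull A e -` M \<inter> space (loeb \<omega> X B) = pre B A e M"
    by (auto simp: pre_def)
  then show "emeasure (distr (loeb \<omega> X B) (loeb \<omega> X A) (pull A e)) M = emeasure (loeb \<omega> X A) M"
    using measure_pre[OF assms M] pull_measurable[OF assms] M
    by (simp add: emeasure_distr A.emeasure_eq_measure B.emeasure_eq_measure)
qed simp

lemma AE_pull:
  assumes "coord_inj A B e" and "AE x in loeb \<omega> X A. P x"
  shows "AE x in loeb \<omega> X B. P (pull A e x)"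
  by (rule AE_distrD[OF pull_measurable[OF assms(1)]]) (simp only: distr_pull[OF assms(1)] assms(2))

section \<open>The coordinate sigma-algebras\<close>

lemma sets_sigma_coord:
  assumes "B \<subseteq> {1..k}"
  shows "sets (sigma_coord \<omega> X k B) = pre {1..k} B (\<lambda>j. j) ` sets (loeb \<omega> X B)"
proof -
  have eq: "umap \<omega> (\<lambda>v. restrict v B) = pull B (\<lambda>j. j)"
    by (simp add: pull_def)
  have "pull B (\<lambda>j. j) \<in> upower \<omega> X {1..k} \<rightarrow> space (loeb \<omega> X B)"
    using assms by (auto intro: pull_upower)
  then show ?thesis
    unfolding sigma_coord_def eq by (subst sets_vimage_algebra2) (auto simp: pre_def)
qed

text \<open>Truncated subtraction makes the empty set the only facet of a singleton and also of the
  empty set. So a finite set always has a facet, and intersections over all facets are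
  meaningful.\<close>

definition facets :: "nat set \<Rightarrow> nat set set" where
  "facets D = {B. B \<subseteq> D \<and> card B = card D - 1}"

lemma facets_finite: "finite D \<Longrightarrow> finite (facets D)"
  unfolding facets_def by (rule finite_subset[of _ "Pow D"]) auto

lemma facets_nonempty: "finite D \<Longrightarrow> facets D \<noteq> {}"
proof -
  have "card D - 1 \<le> card D"
    by simp
  then obtain T where "T \<subseteq> D" "card T = card D - 1"
    by (rule obtain_subset_with_card_n)
  then have "T \<in> facets D"
    by (simp add: facets_def)
  then show ?thesis
    by auto
qed

lemma facets_subset: "B \<in> facets D \<Longrightarrow> B \<subseteq> D"
  by (simp add: facets_def)

lemma facet_superset:
  assumes "finite D" "A \<subset> D"
  obtains B where "B \<in> facets D" "A \<subseteq> B"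
proof -
  obtain d where d: "d \<in> D" "d \<notin> A"
    using assms(2) by auto
  then have "D - {d} \<in> facets D" "A \<subseteq> D - {d}"
    using assms by (auto simp: facets_def card_Diff_singleton)
  then show ?thesis
    by (rule that)
qed

lemma facet_proper: "finite D \<Longrightarrow> D \<noteq> {} \<Longrightarrow> B \<in> facets D \<Longrightarrow> \<not> D \<subseteq> B"
  using card_mono[of B D] by (auto simp: facets_def card_gt_0_iff dest: finite_subset)

text \<open>One factor for each facet. Unlike the union of the facet sigma-algebras, these sets are
  closed under intersection, so Dynkin arguments apply; a facet without constraint has its full
  power as factor.\<close>

definition cylinders :: "nat \<Rightarrow> nat set \<Rightarrow> 'a upoint set set" where
  "cylinders k D = {\<Inter>B\<in>facets D. pre {1..k} B (\<lambda>j. j) (G B) | G. \<forall>B\<in>facets D. G B \<in> sets (loeb \<omega> X B)}"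

lemma cylindersI:
  "(\<And>B. B \<in> facets D \<Longrightarrow> G B \<in> sets (loeb \<omega> X B)) \<Longrightarrow>
    (\<Inter>B\<in>facets D. pre {1..k} B (\<lambda>j. j) (G B)) \<in> cylinders k D"
  unfolding cylinders_def by blast

lemma cylinders_events:
  assumes "D \<subseteq> {1..k}"
  shows "cylinders k D \<subseteq> sets (loeb \<omega> X {1..k})"
proof
  fix C
  assume "C \<in> cylinders k D"
  then obtain G where G: "C = (\<Inter>B\<in>facets D. pre {1..k} B (\<lambda>j. j) (G B))" "\<And>B. B \<in> facets D \<Longrightarrow> G B \<in> sets (loeb \<omega> X B)"
    by (auto simp: cylinders_def)
  have D: "finite D"
    using assms finite_subset by blast
  show "C \<in> sets (loeb \<omega> X {1..k})"
    unfolding G(1) using facets_finite[OF D] facets_nonempty[OF D] facets_subset assms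
    by (intro sets.finite_INT pre_in_sets coord_inj_id G(2)) auto
qed

lemma pre_upower: "e ` A \<subseteq> B \<Longrightarrow> pre B A e (upower \<omega> X A) = upower \<omega> X B"
  by (auto simp: pre_def intro: pull_upower)

lemma upower_in_sets: "upower \<omega> X B \<in> sets (loeb \<omega> X B)"
  using sets.top[of "loeb \<omega> X B"] by simp

lemma pre_in_cylinders:
  assumes D: "D \<subseteq> {1..k}" and B: "B \<in> facets D" and M: "M \<in> sets (loeb \<omega> X B)"
  shows "pre {1..k} B (\<lambda>j. j) M \<in> cylinders k D"
proof -
  define G where "G B' = (if B' = B then M else upower \<omega> X B')" for B'
  have "pre {1..k} B' (\<lambda>j. j) (upower \<omega> X B') = upower \<omega> X {1..k}" if "B' \<in> facets D" for B'
    using facets_subset[OF that] D by (intro pre_upower) auto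
  then have "pre {1..k} B (\<lambda>j. j) M = (\<Inter>B\<in>facets D. pre {1..k} B (\<lambda>j. j) (G B))"
    using B pre_subset[of "{1..k}" B "\<lambda>j. j" M] by (auto simp: G_def)
  moreover have "G B \<in> sets (loeb \<omega> X B)" for B
    using M upower_in_sets by (simp add: G_def)
  ultimately show ?thesis
    using cylindersI[of D G] by simp
qed

lemma sets_sigma_coord_star:
  assumes D: "D \<subseteq> {1..k}"
  shows "sets (sigma_coord_star \<omega> X k D) = sigma_sets (upower \<omega> X {1..k}) (cylinders k D)"
    and "Int_stable (cylinders k D)"
    and "upower \<omega> X {1..k} \<in> cylinders k D"
    and "space (sigma_coord_star \<omega> X k D) = upower \<omega> X {1..k}"
proof -
  let ?U = "\<Union>B\<in>facets D. sets (sigma_coord \<omega> X k B)"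
  have fD: "finite D"
    using D finite_subset by blast
  have pow: "?U \<subseteq> Pow (upower \<omega> X {1..k})"
    by (auto simp: sets_sigma_coord[OF order_trans[OF facets_subset D]] dest: subsetD[OF pre_subset])
  have "?U \<subseteq> cylinders k D"
    using pre_in_cylinders[OF D] by (auto simp: sets_sigma_coord[OF order_trans[OF facets_subset D]])
  moreover have "cylinders k D \<subseteq> sigma_sets (upower \<omega> X {1..k}) ?U"
  proof
    fix C
    assume "C \<in> cylinders k D"
    then obtain G where G: "C = (\<Inter>B\<in>facets D. pre {1..k} B (\<lambda>j. j) (G B))" "\<And>B. B \<in> facets D \<Longrightarrow> G B \<in> sets (loeb \<omega> X B)"
      by (auto simp: cylinders_def)
    interpret sigma_algebra "upower \<omega> X {1..k}" "sigma_sets (upower \<omega> X {1..k}) ?U"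
      using pow by (rule sigma_algebra_sigma_sets)
    show "C \<in> sigma_sets (upower \<omega> X {1..k}) ?U"
      unfolding G(1)
    proof (rule finite_INT[OF facets_finite[OF fD] facets_nonempty[OF fD]])
      fix B
      assume "B \<in> facets D"
      then show "pre {1..k} B (\<lambda>j. j) (G B) \<in> sigma_sets (upower \<omega> X {1..k}) ?U"
        using G(2) by (intro sigma_sets.Basic) (auto simp: sets_sigma_coord[OF order_trans[OF facets_subset D]])
    qed
  qed
  ultimately have "sigma_sets (upower \<omega> X {1..k}) (cylinders k D) = sigma_sets (upower \<omega> X {1..k}) ?U"
    by (intro sigma_sets_eqI) (auto intro: sigma_sets.Basic)
  moreover have "sets (sigma_coord_star \<omega> X k D) = sigma_sets (upower \<omega> X {1..k}) ?U"
    unfolding sigma_coord_star_def facets_def[symmetric] using pow by (rule sets_measure_of)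
  ultimately show "sets (sigma_coord_star \<omega> X k D) = sigma_sets (upower \<omega> X {1..k}) (cylinders k D)"
    by simp
  show "space (sigma_coord_star \<omega> X k D) = upower \<omega> X {1..k}"
    unfolding sigma_coord_star_def facets_def[symmetric] using pow by (rule space_measure_of)
  show "Int_stable (cylinders k D)"
  proof (rule Int_stableI)
    fix C C'
    assume "C \<in> cylinders k D" "C' \<in> cylinders k D"
    then obtain G G' where
      G: "C = (\<Inter>B\<in>facets D. pre {1..k} B (\<lambda>j. j) (G B))" "\<forall>B\<in>facets D. G B \<in> sets (loeb \<omega> X B)" and
      G': "C' = (\<Inter>B\<in>facets D. pre {1..k} B (\<lambda>j. j) (G' B))" "\<forall>B\<in>facets D. G' B \<in> sets (loeb \<omega> X B)"
      by (auto simp: cylinders_def)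
    have "C \<inter> C' = (\<Inter>B\<in>facets D. pre {1..k} B (\<lambda>j. j) (G B \<inter> G' B))"
      unfolding G(1) G'(1) pre_Int INT_Int_distrib ..
    moreover have "\<forall>B\<in>facets D. G B \<inter> G' B \<in> sets (loeb \<omega> X B)"
      using G(2) G'(2) by auto
    ultimately show "C \<inter> C' \<in> cylinders k D"
      using cylindersI[of D "\<lambda>B. G B \<inter> G' B"] by simp
  qed
  show "upower \<omega> X {1..k} \<in> cylinders k D"
  proof -
    have "upower \<omega> X {1..k} = (\<Inter>B\<in>facets D. pre {1..k} B (\<lambda>j. j) (upower \<omega> X B))"
      using facets_nonempty[OF fD] pre_upower[of "\<lambda>j. j" _ "{1..k}"] order_trans[OF facets_subset D] by auto
    then show ?thesis
      using cylindersI[of D "upower \<omega> X"] upower_in_sets by simp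
  qed
qed

lemma pre_in_star:
  assumes "D \<subseteq> {1..k}" "B \<in> facets D" "M \<in> sets (loeb \<omega> X B)"
  shows "pre {1..k} B (\<lambda>j. j) M \<in> sets (sigma_coord_star \<omega> X k D)"
  using pre_in_cylinders[OF assms] by (auto simp: sets_sigma_coord_star(1)[OF assms(1)])

lemma subalgebra_star:
  assumes "D \<subseteq> {1..k}"
  shows "subalgebra (loeb \<omega> X {1..k}) (sigma_coord_star \<omega> X k D)"
  using sets.sigma_sets_subset[OF cylinders_events[OF assms]] sets_sigma_coord_star(1,4)[OF assms]
  by (simp add: subalgebra_def)

lemma star_proportional:
  assumes D: "D \<subseteq> {1..k}" and S: "S \<in> sets (loeb \<omega> X {1..k})" "T \<in> sets (loeb \<omega> X {1..k})"
    and eq: "\<And>G. (\<And>B. B \<in> facets D \<Longrightarrow> G B \<in> sets (loeb \<omega> X B)) \<Longrightarrow>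
      measure (loeb \<omega> X {1..k}) (S \<inter> (\<Inter>B\<in>facets D. pre {1..k} B (\<lambda>j. j) (G B)))
      = c * measure (loeb \<omega> X {1..k}) (T \<inter> (\<Inter>B\<in>facets D. pre {1..k} B (\<lambda>j. j) (G B)))"
    and G: "G \<in> sets (sigma_coord_star \<omega> X k D)"
  shows "measure (loeb \<omega> X {1..k}) (S \<inter> G) = c * measure (loeb \<omega> X {1..k}) (T \<inter> G)"
proof -
  interpret prob_space "loeb \<omega> X {1..k}"
    by (rule prob_space_loeb) simp
  show ?thesis
  proof (rule prob_proportional_sigma_sets[OF sets_sigma_coord_star(2)[OF D] cylinders_events[OF D] _ S])
    show "space (loeb \<omega> X {1..k}) \<in> cylinders k D"
      using sets_sigma_coord_star(3)[OF D] by simp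
    show "G \<in> sigma_sets (space (loeb \<omega> X {1..k})) (cylinders k D)"
      using G sets_sigma_coord_star(1)[OF D] by simp
    show "prob (S \<inter> C) = c * prob (T \<inter> C)" if C: "C \<in> cylinders k D" for C
    proof -
      obtain H where H: "C = (\<Inter>B\<in>facets D. pre {1..k} B (\<lambda>j. j) (H B))" "\<And>B. B \<in> facets D \<Longrightarrow> H B \<in> sets (loeb \<omega> X B)"
        using C unfolding cylinders_def by blast
      show ?thesis
        unfolding H(1) by (rule eq) (rule H(2))
    qed
  qed
qed

text \<open>Each factor of a cylinder agrees almost everywhere with an internal set. An identity on
  the whole star sigma-algebra thus reduces to ultralimits of counts over internal cylinders, of
  which each finite stage has only finitely many.\<close>

lemma star_proportional_internal:
  assumes D: "D \<subseteq> {1..k}" and S: "internal {1..k} S" "internal {1..k} T"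
    and eq: "\<And>H. (\<And>B. B \<in> facets D \<Longrightarrow> internal B (H B)) \<Longrightarrow>
      um {1..k} (\<lambda>i. S i \<inter> (\<Inter>B\<in>facets D. ipre {1..k} B (\<lambda>j. j) (H B) i))
      = c * um {1..k} (\<lambda>i. T i \<inter> (\<Inter>B\<in>facets D. ipre {1..k} B (\<lambda>j. j) (H B) i))"
    and G: "G \<in> sets (sigma_coord_star \<omega> X k D)"
  shows "measure (loeb \<omega> X {1..k}) (ultraproduct \<omega> S \<inter> G) = c * measure (loeb \<omega> X {1..k}) (ultraproduct \<omega> T \<inter> G)"
proof (rule star_proportional[OF D _ _ _ G])
  have fD: "finite D"
    using D finite_subset by blast
  interpret prob_space "loeb \<omega> X {1..k}"
    by (rule prob_space_loeb) simp
  show "ultraproduct \<omega> S \<in> sets (loeb \<omega> X {1..k})" "ultraproduct \<omega> T \<in> sets (loeb \<omega> X {1..k})"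
    using S by (simp_all add: ultraproduct_in_sets)
  fix G
  assume G: "\<And>B. B \<in> facets D \<Longrightarrow> G B \<in> sets (loeb \<omega> X B)"
  have "\<exists>H. \<forall>B\<in>facets D. internal B (H B) \<and> (AE x in loeb \<omega> X B. x \<in> G B \<longleftrightarrow> x \<in> ultraproduct \<omega> (H B))"
  proof (rule bchoice, rule ballI)
    fix B
    assume B: "B \<in> facets D"
    then have "finite B"
      using facets_subset fD finite_subset by blast
    then show "\<exists>H. internal B H \<and> (AE x in loeb \<omega> X B. x \<in> G B \<longleftrightarrow> x \<in> ultraproduct \<omega> H)"
      using ae_internal[OF _ G[OF B]] by blast
  qed
  then obtain H where H: "\<And>B. B \<in> facets D \<Longrightarrow> internal B (H B)"
    "\<And>B. B \<in> facets D \<Longrightarrow> AE x in loeb \<omega> X B. x \<in> G B \<longleftrightarrow> x \<in> ultraproduct \<omega> (H B)"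
    by blast
  have "AE x in loeb \<omega> X {1..k}. x \<in> pre {1..k} B (\<lambda>j. j) (G B) \<longleftrightarrow> x \<in> ultraproduct \<omega> (ipre {1..k} B (\<lambda>j. j) (H B))"
    if B: "B \<in> facets D" for B
  proof -
    have "coord_inj B {1..k} (\<lambda>j. j)"
      using facets_subset[OF B] D by (intro coord_inj_id) auto
    then show ?thesis
      by (rule AE_pull[OF _ H(2)[OF B], THEN eventually_mono]) (auto simp: pre_ultraproduct[symmetric] pre_def)
  qed
  then have "AE x in loeb \<omega> X {1..k}. \<forall>B\<in>facets D. x \<in> pre {1..k} B (\<lambda>j. j) (G B)
      \<longleftrightarrow> x \<in> ultraproduct \<omega> (ipre {1..k} B (\<lambda>j. j) (H B))"
    using facets_finite[OF fD] by (intro AE_finite_allI)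
  then have ae: "AE x in loeb \<omega> X {1..k}. x \<in> (\<Inter>B\<in>facets D. pre {1..k} B (\<lambda>j. j) (G B)) \<longleftrightarrow>
      x \<in> ultraproduct \<omega> (\<lambda>i. \<Inter>B\<in>facets D. ipre {1..k} B (\<lambda>j. j) (H B) i)"
    by (rule eventually_mono)
      (simp add: ultraproduct_INT[OF facets_finite[OF fD] facets_nonempty[OF fD], where S = "\<lambda>B. ipre {1..k} B (\<lambda>j. j) (H B)"])
  have "prob (ultraproduct \<omega> S \<inter> (\<Inter>B\<in>facets D. pre {1..k} B (\<lambda>j. j) (G B)))
      = um {1..k} (\<lambda>i. S i \<inter> (\<Inter>B\<in>facets D. ipre {1..k} B (\<lambda>j. j) (H B) i))"
    if S: "internal {1..k} S" for S
  proof -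
    let ?C = "\<lambda>i. S i \<inter> (\<Inter>B\<in>facets D. ipre {1..k} B (\<lambda>j. j) (H B) i)"
    have C: "internal {1..k} ?C"
      using S by (rule internal_Int)
    have ev: "(\<Inter>B\<in>facets D. pre {1..k} B (\<lambda>j. j) (G B)) \<in> sets (loeb \<omega> X {1..k})"
      using cylinders_events[OF D] cylindersI[of D G k] G by blast
    have "prob (ultraproduct \<omega> S \<inter> (\<Inter>B\<in>facets D. pre {1..k} B (\<lambda>j. j) (G B))) = prob (ultraproduct \<omega> ?C)"
    proof (rule finite_measure_eq_AE)
      show "AE x in loeb \<omega> X {1..k}. x \<in> ultraproduct \<omega> S \<inter> (\<Inter>B\<in>facets D. pre {1..k} B (\<lambda>j. j) (G B))
          \<longleftrightarrow> x \<in> ultraproduct \<omega> ?C"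
        using ae by eventually_elim (simp add: ultraproduct_Int)
    qed (use ultraproduct_in_sets[OF _ S] ultraproduct_in_sets[OF _ C] ev in auto)
    then show ?thesis
      using measure_ultraproduct[OF _ C] by simp
  qed
  then show "prob (ultraproduct \<omega> S \<inter> (\<Inter>B\<in>facets D. pre {1..k} B (\<lambda>j. j) (G B)))
      = c * prob (ultraproduct \<omega> T \<inter> (\<Inter>B\<in>facets D. pre {1..k} B (\<lambda>j. j) (G B)))"
    using S eq[OF H(1)] by simp
qed

end

section \<open>Random sets have small discrepancy\<close>

text \<open>A bound on the moment generating function of a fair sign. The sharper exponent
  \<open>x\<^sup>2 / 2\<close> would only improve constants; on the unit interval quadratic bounds
  for both exponentials are enough.\<close>

lemma exp_plus_exp_minus_le:
  fixes x :: real
  assumes "0 \<le> x" "x \<le> 1"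
  shows "exp x + exp (- x) \<le> 2 * exp (x\<^sup>2)"
proof -
  have "1 \<le> (1 - x + x\<^sup>2) * (1 + x)"
    using assms by (simp add: algebra_simps power2_eq_square)
  also have "\<dots> \<le> (1 - x + x\<^sup>2) * exp x"
    using assms by (intro mult_left_mono) (auto simp: exp_ge_add_one_self)
  finally have "exp (- x) \<le> 1 - x + x\<^sup>2"
    by (simp add: exp_minus field_simps)
  moreover have "exp x \<le> 1 + x + x\<^sup>2"
    using assms by (rule exp_bound)
  moreover have "1 + x\<^sup>2 \<le> exp (x\<^sup>2)"
    by (rule exp_ge_add_one_self)
  ultimately show ?thesis
    by linarith
qed

text \<open>When all subsets are equally likely, the memberships of the points are independent, so
  the sum factors over \<open>V\<close>: a point of \<open>K\<close> contributes
  \<open>exp \<nu> + exp (- \<nu>)\<close>, any other point contributes 2. The two signs of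
  \<open>\<nu>\<close> serve deviations in the two directions.\<close>

lemma sum_exp_discrepancy_le:
  fixes \<nu> \<mu> :: real
  assumes V: "finite V" and K: "K \<subseteq> V" and \<nu>: "0 \<le> \<mu>" "\<mu> \<le> 1" "\<nu> = \<mu> \<or> \<nu> = - \<mu>"
  shows "(\<Sum>U\<in>Pow V. exp (\<nu> * (2 * real (card (U \<inter> K)) - real (card K)))) \<le> 2 ^ card V * exp (real (card V) * \<mu>\<^sup>2)"
proof -
  define f where "f x = exp (\<nu> * of_bool (x \<in> K))" for x
  define g where "g x = exp (- \<nu> * of_bool (x \<in> K))" for x
  have "(\<Prod>x\<in>U. f x) * (\<Prod>x\<in>V - U. g x) = exp (\<nu> * (2 * real (card (U \<inter> K)) - real (card K)))" if U: "U \<in> Pow V" for U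
  proof -
    have fin: "finite U" "finite K"
      using U K V finite_subset by auto
    have "(\<Prod>x\<in>U. f x) = exp (\<nu> * real (card (U \<inter> K)))"
      unfolding f_def using fin by (simp add: exp_sum[symmetric] sum_distrib_left[symmetric] Int_def)
    moreover have "(\<Prod>x\<in>V - U. g x) = exp (- \<nu> * real (card ((V - U) \<inter> K)))"
      unfolding g_def using V by (subst exp_sum[symmetric]) (auto simp: sum_distrib_left[symmetric] sum_negf Int_def)
    moreover have "real (card ((V - U) \<inter> K)) = real (card K) - real (card (U \<inter> K))"
    proof -
      have "(V - U) \<inter> K = K - U \<inter> K"
        using K by auto
      then show ?thesis
        using fin by (simp add: card_Diff_subset card_mono of_nat_diff)
    qed
    ultimately show ?thesis
      by (simp add: exp_add[symmetric] algebra_simps)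
  qed
  then have "(\<Sum>U\<in>Pow V. exp (\<nu> * (2 * real (card (U \<inter> K)) - real (card K)))) = (\<Prod>x\<in>V. f x + g x)"
    using prod_add[OF V, of f g] by simp
  also have "\<dots> \<le> (\<Prod>x\<in>V. 2 * exp (\<mu>\<^sup>2))"
  proof (intro prod_mono conjI)
    fix x
    show "f x + g x \<le> 2 * exp (\<mu>\<^sup>2)"
      using exp_plus_exp_minus_le[OF \<nu>(1,2)] \<nu>(3) by (auto simp: f_def g_def add.commute)
    show "0 \<le> f x + g x"
      by (simp add: f_def g_def add_nonneg_nonneg)
  qed
  also have "\<dots> = 2 ^ card V * exp (real (card V) * \<mu>\<^sup>2)"
    by (simp add: power_mult_distrib exp_of_nat_mult)
  finally show ?thesis .
qed

text \<open>Chernoff and union bound in the form of an averaging argument: some \<open>U\<close> has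
  a potential \<open>\<Phi> U\<close> not above the bound for the mean. The number of sets enters
  only through its upper bound \<open>h\<close>.\<close>

lemma low_discrepancy_subset:
  fixes h :: real
  assumes V: "finite V" and \<K>: "finite \<K>" "\<And>K. K \<in> \<K> \<Longrightarrow> K \<subseteq> V" and h: "1 \<le> h" "real (card \<K>) \<le> h"
    and small: "ln (2 * h) \<le> real (card V)"
  shows "\<exists>U\<subseteq>V. \<forall>K\<in>\<K>. \<bar>2 * real (card (U \<inter> K)) - real (card K)\<bar> \<le> 2 * sqrt (real (card V) * ln (2 * h))"
proof -
  define n where "n = real (card V)"
  define l where "l = ln (2 * h)"
  have l: "0 < l"
    using h by (simp add: l_def)
  then have n: "0 < n" "l \<le> n"
    using small by (simp_all add: n_def l_def)
  \<comment> \<open>This value balances \<open>l / \<mu>\<close> against \<open>n * \<mu>\<close>.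
    The hypothesis \<open>small\<close> puts it into the range of the exponential estimate.\<close>
  define \<mu> where "\<mu> = sqrt (l / n)"
  have \<mu>: "0 < \<mu>" "\<mu> \<le> 1" "\<mu>\<^sup>2 = l / n"
    using l n by (simp_all add: \<mu>_def)
  define d where "d U K = 2 * real (card (U \<inter> K)) - real (card K)" for U K :: "'a set"
  define \<Phi> where "\<Phi> U = (\<Sum>K\<in>\<K>. exp (\<mu> * d U K) + exp (- \<mu> * d U K))" for U
  have "(\<Sum>U\<in>Pow V. \<Phi> U) = (\<Sum>K\<in>\<K>. (\<Sum>U\<in>Pow V. exp (\<mu> * d U K)) + (\<Sum>U\<in>Pow V. exp (- \<mu> * d U K)))"
    unfolding \<Phi>_def by (subst sum.swap) (simp add: sum.distrib)
  also have "\<dots> \<le> (\<Sum>K\<in>\<K>. 2 ^ card V * exp (n * \<mu>\<^sup>2) + 2 ^ card V * exp (n * \<mu>\<^sup>2))"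
    unfolding d_def n_def using \<mu> by (intro sum_mono add_mono sum_exp_discrepancy_le V \<K>(2)) auto
  also have "\<dots> = real (card \<K>) * (2 * 2 ^ card V * exp l)"
    using \<mu> n by simp
  also have "\<dots> \<le> h * (2 * 2 ^ card V * exp l)"
    using h by (intro mult_right_mono) auto
  also have "\<dots> = (\<Sum>U\<in>Pow V. 2 * h * exp l)"
    using V by (simp add: card_Pow)
  finally have "(\<Sum>U\<in>Pow V. \<Phi> U) \<le> (\<Sum>U\<in>Pow V. 2 * h * exp l)" .
  moreover have "(\<Sum>U\<in>Pow V. 2 * h * exp l) < (\<Sum>U\<in>Pow V. \<Phi> U)" if "\<forall>U\<in>Pow V. 2 * h * exp l < \<Phi> U"
    using V that by (intro sum_strict_mono) auto
  ultimately have "\<exists>U\<in>Pow V. \<Phi> U \<le> 2 * h * exp l"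
    by (meson not_le)
  then obtain U where U: "U \<subseteq> V" "\<Phi> U \<le> 2 * h * exp l"
    by auto
  have "\<bar>d U K\<bar> \<le> 2 * sqrt (n * l)" if K: "K \<in> \<K>" for K
  proof -
    have "exp (\<mu> * \<bar>d U K\<bar>) \<le> exp (\<mu> * d U K) + exp (- \<mu> * d U K)"
      by (auto simp: abs_if)
    also have "\<dots> \<le> \<Phi> U"
      unfolding \<Phi>_def using \<K>(1) K by (intro member_le_sum) (auto intro: add_nonneg_nonneg)
    also have "\<dots> \<le> 2 * h * exp l"
      by (rule U(2))
    \<comment> \<open>By the choice of \<open>l\<close> the union bound costs the same factor as the
      moment bound, which explains the 2 in the final estimate.\<close>
    also have "2 * h = exp l"
      using h by (simp add: l_def)
    also have "exp l * exp l = exp (2 * l)"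
      by (simp only: mult_2 exp_add)
    finally have "\<mu> * \<bar>d U K\<bar> \<le> 2 * l"
      by simp
    also have "l = \<mu> * sqrt (n * l)"
      using l n by (simp add: \<mu>_def real_sqrt_mult[symmetric])
    finally show ?thesis
      using \<mu> by simp
  qed
  then show ?thesis
    using U(1) by (intro exI[of _ U]) (simp add: d_def n_def l_def)
qed

section \<open>From low discrepancy at the finite stages to halving in the Loeb space\<close>

context ultra_powers
begin

lemma omega_le_sequentially: "\<omega> \<le> sequentially"
proof (rule filter_leI)
  fix P
  assume "eventually P sequentially"
  then obtain n where "\<And>i. n \<le> i \<Longrightarrow> P i"
    by (auto simp: eventually_sequentially)
  then show "eventually P \<omega>"
    using eventually_ge[of n] by (rule_tac eventually_mono)
qed

lemma tendsto_const_over_card: "((\<lambda>i. c / real (card (X i))) \<longlongrightarrow> 0) \<omega>"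
proof -
  have "filterlim (\<lambda>i. real (card (X i))) at_top sequentially"
    by (rule filterlim_at_top_mono[OF filterlim_real_sequentially]) (simp add: card_X_ge)
  then have "((\<lambda>i. c / real (card (X i))) \<longlongrightarrow> 0) sequentially"
    by (intro tendsto_divide_0[OF tendsto_const] filterlim_at_top_imp_at_infinity)
  then show ?thesis
    using omega_le_sequentially by (rule tendsto_mono[rotated])
qed

text \<open>\<open>U\<close> is chosen before \<open>H\<close>: at stage \<open>i\<close> a single
  \<open>U i\<close> has small discrepancy against all cylinders of that stage, hence against every
  internal sequence of cylinders.\<close>

lemma halving_internal:
  assumes r: "1 \<le> r" and \<S>: "finite \<S>" "\<And>s. s \<in> \<S> \<Longrightarrow> internal {1..r} (S s)"
  shows "\<exists>U. internal {1..r} U \<and> (\<forall>s\<in>\<S>. \<forall>H. (\<forall>B\<in>facets {1..r}. internal B (H B)) \<longrightarrow>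
      um {1..r} (\<lambda>i. (S s i \<inter> U i) \<inter> (\<Inter>B\<in>facets {1..r}. ipre {1..r} B (\<lambda>j. j) (H B) i))
      = 1 / 2 * um {1..r} (\<lambda>i. S s i \<inter> (\<Inter>B\<in>facets {1..r}. ipre {1..r} B (\<lambda>j. j) (H B) i)))"
proof -
  define A where "A = {1..r}"
  have fA: "finite A" and cA: "card A = r"
    by (simp_all add: A_def)
  define N where "N i = card (X i)" for i
  have fB: "finite B" if "B \<in> facets A" for B
    using facets_subset[OF that] fA finite_subset by blast
  \<comment> \<open>All choices of one factor per facet at stage \<open>i\<close>; the power over a
    facet has \<open>N i ^ (r - 1)\<close> points, which bounds the exponent in the count.\<close>
  define \<H> where "\<H> i = (\<Pi>\<^sub>E B\<in>facets A. Pow (fpower X B i))" for i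
  define cyl where "cyl i s H = S s i \<inter> (\<Inter>B\<in>facets A. {v \<in> fpower X A i. (\<lambda>j\<in>B. v j) \<in> H B})" for i s H
  define \<K> where "\<K> i = case_prod (cyl i) ` (\<S> \<times> \<H> i)" for i
  \<comment> \<open>The summand 1 keeps \<open>h\<close> at least 1 when \<open>\<S>\<close> is
    empty.\<close>
  define h where "h i = real (card \<S> + 1) * 2 ^ (card (facets A) * N i ^ (r - 1))" for i
  have fin\<H>: "finite (\<H> i)" for i
    unfolding \<H>_def using fB by (intro finite_PiE facets_finite[OF fA]) (simp add: finite_fpower)
  have card\<H>: "card (\<H> i) = 2 ^ (card (facets A) * N i ^ (r - 1))" for i
  proof -
    have "card (\<H> i) = (\<Prod>B\<in>facets A. 2 ^ (N i ^ (r - 1)))"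
      unfolding \<H>_def card_PiE[OF facets_finite[OF fA]]
      using fB by (intro prod.cong refl) (simp add: card_Pow finite_fpower card_fpower N_def facets_def cA)
    then show ?thesis
      by (simp add: power_mult[symmetric] mult.commute)
  qed
  have card\<K>: "real (card (\<K> i)) \<le> h i" for i
  proof -
    have "card (\<K> i) \<le> card \<S> * 2 ^ (card (facets A) * N i ^ (r - 1))"
      unfolding \<K>_def using card_image_le[of "\<S> \<times> \<H> i" "case_prod (cyl i)"] \<S>(1) fin\<H>
      by (simp add: card_cartesian_product card\<H>)
    also have "\<dots> \<le> (card \<S> + 1) * 2 ^ (card (facets A) * N i ^ (r - 1))"
      by simp
    finally have "real (card (\<K> i)) \<le> real ((card \<S> + 1) * 2 ^ (card (facets A) * N i ^ (r - 1)))"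
      by (rule of_nat_mono)
    then show ?thesis
      by (simp add: h_def)
  qed
  have h1: "1 \<le> h i" for i
    unfolding h_def by (rule mult_ge1_I) auto
  \<comment> \<open>Dividing the discrepancy \<open>2 * sqrt (n * ln (2 * h i))\<close> by the
    number \<open>n\<close> of points gives \<open>2 * sqrt (q i)\<close>.\<close>
  define q where "q i = ln (2 * h i) / real (card (fpower X A i))" for i
  define c where "c = ln (2 * real (card \<S> + 1)) + real (card (facets A)) * ln 2"
  have c0: "0 \<le> ln (2 * real (card \<S> + 1))"
    by simp
  have q_le: "0 \<le> q i \<and> q i \<le> c / real (N i)" if "1 \<le> i" for i
  proof -
    have N: "1 \<le> N i"
      using card_X_ge[of i] that by (simp add: N_def)
    have "ln (2 * h i) = ln (2 * real (card \<S> + 1)) + real (card (facets A) * N i ^ (r - 1)) * ln 2"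
      unfolding h_def mult.assoc[symmetric] by (subst ln_mult) (auto simp: ln_realpow)
    also have "\<dots> \<le> ln (2 * real (card \<S> + 1)) * real (N i ^ (r - 1)) + real (card (facets A) * N i ^ (r - 1)) * ln 2"
    proof -
      have "1 \<le> real (N i ^ (r - 1))"
        using N by (simp add: one_le_power)
      then show ?thesis
        using mult_left_mono[OF _ c0, of 1] by simp
    qed
    also have "\<dots> = c * real (N i ^ (r - 1))"
      by (simp add: c_def algebra_simps)
    finally have "ln (2 * h i) \<le> c * real (N i ^ (r - 1))" .
    moreover have "card (fpower X A i) = N i * N i ^ (r - 1)"
      using r by (simp add: card_fpower[OF fA] cA N_def power_eq_if)
    ultimately have "q i \<le> c * real (N i ^ (r - 1)) / (real (N i) * real (N i ^ (r - 1)))"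
      unfolding q_def by (simp only: of_nat_mult) (rule divide_right_mono, simp_all)
    also have "\<dots> = c / real (N i)"
      using N by simp
    finally show ?thesis
      using h1[of i] by (simp add: q_def)
  qed
  have q0: "(q \<longlongrightarrow> 0) \<omega>"
  proof (rule tendsto_sandwich[OF _ _ tendsto_const tendsto_const_over_card])
    show "eventually (\<lambda>i. 0 \<le> q i) \<omega>" "eventually (\<lambda>i. q i \<le> c / real (card (X i))) \<omega>"
      using eventually_ge[of 1] by (eventually_elim, use q_le in \<open>simp add: N_def\<close>)+
  qed
  define P where "P i U \<longleftrightarrow> U \<subseteq> fpower X A i \<and> (\<forall>K\<in>\<K> i. \<bar>2 * real (card (U \<inter> K)) - real (card K)\<bar>
      \<le> 2 * sqrt (real (card (fpower X A i)) * ln (2 * h i)))" for i U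
  have exU: "eventually (\<lambda>i. \<exists>U. P i U) \<omega>"
  proof -
    have "eventually (\<lambda>i. q i < 1) \<omega>"
      using order_tendstoD(2)[OF q0, of 1] by simp
    then show ?thesis
      using eventually_ge[of 1]
    proof eventually_elim
      case (elim i)
      have n: "0 < card (fpower X A i)"
        using finite_fpower[OF fA, of i] fpower_nonempty[of i A] elim(2) by (simp add: card_gt_0_iff)
      have "K \<subseteq> fpower X A i" if K: "K \<in> \<K> i" for K
      proof -
        obtain s H where "s \<in> \<S>" "K = cyl i s H"
          using K by (auto simp: \<K>_def)
        then show ?thesis
          using internalD[OF \<S>(2), of s i] by (auto simp: cyl_def A_def)
      qed
      moreover have "finite (\<K> i)"
        unfolding \<K>_def using \<S>(1) fin\<H> by auto
      moreover have "ln (2 * h i) \<le> real (card (fpower X A i))"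
        using elim(1) n by (simp add: q_def divide_less_eq)
      ultimately show ?case
        unfolding P_def using low_discrepancy_subset[OF finite_fpower[OF fA] _ _ h1 card\<K>] by simp
    qed
  qed
  \<comment> \<open>The default is the empty set, so that \<open>U\<close> is internal at every
    stage; by \<open>exU\<close> the default is confined to a set of stages outside of the
    ultrafilter.\<close>
  define U where "U i = (if \<exists>U. P i U then SOME U. P i U else {})" for i
  have PU: "P i (U i)" if "\<exists>U. P i U" for i
    using someI_ex[OF that] that by (simp add: U_def)
  have U: "internal A U"
  proof (rule internalI)
    show "U i \<subseteq> fpower X A i" for i
    proof (cases "\<exists>U. P i U")
      case True
      then show ?thesis
        using PU[OF True] by (simp add: P_def)
    qed (simp add: U_def)
  qed
  have "um A (\<lambda>i. (S s i \<inter> U i) \<inter> (\<Inter>B\<in>facets A. ipre A B (\<lambda>j. j) (H B) i))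
      = 1 / 2 * um A (\<lambda>i. S s i \<inter> (\<Inter>B\<in>facets A. ipre A B (\<lambda>j. j) (H B) i))"
    if s: "s \<in> \<S>" and H: "\<And>B. B \<in> facets A \<Longrightarrow> internal B (H B)" for s H
  proof -
    let ?C = "\<lambda>i. S s i \<inter> (\<Inter>B\<in>facets A. ipre A B (\<lambda>j. j) (H B) i)"
    let ?CU = "\<lambda>i. (S s i \<inter> U i) \<inter> (\<Inter>B\<in>facets A. ipre A B (\<lambda>j. j) (H B) i)"
    have int: "internal A ?C" "internal A ?CU"
      using \<S>(2)[OF s] by (simp_all add: A_def internal_Int)
    have Ck: "?C i \<in> \<K> i" for i
    proof -
      have "(\<lambda>B\<in>facets A. H B i) \<in> \<H> i"
        unfolding \<H>_def using internalD[OF H] by auto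
      moreover have "?C i = cyl i s (\<lambda>B\<in>facets A. H B i)"
        unfolding cyl_def ipre_def by simp
      ultimately show ?thesis
        unfolding \<K>_def using s by (metis (no_types, lifting) SigmaI case_prod_conv image_eqI)
    qed
    have dev: "eventually (\<lambda>i. norm (2 * frac A ?CU i - frac A ?C i) \<le> 2 * sqrt (q i)) \<omega>"
      using exU eventually_ge[of 1]
    proof eventually_elim
      case (elim i)
      define n where "n = real (card (fpower X A i))"
      have n: "0 < n"
        unfolding n_def using finite_fpower[OF fA, of i] fpower_nonempty[of i A] elim(2) by (simp add: card_gt_0_iff)
      have "?CU i = U i \<inter> ?C i"
        by auto
      then have "\<bar>2 * real (card (?CU i)) - real (card (?C i))\<bar> \<le> 2 * sqrt (n * ln (2 * h i))"
        using PU[OF elim(1)] Ck[of i] unfolding P_def n_def by auto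
      then have "\<bar>2 * real (card (?CU i)) - real (card (?C i))\<bar> / n \<le> 2 * sqrt (n * ln (2 * h i)) / n"
        using n by (intro divide_right_mono) auto
      moreover have "\<bar>2 * real (card (?CU i)) - real (card (?C i))\<bar> / n = \<bar>2 * frac A ?CU i - frac A ?C i\<bar>"
        using n by (simp add: frac_def n_def[symmetric] diff_divide_distrib[symmetric])
      moreover have "sqrt (n * ln (2 * h i)) / n = sqrt (q i)"
      proof -
        have "sqrt (n * ln (2 * h i)) / n = sqrt (n * ln (2 * h i)) / sqrt (n * n)"
          using n by simp
        also have "\<dots> = sqrt (n * ln (2 * h i) / (n * n))"
          by (simp only: real_sqrt_divide)
        also have "n * ln (2 * h i) / (n * n) = q i"
          using n by (simp add: q_def n_def[symmetric])
        finally show ?thesis .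
      qed
      ultimately show ?case
        by simp
    qed
    have "((\<lambda>i. 2 * sqrt (q i)) \<longlongrightarrow> 2 * sqrt 0) \<omega>"
      by (intro tendsto_intros q0)
    then have "((\<lambda>i. 2 * frac A ?CU i - frac A ?C i) \<longlongrightarrow> 0) \<omega>"
      unfolding real_sqrt_zero mult_zero_right by (rule Lim_null_comparison[OF dev])
    moreover have "((\<lambda>i. 2 * frac A ?CU i - frac A ?C i) \<longlongrightarrow> 2 * um A ?CU - um A ?C) \<omega>"
      by (intro tendsto_intros frac_tendsto fA int)
    ultimately have "2 * um A ?CU - um A ?C = 0"
      using tendsto_unique[OF omega_not_bot] by blast
    then show ?thesis
      by simp
  qed
  then show ?thesis
    using U unfolding A_def by blast
qed

lemma halving_over_star:
  assumes r: "1 \<le> r"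
  shows "halving_over (loeb \<omega> X {1..r}) (sigma_coord_star \<omega> X r {1..r})"
  unfolding halving_over_def
proof (intro allI impI)
  fix \<S>
  assume \<S>: "finite \<S> \<and> \<S> \<subseteq> sets (loeb \<omega> X {1..r})"
  interpret prob_space "loeb \<omega> X {1..r}"
    by (rule prob_space_loeb) simp
  have "\<exists>S. \<forall>s\<in>\<S>. internal {1..r} (S s) \<and> (AE x in loeb \<omega> X {1..r}. x \<in> s \<longleftrightarrow> x \<in> ultraproduct \<omega> (S s))"
    using \<S> ae_internal[of "{1..r}"] by (intro bchoice) blast
  then obtain S where S: "\<And>s. s \<in> \<S> \<Longrightarrow> internal {1..r} (S s)"
    "\<And>s. s \<in> \<S> \<Longrightarrow> AE x in loeb \<omega> X {1..r}. x \<in> s \<longleftrightarrow> x \<in> ultraproduct \<omega> (S s)"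
    by blast
  obtain U where U: "internal {1..r} U"
    "\<And>s H. s \<in> \<S> \<Longrightarrow> (\<And>B. B \<in> facets {1..r} \<Longrightarrow> internal B (H B)) \<Longrightarrow>
      um {1..r} (\<lambda>i. (S s i \<inter> U i) \<inter> (\<Inter>B\<in>facets {1..r}. ipre {1..r} B (\<lambda>j. j) (H B) i))
      = 1 / 2 * um {1..r} (\<lambda>i. S s i \<inter> (\<Inter>B\<in>facets {1..r}. ipre {1..r} B (\<lambda>j. j) (H B) i))"
    using halving_internal[of r \<S> S, OF r conjunct1[OF \<S>]] S(1) by blast
  have Uev: "ultraproduct \<omega> U \<in> events"
    using U(1) by (simp add: ultraproduct_in_sets)
  show "\<exists>V\<in>events. \<forall>s\<in>\<S>. \<forall>G\<in>sets (sigma_coord_star \<omega> X r {1..r}). prob (s \<inter> V \<inter> G) = 1 / 2 * prob (s \<inter> G)"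
  proof (intro bexI[OF _ Uev] ballI)
    fix s G
    assume s: "s \<in> \<S>" and G: "G \<in> sets (sigma_coord_star \<omega> X r {1..r})"
    have ev: "s \<in> events" "ultraproduct \<omega> (S s) \<in> events" "G \<in> events"
      using \<S> s S(1) G subalgebra_star[of "{1..r}" r] by (auto simp: ultraproduct_in_sets subalgebra_def)
    have "prob (ultraproduct \<omega> (\<lambda>i. S s i \<inter> U i) \<inter> G) = 1 / 2 * prob (ultraproduct \<omega> (S s) \<inter> G)"
    proof (rule star_proportional_internal[OF order_refl internal_Int[OF S(1)[OF s]] S(1)[OF s] _ G])
      fix H :: "nat set \<Rightarrow> nat \<Rightarrow> (nat \<Rightarrow> 'a) set"
      assume "\<And>B. B \<in> facets {1..r} \<Longrightarrow> internal B (H B)"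
      then show "um {1..r} (\<lambda>i. (S s i \<inter> U i) \<inter> (\<Inter>B\<in>facets {1..r}. ipre {1..r} B (\<lambda>j. j) (H B) i))
          = 1 / 2 * um {1..r} (\<lambda>i. S s i \<inter> (\<Inter>B\<in>facets {1..r}. ipre {1..r} B (\<lambda>j. j) (H B) i))"
        by (rule U(2)[OF s])
    qed
    moreover have "prob (s \<inter> ultraproduct \<omega> U \<inter> G) = prob (ultraproduct \<omega> (\<lambda>i. S s i \<inter> U i) \<inter> G)"
      using ev Uev S(2)[OF s] by (intro finite_measure_eq_AE) (auto simp: ultraproduct_Int elim: eventually_mono)
    moreover have "prob (s \<inter> G) = prob (ultraproduct \<omega> (S s) \<inter> G)"
      using ev S(2)[OF s] by (intro finite_measure_eq_AE) (auto elim: eventually_mono)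
    ultimately show "prob (s \<inter> ultraproduct \<omega> U \<inter> G) = 1 / 2 * prob (s \<inter> G)"
      by simp
  qed
qed

end

section \<open>Independence of functions of different coordinates\<close>

context ultra_powers
begin

text \<open>Counting by fibres over the coordinates outside of the image of \<open>e\<close>: the
  finite Fubini theorem behind the freezing argument.\<close>

lemma card_merge:
  assumes e: "coord_inj A K e" and T: "T \<subseteq> fpower X A i" and Q: "Q \<subseteq> fpower X K i"
  shows "card {v \<in> Q. (\<lambda>j\<in>A. v (e j)) \<in> T}
    = (\<Sum>y\<in>fpower X (K - e ` A) i. card (T \<inter> {z \<in> fpower X A i. merge_points K A e z y \<in> Q}))"
proof -
  let ?m = "\<lambda>(z, y). merge_points K A e z y"
  define L where "L y = T \<inter> {z \<in> fpower X A i. merge_points K A e z y \<in> Q}" for y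
  have inj: "inj_on e A" "e ` A \<subseteq> K" and fin: "finite A" "finite K"
    using e coord_inj_finite by (auto simp: coord_inj_def)
  have bij: "bij_betw ?m (fpower X A i \<times> fpower X (K - e ` A) i) (fpower X K i)"
    unfolding fpower_def by (rule bij_betw_merge_points[OF inj])
  have "{v \<in> Q. (\<lambda>j\<in>A. v (e j)) \<in> T} = (\<lambda>(y, z). merge_points K A e z y) ` (SIGMA y:fpower X (K - e ` A) i. L y)"
  proof (intro set_eqI iffI)
    fix v
    assume v: "v \<in> {v \<in> Q. (\<lambda>j\<in>A. v (e j)) \<in> T}"
    then obtain z y where zy: "z \<in> fpower X A i" "y \<in> fpower X (K - e ` A) i" "v = merge_points K A e z y"
      using bij_betw_imp_surj_on[OF bij] Q by force
    moreover have "(\<lambda>j\<in>A. v (e j)) = z"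
      using restrict_merge_points[OF inj, of z "X i" y] zy by (simp add: fpower_def)
    ultimately show "v \<in> (\<lambda>(y, z). merge_points K A e z y) ` (SIGMA y:fpower X (K - e ` A) i. L y)"
      using v by (force simp: L_def)
  next
    fix v
    assume "v \<in> (\<lambda>(y, z). merge_points K A e z y) ` (SIGMA y:fpower X (K - e ` A) i. L y)"
    then obtain z y where zy: "y \<in> fpower X (K - e ` A) i" "z \<in> L y" "v = merge_points K A e z y"
      by auto
    moreover have "(\<lambda>j\<in>A. v (e j)) = z"
      using restrict_merge_points[OF inj, of z "X i" y] zy by (simp add: fpower_def L_def)
    ultimately show "v \<in> {v \<in> Q. (\<lambda>j\<in>A. v (e j)) \<in> T}"
      by (simp add: L_def)
  qed
  moreover have "inj_on (\<lambda>(y, z). merge_points K A e z y) (SIGMA y:fpower X (K - e ` A) i. L y)"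
    using bij_betw_imp_inj_on[OF bij] by (auto simp: inj_on_def L_def)
  ultimately have "card {v \<in> Q. (\<lambda>j\<in>A. v (e j)) \<in> T} = card (SIGMA y:fpower X (K - e ` A) i. L y)"
    by (simp add: card_image)
  also have "\<dots> = (\<Sum>y\<in>fpower X (K - e ` A) i. card (L y))"
    using finite_fpower[OF fin(1), of i] fin by (intro card_SigmaI ballI finite_fpower) (auto simp: L_def)
  finally show ?thesis
    by (simp add: L_def)
qed

text \<open>For each \<open>i\<close> the remaining coordinates are frozen at the worst possible value. The resulting
  sections are internal sets in the star sigma-algebra, so the worst deviation tends to \<open>0\<close>.\<close>

lemma independent_sections:
  fixes H :: "'j \<Rightarrow> nat \<Rightarrow> (nat \<Rightarrow> 'a) set"
  assumes e: "coord_inj {1..r} K e" and S: "internal {1..r} S"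
    and ind: "\<And>G. G \<in> sets (sigma_coord_star \<omega> X r {1..r}) \<Longrightarrow>
      measure (loeb \<omega> X {1..r}) (ultraproduct \<omega> S \<inter> G) = c * measure (loeb \<omega> X {1..r}) G"
    and J: "finite J" "\<And>j. j \<in> J \<Longrightarrow> E j \<subseteq> K" "\<And>j. j \<in> J \<Longrightarrow> \<not> e ` {1..r} \<subseteq> E j"
  defines "Q \<equiv> \<lambda>i. {v \<in> fpower X K i. \<forall>j\<in>J. restrict v (E j) \<in> H j i}"
  shows "um K (\<lambda>i. ipre K {1..r} e S i \<inter> Q i) = c * um K Q"
proof -
  define A where "A = {1..r}"
  note e = e[folded A_def] and S = S[folded A_def] and ind = ind[folded A_def] and J = J[folded A_def]
  have inj: "inj_on e A" "e ` A \<subseteq> K" and fin: "finite A" "finite K"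
    using e coord_inj_finite by (auto simp: coord_inj_def)
  define L where "L i y = {z \<in> fpower X A i. merge_points K A e z y \<in> Q i}" for i y
  define d where "d i y = \<bar>real (card (S i \<inter> L i y)) - c * real (card (L i y))\<bar>" for i y
  let ?R = "\<lambda>i. fpower X (K - e ` A) i"
  have "\<exists>y. ?R i \<noteq> {} \<longrightarrow> y \<in> ?R i \<and> (\<forall>y'\<in>?R i. d i y' \<le> d i y)" for i
  proof (cases "?R i = {}")
    case False
    have finR: "finite (d i ` ?R i)"
      using fin by (intro finite_imageI finite_fpower) auto
    have "Max (d i ` ?R i) \<in> d i ` ?R i"
      using False by (intro Max_in finR) auto
    then obtain y where "y \<in> ?R i" "d i y = Max (d i ` ?R i)"
      by auto
    then show ?thesis
      using finR by (intro exI[of _ y]) simp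
  qed simp
  then obtain y where y: "\<And>i. ?R i \<noteq> {} \<Longrightarrow> y i \<in> ?R i" "\<And>i y'. ?R i \<noteq> {} \<Longrightarrow> y' \<in> ?R i \<Longrightarrow> d i y' \<le> d i (y i)"
    by metis
  define LY where "LY i = L i (y i)" for i
  have LY: "internal A LY"
    by (rule internalI) (auto simp: LY_def L_def)
  have Q: "internal K Q"
    by (rule internalI) (auto simp: Q_def)
  have star: "ultraproduct \<omega> LY \<in> sets (sigma_coord_star \<omega> X r A)"
  proof (cases "eventually (\<lambda>i. ?R i \<noteq> {} \<and> y i \<in> ?R i) \<omega>")
    case True
    have "\<exists>B. \<forall>j\<in>J. B j \<in> facets A \<and> {a \<in> A. e a \<in> E j} \<subseteq> B j"
    proof (rule bchoice, rule ballI)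
      fix j
      assume "j \<in> J"
      then have "{a \<in> A. e a \<in> E j} \<subset> A"
        using J(3) by blast
      then show "\<exists>B. B \<in> facets A \<and> {a \<in> A. e a \<in> E j} \<subseteq> B"
        using facet_superset[OF fin(1)] by metis
    qed
    then obtain B where B: "\<And>j. j \<in> J \<Longrightarrow> B j \<in> facets A" "\<And>j. j \<in> J \<Longrightarrow> {a \<in> A. e a \<in> E j} \<subseteq> B j"
      by blast
    \<comment> \<open>Once \<open>y i\<close> is frozen, the \<open>j\<close>-th constraint involves
      only the coordinates \<open>a\<close> with \<open>e a \<in> E j\<close>. As the image of
      \<open>e\<close> is not contained in \<open>E j\<close>, they lie in a facet
      \<open>B j\<close>, and \<open>H' j\<close> is the constraint read as a set in the power over
      that facet.\<close>
    define H' where "H' j i = {w \<in> fpower X (B j) i. \<exists>z\<in>fpower X A i. restrict z (B j) = w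
        \<and> restrict (merge_points K A e z (y i)) (E j) \<in> H j i}" for j i
    have H': "internal (B j) (H' j)" for j
      by (rule internalI) (auto simp: H'_def)
    define LJ where "LJ i = {z \<in> fpower X A i. \<forall>j\<in>J. z \<in> ipre A (B j) (\<lambda>j. j) (H' j) i}" for i
    have "eventually (\<lambda>i. LY i = LJ i) \<omega>"
      using True
    proof eventually_elim
      case (elim i)
      have merge: "merge_points K A e z (y i) \<in> fpower X K i" if "z \<in> fpower X A i" for z
        using bij_betwE[OF bij_betw_merge_points[OF inj, of "X i"]] that elim by (auto simp: fpower_def)
      have "restrict (merge_points K A e z (y i)) (E j) \<in> H j i \<longleftrightarrow> z \<in> ipre A (B j) (\<lambda>j. j) (H' j) i"
        if z: "z \<in> fpower X A i" and j: "j \<in> J" for z j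
      proof -
        have rest: "restrict z (B j) \<in> fpower X (B j) i"
          using restrict_fpower[of "\<lambda>j. j" "B j" A z i] z facets_subset[OF B(1)[OF j]] by simp
        have eq: "restrict (merge_points K A e z (y i)) (E j) = restrict (merge_points K A e z' (y i)) (E j)"
          if z': "restrict z' (B j) = restrict z (B j)" for z'
        proof (rule restrict_ext)
          fix m
          assume m: "m \<in> E j"
          show "merge_points K A e z (y i) m = merge_points K A e z' (y i) m"
          proof (cases "m \<in> e ` A")
            case True
            then obtain a where a: "a \<in> A" "m = e a"
              by auto
            then have "a \<in> B j"
              using B(2)[OF j] m by auto
            then have "z' a = z a"
              using z' by (metis restrict_apply')
            then show ?thesis
              using merge_points_on_range[OF inj a(1), of z] merge_points_on_range[OF inj a(1), of z'] a(2) by simp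
          qed (simp add: merge_points_def)
        qed
        show ?thesis
        proof
          assume "restrict (merge_points K A e z (y i)) (E j) \<in> H j i"
          then have "restrict z (B j) \<in> H' j i"
            unfolding H'_def using z rest by blast
          then show "z \<in> ipre A (B j) (\<lambda>j. j) (H' j) i"
            using z by (simp add: ipre_def)
        next
          assume "z \<in> ipre A (B j) (\<lambda>j. j) (H' j) i"
          then obtain z' where z': "restrict z' (B j) = restrict z (B j)"
            "restrict (merge_points K A e z' (y i)) (E j) \<in> H j i"
            by (auto simp: ipre_def H'_def)
          show "restrict (merge_points K A e z (y i)) (E j) \<in> H j i"
            unfolding eq[OF z'(1)] by (rule z'(2))
        qed
      qed
      then show ?case
        using merge unfolding LY_def L_def LJ_def Q_def by auto
    qed
    then have eq: "ultraproduct \<omega> LY = ultraproduct \<omega> LJ"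
      by (intro equalityI) (simp_all add: ultraproduct_subset_iff eventually_mono)
    show ?thesis
    proof (cases "J = {}")
      case True
      then have "ultraproduct \<omega> LJ = upower \<omega> X A"
        by (simp add: LJ_def[abs_def] upower_def)
      then show ?thesis
        using eq sets.top[of "sigma_coord_star \<omega> X r A"] sets_sigma_coord_star(4)[of "{1..r}" r] by (simp add: A_def)
    next
      case False
      have "LJ i = (\<Inter>j\<in>J. ipre A (B j) (\<lambda>j. j) (H' j) i)" for i
        using False by (auto simp: LJ_def ipre_def)
      then have "LJ = (\<lambda>i. \<Inter>j\<in>J. ipre A (B j) (\<lambda>j. j) (H' j) i)"
        by auto
      then have "ultraproduct \<omega> LJ = (\<Inter>j\<in>J. pre A (B j) (\<lambda>j. j) (ultraproduct \<omega> (H' j)))"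
        using ultraproduct_INT[OF J(1) False, of "\<lambda>j. ipre A (B j) (\<lambda>j. j) (H' j)"] by (simp add: pre_ultraproduct)
      moreover have "pre A (B j) (\<lambda>j. j) (ultraproduct \<omega> (H' j)) \<in> sets (sigma_coord_star \<omega> X r A)" if "j \<in> J" for j
      proof -
        have "finite (B j)"
          using facets_subset[OF B(1)[OF that]] fin finite_subset by blast
        then show ?thesis
          using B(1)[OF that] H' ultraproduct_in_sets unfolding A_def by (intro pre_in_star) auto
      qed
      ultimately show ?thesis
        using eq J(1) False by (auto intro!: sets.finite_INT)
    qed
  next
    case False
    have "eventually (\<lambda>i. ?R i \<noteq> {} \<and> y i \<in> ?R i) \<omega>"
      using eventually_ge[of 1] by eventually_elim (use fpower_nonempty y(1) in auto)
    then show ?thesis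
      using False by blast
  qed
  have lim0: "((\<lambda>i. frac A (\<lambda>i. S i \<inter> LY i) i - c * frac A LY i) \<longlongrightarrow> 0) \<omega>"
  proof -
    \<comment> \<open>The independence of \<open>S\<close> is used for just one set, the
      ultraproduct of the worst sections.\<close>
    have "um A (\<lambda>i. S i \<inter> LY i) = c * um A LY"
      using ind[OF star] measure_ultraproduct[OF fin(1) LY] measure_ultraproduct[OF fin(1) internal_Int[OF S, of LY]]
      by (simp add: ultraproduct_Int)
    moreover have "((\<lambda>i. frac A (\<lambda>i. S i \<inter> LY i) i - c * frac A LY i) \<longlongrightarrow> um A (\<lambda>i. S i \<inter> LY i) - c * um A LY) \<omega>"
      by (intro tendsto_intros frac_tendsto fin LY internal_Int S)
    ultimately show ?thesis
      by simp
  qed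
  let ?SQ = "\<lambda>i. ipre K A e S i \<inter> Q i"
  have "eventually (\<lambda>i. \<bar>frac K ?SQ i - c * frac K Q i\<bar> \<le> \<bar>frac A (\<lambda>i. S i \<inter> LY i) i - c * frac A LY i\<bar>) \<omega>"
    using eventually_ge[of 1]
  proof eventually_elim
    case (elim i)
    have R: "?R i \<noteq> {}"
      using elim fpower_nonempty by simp
    have cardR: "0 < card (?R i)" "0 < card (fpower X A i)"
      using R fpower_nonempty[of i A] elim fin by (simp_all add: card_gt_0_iff finite_fpower)
    have eqS: "?SQ i = {v \<in> Q i. (\<lambda>j\<in>A. v (e j)) \<in> S i}"
      using internalD[OF Q] by (auto simp: ipre_def)
    have eqQ: "Q i = {v \<in> Q i. (\<lambda>j\<in>A. v (e j)) \<in> fpower X A i}"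
      using internalD[OF Q, of i] restrict_fpower[OF inj(2)] by blast
    have card1: "card (?SQ i) = (\<Sum>y\<in>?R i. card (S i \<inter> L i y))"
      unfolding eqS L_def by (rule card_merge[OF e internalD[OF S] internalD[OF Q]])
    have "card {v \<in> Q i. (\<lambda>j\<in>A. v (e j)) \<in> fpower X A i} = (\<Sum>y\<in>?R i. card (fpower X A i \<inter> L i y))"
      unfolding L_def by (rule card_merge[OF e order_refl internalD[OF Q]])
    moreover have "fpower X A i \<inter> L i y = L i y" for y
      by (auto simp: L_def)
    ultimately have card2: "card (Q i) = (\<Sum>y\<in>?R i. card (L i y))"
      using eqQ by simp
    have "real (card (?SQ i)) - c * real (card (Q i)) = (\<Sum>y\<in>?R i. real (card (S i \<inter> L i y)) - c * real (card (L i y)))"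
      unfolding card1 card2 by (simp add: sum_subtractf sum_distrib_left)
    then have "\<bar>real (card (?SQ i)) - c * real (card (Q i))\<bar> \<le> (\<Sum>y\<in>?R i. d i y)"
      unfolding d_def by simp
    also have "\<dots> \<le> (\<Sum>y'\<in>?R i. d i (y i))"
      using y(2)[OF R] by (intro sum_mono)
    finally have le: "\<bar>real (card (?SQ i)) - c * real (card (Q i))\<bar> \<le> real (card (?R i)) * d i (y i)"
      by simp
    have "\<bar>frac K ?SQ i - c * frac K Q i\<bar> = \<bar>real (card (?SQ i)) - c * real (card (Q i))\<bar> / real (card (fpower X K i))"
      by (simp add: frac_def diff_divide_distrib[symmetric])
    also have "\<dots> \<le> real (card (?R i)) * d i (y i) / real (card (fpower X K i))"
      using le by (rule divide_right_mono) simp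
    also have "\<dots> = d i (y i) / real (card (fpower X A i))"
      using card_fpower_split[OF e, of i] cardR by simp
    also have "\<dots> = \<bar>frac A (\<lambda>i. S i \<inter> LY i) i - c * frac A LY i\<bar>"
      by (simp add: frac_def d_def LY_def diff_divide_distrib[symmetric])
    finally show ?case .
  qed
  then have "((\<lambda>i. frac K ?SQ i - c * frac K Q i) \<longlongrightarrow> 0) \<omega>"
    by (intro Lim_null_comparison[OF _ tendsto_rabs_zero[OF lim0]]) simp
  moreover have "((\<lambda>i. frac K ?SQ i - c * frac K Q i) \<longlongrightarrow> um K ?SQ - c * um K Q) \<omega>"
    by (intro tendsto_intros frac_tendsto fin Q internal_Int internal_ipre)
  ultimately have "um K ?SQ - c * um K Q = 0"
    using tendsto_unique[OF omega_not_bot] by blast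
  then show ?thesis
    by (simp add: A_def)
qed

text \<open>Passage from internal to measurable sets. The constraints are arbitrary as long as none
  of them sees the whole image of \<open>e\<close>. This covers facets (independence from the star
  sigma-algebra), single coordinates (absence of ties) and the remaining coordinates of a
  realization (joint law).\<close>

lemma independent_of_other_coordinates:
  assumes e: "coord_inj {1..r} K e" and S: "S \<in> sets (loeb \<omega> X {1..r})"
    and ind: "\<And>G. G \<in> sets (sigma_coord_star \<omega> X r {1..r}) \<Longrightarrow>
      measure (loeb \<omega> X {1..r}) (S \<inter> G) = c * measure (loeb \<omega> X {1..r}) G"
    and J: "finite J" "\<And>j. j \<in> J \<Longrightarrow> E j \<subseteq> K" "\<And>j. j \<in> J \<Longrightarrow> \<not> e ` {1..r} \<subseteq> E j"
    and G: "\<And>j. j \<in> J \<Longrightarrow> G j \<in> sets (loeb \<omega> X (E j))"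
  defines "Q \<equiv> {x \<in> upower \<omega> X K. \<forall>j\<in>J. x \<in> pre K (E j) (\<lambda>j. j) (G j)}"
  shows "measure (loeb \<omega> X K) (pre K {1..r} e S \<inter> Q) = c * measure (loeb \<omega> X K) Q"
proof -
  have fK: "finite K"
    using e by (simp add: coord_inj_def)
  have fE: "finite (E j)" if "j \<in> J" for j
    using J(2)[OF that] fK by (rule finite_subset)
  interpret K: prob_space "loeb \<omega> X K"
    by (rule prob_space_loeb[OF fK])
  interpret A: prob_space "loeb \<omega> X {1..r}"
    by (rule prob_space_loeb) simp
  obtain S' where S': "internal {1..r} S'" "AE x in loeb \<omega> X {1..r}. x \<in> S \<longleftrightarrow> x \<in> ultraproduct \<omega> S'"
    using ae_internal[OF _ S] by auto
  have "\<exists>H. \<forall>j\<in>J. internal (E j) (H j) \<and> (AE x in loeb \<omega> X (E j). x \<in> G j \<longleftrightarrow> x \<in> ultraproduct \<omega> (H j))"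
    using ae_internal[OF fE G] by (intro bchoice ballI) blast
  then obtain H where H: "\<And>j. j \<in> J \<Longrightarrow> internal (E j) (H j)"
    "\<And>j. j \<in> J \<Longrightarrow> AE x in loeb \<omega> X (E j). x \<in> G j \<longleftrightarrow> x \<in> ultraproduct \<omega> (H j)"
    by blast
  define Q' where "Q' i = {v \<in> fpower X K i. \<forall>j\<in>J. restrict v (E j) \<in> H j i}" for i
  have Q': "internal K Q'"
    by (rule internalI) (auto simp: Q'_def)
  have inE: "coord_inj (E j) K (\<lambda>j. j)" if "j \<in> J" for j
    using J(2)[OF that] fK by (rule coord_inj_id[rotated])
  have Qev: "Q \<in> sets (loeb \<omega> X K)"
  proof -
    have "Q = upower \<omega> X K \<inter> (\<Inter>j\<in>J. pre K (E j) (\<lambda>j. j) (G j))"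
      by (auto simp: Q_def)
    moreover have "(\<Inter>j\<in>J. pre K (E j) (\<lambda>j. j) (G j)) \<in> sets (loeb \<omega> X K)" if "J \<noteq> {}"
      using J(1) that inE G by (intro sets.finite_INT pre_in_sets) auto
    ultimately show ?thesis
      using upower_in_sets[of K] by (cases "J = {}") auto
  qed
  have mem: "x \<in> ultraproduct \<omega> Q' \<longleftrightarrow> x \<in> upower \<omega> X K \<and> (\<forall>j\<in>J. x \<in> pre K (E j) (\<lambda>j. j) (ultraproduct \<omega> (H j)))" for x
  proof (cases "J = {}")
    case True
    then show ?thesis
      by (simp add: Q'_def[abs_def] upower_def)
  next
    case False
    have "Q' = (\<lambda>i. \<Inter>j\<in>J. ipre K (E j) (\<lambda>j. j) (H j) i)"
      using False by (auto simp: Q'_def ipre_def fun_eq_iff)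
    then have "ultraproduct \<omega> Q' = (\<Inter>j\<in>J. pre K (E j) (\<lambda>j. j) (ultraproduct \<omega> (H j)))"
      using ultraproduct_INT[OF J(1) False, of "\<lambda>j. ipre K (E j) (\<lambda>j. j) (H j)"] by (simp add: pre_ultraproduct)
    then show ?thesis
      using False pre_subset by blast
  qed
  have "AE x in loeb \<omega> X K. pull (E j) (\<lambda>j. j) x \<in> G j \<longleftrightarrow> pull (E j) (\<lambda>j. j) x \<in> ultraproduct \<omega> (H j)" if "j \<in> J" for j
    using AE_pull[OF inE[OF that] H(2)[OF that]] .
  then have "AE x in loeb \<omega> X K. \<forall>j\<in>J. pull (E j) (\<lambda>j. j) x \<in> G j \<longleftrightarrow> pull (E j) (\<lambda>j. j) x \<in> ultraproduct \<omega> (H j)"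
    using J(1) by (intro AE_finite_allI)
  then have aeQ: "AE x in loeb \<omega> X K. x \<in> Q \<longleftrightarrow> x \<in> ultraproduct \<omega> Q'"
    by (rule eventually_mono) (auto simp: mem Q_def pre_def)
  have aeS: "AE x in loeb \<omega> X K. x \<in> pre K {1..r} e S \<longleftrightarrow> x \<in> ultraproduct \<omega> (ipre K {1..r} e S')"
    unfolding pre_ultraproduct[symmetric] by (rule eventually_mono[OF AE_pull[OF e S'(2)]]) (auto simp: pre_def)
  have ind': "A.prob (ultraproduct \<omega> S' \<inter> G) = c * A.prob G" if "G \<in> sets (sigma_coord_star \<omega> X r {1..r})" for G
  proof -
    have "G \<in> sets (loeb \<omega> X {1..r})"
      using that subalgebra_star[of "{1..r}" r] by (auto simp: subalgebra_def)
    moreover have "AE x in loeb \<omega> X {1..r}. x \<in> ultraproduct \<omega> S' \<inter> G \<longleftrightarrow> x \<in> S \<inter> G"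
      using S'(2) by eventually_elim simp
    ultimately have "A.prob (ultraproduct \<omega> S' \<inter> G) = A.prob (S \<inter> G)"
      using S S'(1) by (intro A.finite_measure_eq_AE) (auto simp: ultraproduct_in_sets)
    then show ?thesis
      using ind[OF that] by simp
  qed
  have "K.prob (pre K {1..r} e S \<inter> Q) = K.prob (ultraproduct \<omega> (\<lambda>i. ipre K {1..r} e S' i \<inter> Q' i))"
  proof (rule K.finite_measure_eq_AE)
    show "AE x in loeb \<omega> X K. x \<in> pre K {1..r} e S \<inter> Q \<longleftrightarrow> x \<in> ultraproduct \<omega> (\<lambda>i. ipre K {1..r} e S' i \<inter> Q' i)"
      using aeQ aeS by eventually_elim (simp add: ultraproduct_Int)
  qed (use pre_in_sets[OF e S] Qev ultraproduct_in_sets[OF fK internal_Int[OF internal_ipre]] in auto)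
  also have "\<dots> = um K (\<lambda>i. ipre K {1..r} e S' i \<inter> Q' i)"
    by (rule measure_ultraproduct[OF fK internal_Int[OF internal_ipre]])
  also have "\<dots> = c * um K Q'"
    unfolding Q'_def using e S'(1) ind' J by (rule independent_sections)
  also have "um K Q' = K.prob (ultraproduct \<omega> Q')"
    by (rule measure_ultraproduct[OF fK Q', symmetric])
  also have "\<dots> = K.prob Q"
    using aeQ Qev ultraproduct_in_sets[OF fK Q'] by (intro K.finite_measure_eq_AE) (auto elim: eventually_mono)
  finally show ?thesis .
qed

end

section \<open>Symmetrization\<close>

declare atLeastAtMost_singleton [simp del]

lemma strict_mono_permutation_eq_id:
  fixes \<tau> :: "nat \<Rightarrow> nat"
  assumes \<tau>: "\<tau> permutes {1..r}" and mono: "\<And>a b. a \<in> {1..r} \<Longrightarrow> b \<in> {1..r} \<Longrightarrow> a < b \<Longrightarrow> \<tau> a < \<tau> b"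
  shows "\<tau> = id"
proof (rule permutes_natset_ge[OF \<tau>], rule ballI)
  fix j
  assume "j \<in> {1..r}"
  then show "j \<le> \<tau> j"
  proof (induction j)
    case (Suc j)
    show ?case
    proof (cases "j = 0")
      case True
      then show ?thesis
        using permutes_in_image[OF \<tau>, of 1] Suc(2) by (auto simp: One_nat_def)
    next
      case False
      then have "j \<le> \<tau> j" "\<tau> j < \<tau> (Suc j)"
        using Suc mono[of j "Suc j"] by auto
      then show ?thesis
        by simp
    qed
  qed simp
qed

lemma sorting_permutation:
  fixes f :: "nat \<Rightarrow> real"
  assumes "inj_on f {1..r}"
  obtains \<pi> where "\<pi> permutes {1..r}" "\<And>a b. a \<in> {1..r} \<Longrightarrow> b \<in> {1..r} \<Longrightarrow> a < b \<Longrightarrow> f (\<pi> a) < f (\<pi> b)"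
proof -
  define xs where "xs = sort_key f [1..<Suc r]"
  have xs: "distinct xs" "set xs = {1..r}" "length xs = r" "sorted (map f xs)"
    by (auto simp: xs_def simp del: upt_Suc)
  define \<pi> where "\<pi> j = (if j \<in> {1..r} then xs ! (j - 1) else j)" for j
  have "inj_on \<pi> {1..r}"
    using xs by (auto simp: inj_on_def \<pi>_def nth_eq_iff_index_eq)
  moreover have "\<pi> ` {1..r} \<subseteq> {1..r}"
    using xs nth_mem[of _ xs] by (auto simp: \<pi>_def)
  ultimately have "bij_betw \<pi> {1..r} {1..r}"
    by (simp add: bij_betw_def endo_inj_surj)
  then have \<pi>: "\<pi> permutes {1..r}"
    by (rule bij_imp_permutes) (auto simp only: \<pi>_def if_False)
  have "f (\<pi> a) < f (\<pi> b)" if ab: "a \<in> {1..r}" "b \<in> {1..r}" "a < b" for a b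
  proof -
    have "f (\<pi> a) \<le> f (\<pi> b)"
      using sorted_nth_mono[OF xs(4), of "a - 1" "b - 1"] ab xs(3) by (simp add: \<pi>_def)
    moreover have "f (\<pi> a) \<noteq> f (\<pi> b)"
      using assms ab permutes_in_image[OF \<pi>] permutes_inj[OF \<pi>] by (metis inj_on_contraD inj_onD less_irrefl inj_def)
    ultimately show ?thesis
      by simp
  qed
  then show ?thesis
    using that[OF \<pi>] by blast
qed

section \<open>Uniform functions on one level and permutations of the coordinates\<close>

context ultra_powers
begin

abbreviation star :: "nat \<Rightarrow> 'a upoint measure" where
  "star r \<equiv> sigma_coord_star \<omega> X r {1..r}"

abbreviation level_uniform :: "nat \<Rightarrow> ('a upoint \<Rightarrow> real) \<Rightarrow> bool" where
  "level_uniform r h \<equiv> uniform_over (loeb \<omega> X {1..r}) (star r) h"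

lemma coord_inj_permutes: "\<pi> permutes {1..r} \<Longrightarrow> coord_inj {1..r} {1..r} \<pi>"
  by (simp add: coord_inj_def permutes_inj_on permutes_image)

lemma finite_measure_subalgebra_star: "finite_measure_subalgebra (loeb \<omega> X {1..r}) (star r)"
proof -
  interpret prob_space "loeb \<omega> X {1..r}"
    by (rule prob_space_loeb) simp
  show ?thesis
    by unfold_locales (rule subalgebra_star[OF order_refl])
qed

lemma level_uniform_exists:
  assumes "1 \<le> r" and C: "\<And>n :: nat. C n \<in> sets (loeb \<omega> X {1..r})"
  shows "\<exists>h. level_uniform r h \<and> (\<forall>n. \<exists>E\<in>sets (sigma_join (loeb \<omega> X {1..r}) (star r) h).
    AE x in loeb \<omega> X {1..r}. x \<in> E \<longleftrightarrow> x \<in> C n)"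
proof -
  interpret finite_measure_subalgebra "loeb \<omega> X {1..r}" "star r"
    by (rule finite_measure_subalgebra_star)
  show ?thesis
    by (rule uniform_over_generating[OF prob_space_loeb halving_over_star[OF assms(1)], of C]) (use C in blast)+
qed

lemma level_uniformD:
  assumes "level_uniform r h"
  shows "h \<in> borel_measurable (loeb \<omega> X {1..r})"
    and "x \<in> upower \<omega> X {1..r} \<Longrightarrow> h x \<in> {0..1}"
    and "G \<in> sets (star r) \<Longrightarrow> t \<in> {0..1} \<Longrightarrow> measure (loeb \<omega> X {1..r}) ({x \<in> upower \<omega> X {1..r}. h x \<le> t} \<inter> G)
      = t * measure (loeb \<omega> X {1..r}) G"
  using assms by (auto simp: uniform_over_def)

lemma level_sets_measurable:
  assumes "level_uniform r h" "I \<in> sets borel"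
  shows "{x \<in> upower \<omega> X {1..r}. h x \<in> I} \<in> sets (loeb \<omega> X {1..r})"
proof -
  have "h -` I \<inter> space (loeb \<omega> X {1..r}) \<in> sets (loeb \<omega> X {1..r})"
    using level_uniformD(1)[OF assms(1)] assms(2) by (rule measurable_sets)
  moreover have "h -` I \<inter> space (loeb \<omega> X {1..r}) = {x \<in> upower \<omega> X {1..r}. h x \<in> I}"
    by auto
  ultimately show ?thesis
    by simp
qed

text \<open>A permutation maps facets of the full index set to facets. The resulting invariance of
  the star sigma-algebra is what symmetrization relies on.\<close>

lemma pre_permutes_star:
  assumes \<pi>: "\<pi> permutes {1..r}" and G: "G \<in> sets (star r)"
  shows "pre {1..r} {1..r} \<pi> G \<in> sets (star r)"
proof -
  note st = sets_sigma_coord_star[OF order_refl, of r]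
  have "G \<in> sigma_sets (upower \<omega> X {1..r}) (cylinders r {1..r})"
    using G st(1) by simp
  then show ?thesis
  proof induction
    case (Basic C)
    then obtain H where H: "C = (\<Inter>B\<in>facets {1..r}. pre {1..r} B (\<lambda>j. j) (H B))"
      "\<And>B. B \<in> facets {1..r} \<Longrightarrow> H B \<in> sets (loeb \<omega> X B)"
      unfolding cylinders_def by blast
    have "pre {1..r} {1..r} \<pi> C = (\<Inter>B\<in>facets {1..r}. pre {1..r} {1..r} \<pi> (pre {1..r} B (\<lambda>j. j) (H B)))"
      unfolding H(1) using facets_nonempty[of "{1..r}"] by (auto simp: pre_def)
    moreover have "pre {1..r} {1..r} \<pi> (pre {1..r} B (\<lambda>j. j) (H B)) \<in> sets (star r)" if B: "B \<in> facets {1..r}" for B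
    proof -
      have BA: "B \<subseteq> {1..r}"
        using B by (rule facets_subset)
      have inj: "inj_on \<pi> B"
        using permutes_inj_on[OF \<pi>] .
      have B': "\<pi> ` B \<in> facets {1..r}"
        using B image_mono[OF BA, of \<pi>] permutes_image[OF \<pi>] inj by (simp add: facets_def card_image)
      have "finite B"
        using BA finite_subset by blast
      then have "pre (\<pi> ` B) B \<pi> (H B) \<in> sets (loeb \<omega> X (\<pi> ` B))"
        using inj by (intro pre_in_sets[OF _ H(2)[OF B]]) (simp add: coord_inj_def)
      then have "pre {1..r} (\<pi> ` B) (\<lambda>j. j) (pre (\<pi> ` B) B \<pi> (H B)) \<in> sets (star r)"
        by (rule pre_in_star[OF order_refl B'])
      also have "pre {1..r} (\<pi> ` B) (\<lambda>j. j) (pre (\<pi> ` B) B \<pi> (H B)) = pre {1..r} {1..r} \<pi> (pre {1..r} B (\<lambda>j. j) (H B))"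
        using BA facets_subset[OF B'] permutes_image[OF \<pi>] by (subst (1 2) pre_pre) auto
      finally show ?thesis .
    qed
    ultimately show ?case
      using facets_finite[of "{1..r}"] facets_nonempty[of "{1..r}"] by (auto intro!: sets.finite_INT)
  next
    case Empty
    then show ?case
      by (simp add: pre_def)
  next
    case (Compl a)
    have "pre {1..r} {1..r} \<pi> (upower \<omega> X {1..r} - a) = space (star r) - pre {1..r} {1..r} \<pi> a"
      using pull_upower[of \<pi> "{1..r}" "{1..r}"] permutes_image[OF \<pi>] by (auto simp: pre_def st(4))
    then show ?case
      using Compl by auto
  next
    case (Union a)
    have "pre {1..r} {1..r} \<pi> (\<Union>i. a i) = (\<Union>i. pre {1..r} {1..r} \<pi> (a i))"
      by (auto simp: pre_def)
    then show ?case
      using Union by auto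
  qed
qed

lemma pre_permutes_inv:
  assumes "\<pi> permutes {1..r}" "M \<subseteq> upower \<omega> X {1..r}"
  shows "pre {1..r} {1..r} \<pi> (pre {1..r} {1..r} (inv \<pi>) M) = M"
    and "pre {1..r} {1..r} (inv \<pi>) (pre {1..r} {1..r} \<pi> M) = M"
  using assms permutes_inv[OF assms(1)]
  by (simp_all add: pre_pre permutes_image permutes_inverses[OF assms(1)] pre_id)

end

text \<open>\<open>u\<close> is fixed once for all powers. Comparing its values at the coordinates
  of a point takes the place of a linear order on the base space, and is measurable.\<close>

locale ordered_ultra_powers = ultra_powers +
  fixes u :: "'a upoint \<Rightarrow> real"
  assumes u: "level_uniform 1 u"
begin

definition val :: "nat \<Rightarrow> 'a upoint \<Rightarrow> real" where
  "val a x = u (pull {1..1} (\<lambda>_. a) x)"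

definition sorted_points :: "nat \<Rightarrow> 'a upoint set" where
  "sorted_points r = {x \<in> upower \<omega> X {1..r}. \<forall>a\<in>{1..r}. \<forall>b\<in>{1..r}. a < b \<longrightarrow> val a x < val b x}"

text \<open>At most one permutation sorts a given point, so the sum merely selects a value. As a sum
  over the whole group it is symmetric and measurable without any choice of a permutation; points
  with ties get 0.\<close>

definition symmetrize :: "nat \<Rightarrow> ('a upoint \<Rightarrow> real) \<Rightarrow> 'a upoint \<Rightarrow> real" where
  "symmetrize r h x = (\<Sum>\<pi> | \<pi> permutes {1..r}.
     if pull {1..r} \<pi> x \<in> sorted_points r then h (pull {1..r} \<pi> x) else 0)"

lemma coord_inj_const: "finite B \<Longrightarrow> a \<in> B \<Longrightarrow> coord_inj {1..1} B (\<lambda>_. a)"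
  by (auto simp: coord_inj_def inj_on_def)

lemma val_pull: "a \<in> A \<Longrightarrow> x \<in> upower \<omega> X B \<Longrightarrow> val a (pull A e x) = val (e a) x"
  unfolding val_def by (subst pull_pull[of _ _ A x B]) auto

lemma val_vimage: "{x \<in> upower \<omega> X B. val a x \<in> I} = pre B {1..1} (\<lambda>_. a) {y \<in> upower \<omega> X {1..1}. u y \<in> I}" if "a \<in> B"
  using that pull_upower[of "\<lambda>_. a" "{1..1}" B] by (auto simp: pre_def val_def)

lemma val_measurable_sigma_coord:
  assumes "b \<in> {1..r}"
  shows "val b \<in> borel_measurable (sigma_coord \<omega> X r {b})"
proof (rule measurableI)
  fix I :: "real set"
  assume I: "I \<in> sets borel"
  have sp: "space (sigma_coord \<omega> X r {b}) = upower \<omega> X {1..r}"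
    by (simp add: sigma_coord_def)
  have "val b -` I \<inter> space (sigma_coord \<omega> X r {b}) = {x \<in> upower \<omega> X {1..r}. val b x \<in> I}"
    using sp by auto
  also have "\<dots> = pre {1..r} {1..1} (\<lambda>_. b) {y \<in> upower \<omega> X {1..1}. u y \<in> I}"
    using assms by (rule val_vimage)
  also have "\<dots> = pre {1..r} {b} (\<lambda>j. j) (pre {b} {1..1} (\<lambda>_. b) {y \<in> upower \<omega> X {1..1}. u y \<in> I})"
    using assms by (subst pre_pre) auto
  finally show "val b -` I \<inter> space (sigma_coord \<omega> X r {b}) \<in> sets (sigma_coord \<omega> X r {b})"
    using assms pre_in_sets[OF coord_inj_const[of "{b}" b] level_sets_measurable[OF u I]]
    by (auto simp: sets_sigma_coord)
qed simp

text \<open>\<open>val b\<close> depends on the coordinate \<open>b\<close> alone, and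
  \<open>val a\<close> is uniform and independent of that coordinate; so a tie is an event on a null
  graph.\<close>

lemma AE_val_neq:
  assumes ab: "a \<in> {1..r}" "b \<in> {1..r}" "a \<noteq> b"
  shows "AE x in loeb \<omega> X {1..r}. val a x \<noteq> val b x"
proof -
  let ?M = "loeb \<omega> X {1..r}" and ?F = "sigma_coord \<omega> X r {b}"
  interpret prob_space ?M
    by (rule prob_space_loeb) simp
  have b: "{b} \<subseteq> {1..r}"
    using ab by auto
  have "sets ?F \<subseteq> sets ?M"
    using pre_in_sets[OF coord_inj_id[OF _ b]] by (auto simp: sets_sigma_coord[OF b])
  then have sub: "subalgebra ?M ?F"
    by (simp add: subalgebra_def sigma_coord_def)
  interpret finite_measure_subalgebra ?M ?F
    by unfold_locales (rule sub)
  have "uniform_over ?M ?F (val a)"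
    unfolding uniform_over_def
  proof (intro conjI ballI)
    have "(\<lambda>x. u (pull {1..1} (\<lambda>_. a) x)) \<in> borel_measurable ?M"
      using measurable_comp[OF pull_measurable[OF coord_inj_const[of "{1..r}" a]] level_uniformD(1)[OF u]] ab
      by (simp add: comp_def)
    then show "val a \<in> borel_measurable ?M"
      by (simp add: val_def[abs_def])
    show "val a x \<in> {0..1}" if "x \<in> space ?M" for x
      unfolding val_def using that ab by (intro level_uniformD(2)[OF u] pull_upower) auto
    fix G and t :: real
    assume G: "G \<in> sets ?F" and t: "t \<in> {0..1}"
    then obtain H where H: "H \<in> sets (loeb \<omega> X {b})" "G = pre {1..r} {b} (\<lambda>j. j) H"
      by (auto simp: sets_sigma_coord[OF b])
    have "prob (pre {1..r} {1..1} (\<lambda>_. a) {y \<in> upower \<omega> X {1..1}. u y \<in> {..t}} \<inter> {x \<in> upower \<omega> X {1..r}. \<forall>j\<in>{()}. x \<in> pre {1..r} {b} (\<lambda>j. j) H})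
        = t * prob {x \<in> upower \<omega> X {1..r}. \<forall>j\<in>{()}. x \<in> pre {1..r} {b} (\<lambda>j. j) H}"
    proof (rule independent_of_other_coordinates)
      show "coord_inj {1..1} {1..r} (\<lambda>_. a)"
        using ab by (intro coord_inj_const) auto
      show "{y \<in> upower \<omega> X {1..1}. u y \<in> {..t}} \<in> sets (loeb \<omega> X {1..1})"
        by (rule level_sets_measurable[OF u]) simp
      show "measure (loeb \<omega> X {1..1}) ({y \<in> upower \<omega> X {1..1}. u y \<in> {..t}} \<inter> G) = t * measure (loeb \<omega> X {1..1}) G"
        if "G \<in> sets (star 1)" for G
        using level_uniformD(3)[OF u that t] by simp
    qed (use ab H in \<open>auto simp: atLeastAtMost_singleton\<close>)
    moreover have "{x \<in> upower \<omega> X {1..r}. \<forall>j\<in>{()}. x \<in> pre {1..r} {b} (\<lambda>j. j) H} = G"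
      using H(2) pre_subset[of "{1..r}" "{b}" "\<lambda>j. j" H] by auto
    moreover have "pre {1..r} {1..1} (\<lambda>_. a) {y \<in> upower \<omega> X {1..1}. u y \<in> {..t}} = {x \<in> space ?M. val a x \<le> t}"
      using val_vimage[OF ab(1), of "{..t}"] by simp
    ultimately show "prob ({x \<in> space ?M. val a x \<le> t} \<inter> G) = t * prob G"
      by simp
  qed
  from uniform_over_null_graph[OF this val_measurable_sigma_coord[OF ab(2)] prob_space_axioms]
  show ?thesis
    by (rule AE_I') auto
qed

lemma AE_sortable: "AE x in loeb \<omega> X {1..r}. \<exists>\<pi>. \<pi> permutes {1..r} \<and> pull {1..r} \<pi> x \<in> sorted_points r"
proof -
  have "AE x in loeb \<omega> X {1..r}. \<forall>p\<in>{p \<in> {1..r} \<times> {1..r}. fst p \<noteq> snd p}. val (fst p) x \<noteq> val (snd p) x"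
    by (intro AE_finite_allI) (auto intro!: AE_val_neq)
  then show ?thesis
    using AE_space
  proof eventually_elim
    case (elim x)
    then have x: "x \<in> upower \<omega> X {1..r}"
      by simp
    have "inj_on (\<lambda>a. val a x) {1..r}"
      using elim(1) by (force simp: inj_on_def)
    then obtain \<pi> where \<pi>: "\<pi> permutes {1..r}"
      "\<And>a b. a \<in> {1..r} \<Longrightarrow> b \<in> {1..r} \<Longrightarrow> a < b \<Longrightarrow> val (\<pi> a) x < val (\<pi> b) x"
      using sorting_permutation[of "\<lambda>a. val a x" r] by blast
    have "pull {1..r} \<pi> x \<in> upower \<omega> X {1..r}"
      using x permutes_image[OF \<pi>(1)] by (intro pull_upower[of \<pi> "{1..r}" "{1..r}"]) auto
    then have "pull {1..r} \<pi> x \<in> sorted_points r"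
      using \<pi>(2) x by (auto simp: sorted_points_def val_pull)
    then show ?case
      using \<pi>(1) by blast
  qed
qed

lemma sorting_unique:
  assumes x: "x \<in> upower \<omega> X {1..r}" and \<pi>: "\<pi> permutes {1..r}" "pull {1..r} \<pi> x \<in> sorted_points r"
    and \<rho>: "\<rho> permutes {1..r}" "pull {1..r} \<rho> x \<in> sorted_points r"
  shows "\<pi> = \<rho>"
proof -
  define \<tau> where "\<tau> = inv \<rho> \<circ> \<pi>"
  have \<tau>: "\<tau> permutes {1..r}"
    unfolding \<tau>_def using \<pi>(1) permutes_inv[OF \<rho>(1)] by (rule permutes_compose)
  have "\<rho> (\<tau> j) = \<pi> j" for j
    using permutes_inverses[OF \<rho>(1)] by (simp add: \<tau>_def)
  then have \<pi>_eq: "\<pi> = \<rho> \<circ> \<tau>"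
    by auto
  have mono: "val (\<pi> a) x < val (\<pi> b) x" "val (\<rho> a) x < val (\<rho> b) x"
    if "a \<in> {1..r}" "b \<in> {1..r}" "a < b" for a b
    using \<pi>(2) \<rho>(2) that x by (auto simp: sorted_points_def val_pull)
  have "\<tau> = id"
  proof (rule strict_mono_permutation_eq_id[OF \<tau>])
    fix a b
    assume ab: "a \<in> {1..r}" "b \<in> {1..r}" "a < b"
    have in': "\<tau> a \<in> {1..r}" "\<tau> b \<in> {1..r}"
      using ab permutes_in_image[OF \<tau>] by auto
    have "val (\<rho> (\<tau> a)) x < val (\<rho> (\<tau> b)) x"
      using mono(1)[OF ab] by (simp add: \<pi>_eq)
    then have "\<not> \<tau> b < \<tau> a" "\<tau> a \<noteq> \<tau> b"
      using mono(2)[OF in'(2,1)] by fastforce+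
    then show "\<tau> a < \<tau> b"
      by simp
  qed
  then show ?thesis
    using \<pi>_eq by simp
qed

lemma symmetrize_sorted:
  assumes x: "x \<in> upower \<omega> X {1..r}" and \<pi>: "\<pi> permutes {1..r}" "pull {1..r} \<pi> x \<in> sorted_points r"
  shows "symmetrize r h x = h (pull {1..r} \<pi> x)"
proof -
  have "symmetrize r h x = (\<Sum>\<rho> | \<rho> permutes {1..r}. if \<rho> = \<pi> then h (pull {1..r} \<pi> x) else 0)"
    unfolding symmetrize_def
  proof (intro sum.cong refl)
    fix \<rho>
    assume "\<rho> \<in> {\<rho>. \<rho> permutes {1..r}}"
    then have "pull {1..r} \<rho> x \<in> sorted_points r \<longleftrightarrow> \<rho> = \<pi>"
      using sorting_unique[OF x _ _ \<pi>] \<pi>(2) by blast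
    then show "(if pull {1..r} \<rho> x \<in> sorted_points r then h (pull {1..r} \<rho> x) else 0)
        = (if \<rho> = \<pi> then h (pull {1..r} \<pi> x) else 0)"
      by (cases "\<rho> = \<pi>") simp_all
  qed
  then show ?thesis
    using \<pi>(1) by (simp add: sum.delta finite_permutations)
qed

lemma symmetrize_on_sorted:
  assumes "x \<in> sorted_points r"
  shows "symmetrize r h x = h x"
proof -
  have x: "x \<in> upower \<omega> X {1..r}"
    using assms by (simp add: sorted_points_def)
  have "pull {1..r} id x = x"
    using pull_id[OF x] by (simp add: id_def)
  then show ?thesis
    using symmetrize_sorted[OF x permutes_id, of h] assms by simp
qed

text \<open>Left composition with \<open>\<rho>\<close> permutes the summands. The identity holds at
  every point, ties included, as equivariance of the realization demands.\<close>

lemma symmetrize_pull: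
  assumes x: "x \<in> upower \<omega> X {1..r}" and \<rho>: "\<rho> permutes {1..r}"
  shows "symmetrize r h (pull {1..r} \<rho> x) = symmetrize r h x"
proof -
  have "pull {1..r} \<pi> (pull {1..r} \<rho> x) = pull {1..r} (\<rho> \<circ> \<pi>) x" if "\<pi> permutes {1..r}" for \<pi>
    using pull_pull[of \<pi> "{1..r}" "{1..r}" x "{1..r}" \<rho>] x permutes_image[OF that] by (simp add: comp_def)
  then show ?thesis
    unfolding symmetrize_def
    by (subst (2) setum_permutations_compose_left[OF \<rho>]) (auto intro!: sum.cong)
qed

lemma symmetrize_bounds:
  assumes h: "level_uniform r h" and x: "x \<in> upower \<omega> X {1..r}"
  shows "symmetrize r h x \<in> {0..1}"
proof (cases "\<exists>\<pi>. \<pi> permutes {1..r} \<and> pull {1..r} \<pi> x \<in> sorted_points r")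
  case True
  then obtain \<pi> where "\<pi> permutes {1..r}" "pull {1..r} \<pi> x \<in> sorted_points r"
    by blast
  then show ?thesis
    using symmetrize_sorted[OF x] level_uniformD(2)[OF h, of "pull {1..r} \<pi> x"] by (simp add: sorted_points_def)
next
  case False
  then have "symmetrize r h x = 0"
    unfolding symmetrize_def by (intro sum.neutral) auto
  then show ?thesis
    by simp
qed

lemma sorted_points_in_sigma_algebra:
  assumes sp: "space N = upower \<omega> X {1..r}" and val: "\<And>a. a \<in> {1..r} \<Longrightarrow> val a \<in> borel_measurable N"
  shows "sorted_points r \<in> sets N"
proof -
  define P where "P = {p \<in> {1..r} \<times> {1..r}. fst p < snd p}"
  have "sorted_points r = {x \<in> space N. \<forall>p\<in>P. val (fst p) x < val (snd p) x}"
    by (auto simp: sorted_points_def sp P_def)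
  moreover have "{x \<in> space N. \<forall>p\<in>P. val (fst p) x < val (snd p) x} \<in> sets N"
  proof (rule sets.sets_Collect_finite_All)
    show "{x \<in> space N. val (fst p) x < val (snd p) x} \<in> sets N" if "p \<in> P" for p
      using that val by (intro borel_measurable_less) (auto simp: P_def)
    show "finite P"
      unfolding P_def by simp
  qed
  ultimately show ?thesis
    by simp
qed

text \<open>For \<open>r \<ge> 2\<close> each \<open>val a\<close> depends on a proper subset of the
  coordinates, so comparing two of them stays in the star sigma-algebra; for \<open>r = 1\<close>
  there is nothing to compare.\<close>

lemma sorted_points_star:
  assumes "1 \<le> r"
  shows "sorted_points r \<in> sets (star r)"
proof (cases "r = 1")
  case True
  then have "sorted_points r = space (star r)"
    using sets_sigma_coord_star(4)[of "{1..r}" r] by (auto simp: sorted_points_def)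
  then show ?thesis
    using sets.top[of "star r"] by simp
next
  case False
  show ?thesis
  proof (rule sorted_points_in_sigma_algebra)
    show sp: "space (star r) = upower \<omega> X {1..r}"
      by (rule sets_sigma_coord_star(4)) simp
    fix a
    assume a: "a \<in> {1..r}"
    show "val a \<in> borel_measurable (star r)"
    proof (rule measurableI)
      fix I :: "real set"
      assume I: "I \<in> sets borel"
      have "{a} \<subset> {1..r}"
      proof -
        have "1 \<in> {1..r}" "2 \<in> {1..r}" "(1 :: nat) \<noteq> 2"
          using assms False by auto
        then show ?thesis
          using a by (metis empty_subsetI insert_subset psubsetI singletonD)
      qed
      then obtain B where B: "B \<in> facets {1..r}" "{a} \<subseteq> B"
        using facet_superset[of "{1..r}" "{a}"] by auto
      have "finite B"
        using facets_subset[OF B(1)] finite_subset by blast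
      then have "pre B {1..1} (\<lambda>_. a) {y \<in> upower \<omega> X {1..1}. u y \<in> I} \<in> sets (loeb \<omega> X B)"
        using B(2) by (intro pre_in_sets coord_inj_const level_sets_measurable[OF u I]) auto
      then have "pre {1..r} B (\<lambda>j. j) (pre B {1..1} (\<lambda>_. a) {y \<in> upower \<omega> X {1..1}. u y \<in> I}) \<in> sets (star r)"
        by (rule pre_in_star[OF order_refl B(1)])
      also have "pre {1..r} B (\<lambda>j. j) (pre B {1..1} (\<lambda>_. a) {y \<in> upower \<omega> X {1..1}. u y \<in> I})
          = {x \<in> upower \<omega> X {1..r}. val a x \<in> I}"
        unfolding val_vimage[OF a] using B(2) facets_subset[OF B(1)] by (subst pre_pre) auto
      also have "\<dots> = val a -` I \<inter> space (star r)"
        using sp by auto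
      finally show "val a -` I \<inter> space (star r) \<in> sets (star r)" .
    qed simp
  qed
qed

lemma sorted_points_sets: "1 \<le> r \<Longrightarrow> sorted_points r \<in> sets (loeb \<omega> X {1..r})"
  using sorted_points_star subalgebra_star[of "{1..r}" r] by (auto simp: subalgebra_def)

text \<open>The preimages of the sorted set under the permutations are disjoint, since sorting is
  unique, and cover almost everything.\<close>

lemma measure_eq_sum_sorted:
  assumes r: "1 \<le> r" and R: "R \<in> sets (loeb \<omega> X {1..r})"
  shows "measure (loeb \<omega> X {1..r}) R
    = (\<Sum>\<pi> | \<pi> permutes {1..r}. measure (loeb \<omega> X {1..r}) (pre {1..r} {1..r} \<pi> (sorted_points r) \<inter> R))"
proof -
  let ?P = "{\<pi>. \<pi> permutes {1..r}}" and ?D = "\<lambda>\<pi>. pre {1..r} {1..r} \<pi> (sorted_points r) \<inter> R"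
  interpret prob_space "loeb \<omega> X {1..r}"
    by (rule prob_space_loeb) simp
  have ev: "?D \<pi> \<in> events" if "\<pi> \<in> ?P" for \<pi>
    using that R pre_in_sets[OF coord_inj_permutes sorted_points_sets[OF r]] by auto
  have "prob R = prob (\<Union>\<pi>\<in>?P. ?D \<pi>)"
  proof (rule finite_measure_eq_AE[OF _ R])
    show "AE x in loeb \<omega> X {1..r}. x \<in> R \<longleftrightarrow> x \<in> (\<Union>\<pi>\<in>?P. ?D \<pi>)"
      using AE_sortable[of r] AE_space by eventually_elim (auto simp: pre_def)
    show "(\<Union>\<pi>\<in>?P. ?D \<pi>) \<in> events"
      using ev by (intro sets.finite_UN finite_permutations) auto
  qed
  also have "\<dots> = (\<Sum>\<pi>\<in>?P. prob (?D \<pi>))"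
  proof (rule finite_measure_finite_Union)
    show "disjoint_family_on ?D ?P"
      using sorting_unique unfolding disjoint_family_on_def pre_def by blast
  qed (use ev in \<open>auto simp: finite_permutations\<close>)
  finally show ?thesis .
qed

lemma symmetrize_measurable:
  assumes r: "1 \<le> r" and h: "level_uniform r h"
  shows "symmetrize r h \<in> borel_measurable (loeb \<omega> X {1..r})"
proof -
  note [measurable] = level_uniformD(1)[OF h] sorted_points_sets[OF r]
  have *: "(\<lambda>x. if pull {1..r} \<pi> x \<in> sorted_points r then h (pull {1..r} \<pi> x) else 0) \<in> borel_measurable (loeb \<omega> X {1..r})"
    if "\<pi> permutes {1..r}" for \<pi>
  proof -
    note [measurable] = pull_measurable[OF coord_inj_permutes[OF that]]
    show ?thesis
      by measurable
  qed
  show ?thesis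
    unfolding symmetrize_def[abs_def] by (intro borel_measurable_sum *) simp
qed

text \<open>On the tile sorted by \<open>\<pi>\<close> the symmetrized function is \<open>h\<close>
  moved by \<open>\<pi>\<close>. Moving the tile and \<open>G\<close> back stays in the star
  sigma-algebra, so uniformity of \<open>h\<close> applies tile by tile.\<close>

lemma level_uniform_symmetrize:
  assumes r: "1 \<le> r" and h: "level_uniform r h"
  shows "level_uniform r (symmetrize r h)"
  unfolding uniform_over_def
proof (intro conjI ballI)
  let ?M = "loeb \<omega> X {1..r}"
  interpret prob_space ?M
    by (rule prob_space_loeb) simp
  show "symmetrize r h \<in> borel_measurable ?M"
    by (rule symmetrize_measurable[OF r h])
  then have [measurable]: "symmetrize r h \<in> borel_measurable ?M" .
  show "symmetrize r h x \<in> {0..1}" if "x \<in> space ?M" for x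
    using that symmetrize_bounds[OF h] by simp
  fix G and t :: real
  assume G: "G \<in> sets (star r)" and t: "t \<in> {0..1}"
  have GM [measurable]: "G \<in> events" and G_sub: "G \<subseteq> upower \<omega> X {1..r}"
    using G subalgebra_star[of "{1..r}" r] sets.sets_into_space[of G ?M] by (auto simp: subalgebra_def)
  let ?W = "sorted_points r" and ?p = "\<lambda>\<pi>. pre {1..r} {1..r} \<pi>"
  have part: "prob (?p \<pi> ?W \<inter> ({x \<in> space ?M. symmetrize r h x \<le> t} \<inter> G)) = t * prob (?p \<pi> ?W \<inter> G)"
    if \<pi>: "\<pi> permutes {1..r}" for \<pi>
  proof -
    define G' where "G' = ?W \<inter> ?p (inv \<pi>) G"
    have G': "G' \<in> sets (star r)"
      unfolding G'_def using sorted_points_star[OF r] pre_permutes_star[OF permutes_inv[OF \<pi>] G] by blast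
    have G'M: "G' \<in> events"
      using G' subalgebra_star[of "{1..r}" r] by (auto simp: subalgebra_def)
    have hM: "{x \<in> upower \<omega> X {1..r}. h x \<le> t} \<in> events"
      using level_sets_measurable[OF h, of "{..t}"] by simp
    have eq: "?p \<pi> G' = ?p \<pi> ?W \<inter> G"
      unfolding G'_def pre_Int pre_permutes_inv(1)[OF \<pi> G_sub] ..
    have "?p \<pi> ({x \<in> upower \<omega> X {1..r}. h x \<le> t} \<inter> G') = ?p \<pi> ?W \<inter> ({x \<in> space ?M. symmetrize r h x \<le> t} \<inter> G)"
      unfolding pre_Int eq using symmetrize_sorted[OF _ \<pi>] pull_upower[of \<pi> "{1..r}" "{1..r}"] permutes_image[OF \<pi>]
      by (auto simp: pre_def)
    then have "prob (?p \<pi> ?W \<inter> ({x \<in> space ?M. symmetrize r h x \<le> t} \<inter> G)) = prob ({x \<in> upower \<omega> X {1..r}. h x \<le> t} \<inter> G')"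
      using measure_pre[OF coord_inj_permutes[OF \<pi>] sets.Int[OF hM G'M]] by simp
    also have "\<dots> = t * prob G'"
      by (rule level_uniformD(3)[OF h G' t])
    also have "prob G' = prob (?p \<pi> ?W \<inter> G)"
      using measure_pre[OF coord_inj_permutes[OF \<pi>] G'M] eq by simp
    finally show ?thesis .
  qed
  have "prob ({x \<in> space ?M. symmetrize r h x \<le> t} \<inter> G)
      = (\<Sum>\<pi> | \<pi> permutes {1..r}. prob (?p \<pi> ?W \<inter> ({x \<in> space ?M. symmetrize r h x \<le> t} \<inter> G)))"
    by (rule measure_eq_sum_sorted[OF r]) measurable
  also have "\<dots> = (\<Sum>\<pi> | \<pi> permutes {1..r}. t * prob (?p \<pi> ?W \<inter> G))"
    using part by (intro sum.cong) auto
  also have "\<dots> = t * prob G"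
    unfolding measure_eq_sum_sorted[OF r GM] sum_distrib_left ..
  finally show "prob ({x \<in> space ?M. symmetrize r h x \<le> t} \<inter> G) = t * prob G" .
qed

end

section \<open>Generating separable families level by level\<close>

context ultra_powers
begin

lemma pre_null_sets:
  assumes e: "coord_inj A B e" and N: "N \<in> null_sets (loeb \<omega> X A)"
  shows "pre B A e N \<in> null_sets (loeb \<omega> X B)"
proof -
  have "finite A" "finite B"
    using e coord_inj_finite by (auto simp: coord_inj_def)
  then show ?thesis
    using N loeb_null_pre[OF e] pre_subset by (simp add: null_sets_loeb)
qed

lemma coord_inj_le: "coord_inj {1..j} {1..r} e \<Longrightarrow> j \<le> r"
  unfolding coord_inj_def using card_inj_on_le[of e "{1..j}" "{1..r}"] by simp

text \<open>Enumerating every facet by \<open>{1..r}\<close> turns its sets into sets of the one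
  \<open>r\<close>-th power, so that the next level of the recursion deals with a single
  space.\<close>

lemma star_Suc_generated:
  "sets (star (Suc r)) \<subseteq> sigma_sets (upower \<omega> X {1..Suc r})
    {pre {1..Suc r} {1..r} e D | D e. D \<in> sets (loeb \<omega> X {1..r}) \<and> coord_inj {1..r} {1..Suc r} e}"
  (is "_ \<subseteq> sigma_sets ?\<Omega> ?V")
proof -
  let ?A = "{1..Suc r}"
  have V: "?V \<subseteq> Pow ?\<Omega>"
    using pre_subset by blast
  interpret sigma_algebra ?\<Omega> "sigma_sets ?\<Omega> ?V"
    using V by (rule sigma_algebra_sigma_sets)
  have "cylinders (Suc r) ?A \<subseteq> sigma_sets ?\<Omega> ?V"
  proof
    fix C
    assume "C \<in> cylinders (Suc r) ?A"
    then obtain H where H: "C = (\<Inter>B\<in>facets ?A. pre ?A B (\<lambda>j. j) (H B))"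
      "\<And>B. B \<in> facets ?A \<Longrightarrow> H B \<in> sets (loeb \<omega> X B)"
      unfolding cylinders_def by blast
    have "pre ?A B (\<lambda>j. j) (H B) \<in> sigma_sets ?\<Omega> ?V" if B: "B \<in> facets ?A" for B
    proof -
      have fB: "finite B" "card B = r" "B \<subseteq> ?A"
        using B finite_subset[of B ?A] by (auto simp: facets_def)
      then obtain g where g: "bij_betw g {1..r} B"
        using ex_bij_betw_nat_finite_1 by blast
      \<comment> \<open>\<open>g'\<close> undoes the enumeration \<open>g\<close>: the factor is
        pulled to the \<open>r\<close>-th power along \<open>g'\<close> and from there along
        \<open>g\<close>.\<close>
      define g' where "g' = inv_into {1..r} g"
      have g': "bij_betw g' B {1..r}"
        unfolding g'_def using g by (rule bij_betw_inv_into)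
      have inv: "g (g' j) = j" if "j \<in> B" for j
        unfolding g'_def using g that by (rule bij_betw_inv_into_right)
      have inj: "coord_inj B {1..r} g'" "coord_inj {1..r} ?A g"
        using g g' fB by (auto simp: coord_inj_def bij_betw_def)
      have "pre ?A B (\<lambda>j. j) (H B) = pre ?A B (\<lambda>j. g (g' j)) (H B)"
        using inv by (intro pre_cong) simp
      also have "\<dots> = pre ?A {1..r} g (pre {1..r} B g' (H B))"
        using inj by (intro pre_pre[symmetric]) (auto simp: coord_inj_def)
      finally show ?thesis
        using inj(2) pre_in_sets[OF inj(1) H(2)[OF B]] by (intro sigma_sets.Basic) blast
    qed
    then show "C \<in> sigma_sets ?\<Omega> ?V"
      unfolding H(1) using facets_finite[of ?A] facets_nonempty[of ?A] by (intro finite_INT) auto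
  qed
  then show ?thesis
    using sigma_sets_mono sets_sigma_coord_star(1)[OF order_refl, of "Suc r"] by blast
qed

text \<open>A set of the joined sigma-algebra needs only countably many generators. Those from the
  star sigma-algebra are built from pull-backs of sets on the \<open>r\<close>-th power, which are
  collected in \<open>\<D>\<close>.\<close>

lemma level_step:
  assumes \<C>: "countable \<C>" "\<C> \<subseteq> sets (loeb \<omega> X {1..Suc r})"
  shows "\<exists>h \<D>. level_uniform (Suc r) h \<and> countable \<D> \<and> \<D> \<subseteq> sets (loeb \<omega> X {1..r}) \<and>
    (\<forall>C\<in>\<C>. \<exists>E\<in>sigma_sets (upower \<omega> X {1..Suc r})
        ({pre {1..Suc r} {1..r} e D | D e. D \<in> \<D> \<and> coord_inj {1..r} {1..Suc r} e}
         \<union> {{x \<in> upower \<omega> X {1..Suc r}. h x \<in> I} | I. I \<in> sets borel}).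
      AE x in loeb \<omega> X {1..Suc r}. x \<in> E \<longleftrightarrow> x \<in> C)"
proof -
  let ?\<Omega> = "upower \<omega> X {1..Suc r}" and ?M = "loeb \<omega> X {1..Suc r}"
  define V where "V \<D> = {pre {1..Suc r} {1..r} e D | D e. D \<in> \<D> \<and> coord_inj {1..r} {1..Suc r} e}" for \<D>
  \<comment> \<open>The empty set is inserted because the enumeration needs a nonempty
    family.\<close>
  define c where "c = from_nat_into (insert {} \<C>)"
  have c: "range c = insert {} \<C>"
    unfolding c_def using \<C>(1) by (intro range_from_nat_into) auto
  then have "c n \<in> sets ?M" for n
    using \<C>(2) by (metis insert_iff rangeI sets.empty_sets subsetD)
  then obtain h where h: "level_uniform (Suc r) h"
    "\<And>n. \<exists>E\<in>sets (sigma_join ?M (star (Suc r)) h). AE x in ?M. x \<in> E \<longleftrightarrow> x \<in> c n"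
    using level_uniform_exists[of "Suc r" c] by auto
  define \<H> where "\<H> = {{x \<in> ?\<Omega>. h x \<in> I} | I. I \<in> sets (borel :: real measure)}"
  have star_sub: "sets (star (Suc r)) \<subseteq> Pow ?\<Omega>"
    using sets.space_closed[of "star (Suc r)"] sets_sigma_coord_star(4)[of "{1..Suc r}" "Suc r"] by simp
  have "sets (sigma_join ?M (star (Suc r)) h) = sigma_sets ?\<Omega> (sets (star (Suc r)) \<union> \<H>)"
    unfolding sigma_join_def \<H>_def using star_sub by (subst sets_measure_of) auto
  also have "\<dots> \<subseteq> sigma_sets ?\<Omega> (V (sets (loeb \<omega> X {1..r})) \<union> \<H>)"
  proof (intro sigma_sets_mono Un_least)
    show "sets (star (Suc r)) \<subseteq> sigma_sets ?\<Omega> (V (sets (loeb \<omega> X {1..r})) \<union> \<H>)"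
      using star_Suc_generated[of r] sigma_sets_mono'[of "V (sets (loeb \<omega> X {1..r}))" _ ?\<Omega>]
      unfolding V_def by (meson Un_upper1 order_trans)
    show "\<H> \<subseteq> sigma_sets ?\<Omega> (V (sets (loeb \<omega> X {1..r})) \<union> \<H>)"
      by (auto intro: sigma_sets.Basic)
  qed
  finally have sub: "sets (sigma_join ?M (star (Suc r)) h) \<subseteq> sigma_sets ?\<Omega> (V (sets (loeb \<omega> X {1..r})) \<union> \<H>)" .
  have "\<exists>\<D>. countable \<D> \<and> \<D> \<subseteq> sets (loeb \<omega> X {1..r}) \<and>
      (\<exists>E\<in>sigma_sets ?\<Omega> (V \<D> \<union> \<H>). AE x in ?M. x \<in> E \<longleftrightarrow> x \<in> c n)" for n
  proof -
    obtain E where E: "E \<in> sigma_sets ?\<Omega> (V (sets (loeb \<omega> X {1..r})) \<union> \<H>)" "AE x in ?M. x \<in> E \<longleftrightarrow> x \<in> c n"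
      using h(2)[of n] sub by blast
    obtain \<G> where \<G>: "countable \<G>" "\<G> \<subseteq> V (sets (loeb \<omega> X {1..r})) \<union> \<H>" "E \<in> sigma_sets ?\<Omega> \<G>"
      using E(1) by (rule sigma_sets_countable_generator)
    have "\<exists>f. \<forall>G\<in>\<G> - \<H>. f G \<in> sets (loeb \<omega> X {1..r}) \<and> (\<exists>e. G = pre {1..Suc r} {1..r} e (f G) \<and> coord_inj {1..r} {1..Suc r} e)"
    proof (rule bchoice, rule ballI)
      fix G
      assume "G \<in> \<G> - \<H>"
      then have "G \<in> V (sets (loeb \<omega> X {1..r}))"
        using \<G>(2) by blast
      then show "\<exists>D. D \<in> sets (loeb \<omega> X {1..r}) \<and> (\<exists>e. G = pre {1..Suc r} {1..r} e D \<and> coord_inj {1..r} {1..Suc r} e)"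
        unfolding V_def by blast
    qed
    then obtain f where f: "\<And>G. G \<in> \<G> - \<H> \<Longrightarrow> f G \<in> sets (loeb \<omega> X {1..r})"
      "\<And>G. G \<in> \<G> - \<H> \<Longrightarrow> \<exists>e. G = pre {1..Suc r} {1..r} e (f G) \<and> coord_inj {1..r} {1..Suc r} e"
      by blast
    have "\<G> \<subseteq> V (f ` (\<G> - \<H>)) \<union> \<H>"
      using f(2) unfolding V_def by blast
    then have "E \<in> sigma_sets ?\<Omega> (V (f ` (\<G> - \<H>)) \<union> \<H>)"
      using \<G>(3) sigma_sets_mono'[of \<G> _ ?\<Omega>] by blast
    moreover have "countable (f ` (\<G> - \<H>))"
      using \<G>(1) by simp
    ultimately show ?thesis
      using f(1) E(2) by (intro exI[of _ "f ` (\<G> - \<H>)"]) blast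
  qed
  then have "\<exists>\<D>. \<forall>n. countable (\<D> n) \<and> \<D> n \<subseteq> sets (loeb \<omega> X {1..r}) \<and>
      (\<exists>E\<in>sigma_sets ?\<Omega> (V (\<D> n) \<union> \<H>). AE x in ?M. x \<in> E \<longleftrightarrow> x \<in> c n)"
    by (intro choice allI)
  then obtain \<D> where "\<forall>n. countable (\<D> n) \<and> \<D> n \<subseteq> sets (loeb \<omega> X {1..r}) \<and>
      (\<exists>E\<in>sigma_sets ?\<Omega> (V (\<D> n) \<union> \<H>). AE x in ?M. x \<in> E \<longleftrightarrow> x \<in> c n)"
    by (rule exE)
  then have \<D>: "\<And>n. countable (\<D> n)" "\<And>n. \<D> n \<subseteq> sets (loeb \<omega> X {1..r})"
    "\<And>n. \<exists>E\<in>sigma_sets ?\<Omega> (V (\<D> n) \<union> \<H>). AE x in ?M. x \<in> E \<longleftrightarrow> x \<in> c n"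
    by simp_all
  define D' where "D' = (\<Union>n. \<D> n)"
  have "\<exists>E\<in>sigma_sets ?\<Omega> (V D' \<union> \<H>). AE x in ?M. x \<in> E \<longleftrightarrow> x \<in> C" if C: "C \<in> \<C>" for C
  proof -
    have "C \<in> range c"
      using C c by simp
    then obtain n where n: "C = c n"
      by blast
    have "V (\<D> n) \<union> \<H> \<subseteq> V D' \<union> \<H>"
      unfolding V_def D'_def by blast
    then show ?thesis
      unfolding n using \<D>(3)[of n] sigma_sets_mono'[of "V (\<D> n) \<union> \<H>" "V D' \<union> \<H>" ?\<Omega>] by blast
  qed
  moreover have "countable D'" "D' \<subseteq> sets (loeb \<omega> X {1..r})"
    using \<D>(1,2) by (auto simp: D'_def)
  ultimately show ?thesis
    using h(1) unfolding V_def \<H>_def by (intro exI[of _ h] exI[of _ D'] conjI ballI)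
qed

end

section \<open>The sigma-algebra generated by the symmetrized levels\<close>

context ordered_ultra_powers
begin

definition level_set :: "(nat \<Rightarrow> 'a upoint \<Rightarrow> real) \<Rightarrow> nat \<Rightarrow> real \<Rightarrow> 'a upoint set" where
  "level_set h j t = {x \<in> upower \<omega> X {1..j}. symmetrize j (h j) x \<le> t}"

definition level_gens :: "nat \<Rightarrow> (nat \<Rightarrow> 'a upoint \<Rightarrow> real) \<Rightarrow> 'a upoint set set" where
  "level_gens r h = {pre {1..r} {1..j} e (level_set h j t) | j e t. 1 \<le> j \<and> coord_inj {1..j} {1..r} e}"

text \<open>Null sets are added so that changes almost everywhere do not lead out of the
  sigma-algebra. Its members are the sets that the realization will be able to express.\<close>

definition level_sigma :: "nat \<Rightarrow> (nat \<Rightarrow> 'a upoint \<Rightarrow> real) \<Rightarrow> 'a upoint measure" where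
  "level_sigma r h = sigma (upower \<omega> X {1..r}) (level_gens r h \<union> null_sets (loeb \<omega> X {1..r}))"

definition good_levels :: "nat \<Rightarrow> (nat \<Rightarrow> 'a upoint \<Rightarrow> real) \<Rightarrow> bool" where
  "good_levels r h \<longleftrightarrow> (\<forall>j\<in>{1..r}. level_uniform j (h j))"

lemma level_gens_Pow: "level_gens r h \<union> null_sets (loeb \<omega> X {1..r}) \<subseteq> Pow (upower \<omega> X {1..r})"
  using pre_subset null_sets_loeb[of "{1..r}"] by (auto simp: level_gens_def dest: subsetD[OF pre_subset])

lemma sets_level_sigma:
  "sets (level_sigma r h) = sigma_sets (upower \<omega> X {1..r}) (level_gens r h \<union> null_sets (loeb \<omega> X {1..r}))"
  unfolding level_sigma_def by (rule sets_measure_of[OF level_gens_Pow])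

lemma space_level_sigma: "space (level_sigma r h) = upower \<omega> X {1..r}"
  unfolding level_sigma_def by (rule space_measure_of[OF level_gens_Pow])

lemma level_set_sets:
  assumes "1 \<le> j" "level_uniform j (h j)"
  shows "level_set h j t \<in> sets (loeb \<omega> X {1..j})"
  using level_sets_measurable[OF level_uniform_symmetrize[OF assms], of "{..t}"] by (simp add: level_set_def)

lemma level_sigma_sets_loeb:
  assumes "good_levels r h"
  shows "sets (level_sigma r h) \<subseteq> sets (loeb \<omega> X {1..r})"
proof -
  have "level_gens r h \<subseteq> sets (loeb \<omega> X {1..r})"
  proof
    fix G
    assume "G \<in> level_gens r h"
    then obtain j e t where G: "G = pre {1..r} {1..j} e (level_set h j t)" "1 \<le> j" "coord_inj {1..j} {1..r} e"
      by (auto simp: level_gens_def)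
    then have "level_uniform j (h j)"
      using assms coord_inj_le[OF G(3)] by (simp add: good_levels_def)
    then show "G \<in> sets (loeb \<omega> X {1..r})"
      unfolding G(1) using G(2,3) by (intro pre_in_sets level_set_sets)
  qed
  then have "level_gens r h \<union> null_sets (loeb \<omega> X {1..r}) \<subseteq> sets (loeb \<omega> X {1..r})"
    by auto
  from sets.sigma_sets_subset[OF this] show ?thesis
    by (simp add: sets_level_sigma)
qed

lemma level_sigma_null: "N \<in> null_sets (loeb \<omega> X {1..r}) \<Longrightarrow> N \<in> sets (level_sigma r h)"
  by (simp add: sets_level_sigma)

lemma level_sigma_AE:
  assumes good: "good_levels r h" and M: "M \<in> sets (level_sigma r h)" and N: "N \<in> sets (loeb \<omega> X {1..r})"
    and ae: "AE x in loeb \<omega> X {1..r}. x \<in> M \<longleftrightarrow> x \<in> N"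
  shows "N \<in> sets (level_sigma r h)"
proof -
  have MM: "M \<in> sets (loeb \<omega> X {1..r})"
    using M level_sigma_sets_loeb[OF good] by blast
  have "M - N \<in> null_sets (loeb \<omega> X {1..r})" "N - M \<in> null_sets (loeb \<omega> X {1..r})"
    using MM N ae by (auto simp: AE_iff_null_sets elim: eventually_mono)
  then have "(M - (M - N)) \<union> (N - M) \<in> sets (level_sigma r h)"
    by (intro sets.Un[OF sets.Diff[OF M]] level_sigma_null)
  also have "(M - (M - N)) \<union> (N - M) = N"
    by auto
  finally show ?thesis .
qed

text \<open>Reindexing a generator composes the injections. Only the levels up to \<open>r\<close>
  enter, so \<open>h'\<close> may extend \<open>h\<close> by a new level, as the recursion
  requires.\<close>

lemma level_sigma_pre:
  assumes e: "coord_inj {1..r} {1..s} e" and eq: "\<And>j. j \<in> {1..r} \<Longrightarrow> h' j = h j" and M: "M \<in> sets (level_sigma r h)"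
  shows "pre {1..s} {1..r} e M \<in> sets (level_sigma s h')"
proof -
  have im: "e ` {1..r} \<subseteq> {1..s}"
    using e by (simp add: coord_inj_def)
  from M have "M \<in> sigma_sets (upower \<omega> X {1..r}) (level_gens r h \<union> null_sets (loeb \<omega> X {1..r}))"
    by (simp add: sets_level_sigma)
  then show ?thesis
  proof induction
    case (Basic G)
    then consider "G \<in> level_gens r h" | "G \<in> null_sets (loeb \<omega> X {1..r})"
      by blast
    then show ?case
    proof cases
      case 1
      then obtain j e' t where G: "G = pre {1..r} {1..j} e' (level_set h j t)" "1 \<le> j" "coord_inj {1..j} {1..r} e'"
        by (auto simp: level_gens_def)
      have "level_set h' j t = level_set h j t"
        using eq[of j] coord_inj_le[OF G(3)] G(2) by (simp add: level_set_def)
      moreover have "pre {1..s} {1..r} e G = pre {1..s} {1..j} (\<lambda>i. e (e' i)) (level_set h j t)"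
        unfolding G(1) using G(3) im by (intro pre_pre) (auto simp: coord_inj_def)
      ultimately have "pre {1..s} {1..r} e G \<in> level_gens s h'"
        unfolding level_gens_def using coord_inj_comp[OF G(3) e] G(2) by (metis (mono_tags, lifting) mem_Collect_eq)
      then show ?thesis
        by (simp add: sets_level_sigma)
    next
      case 2
      then show ?thesis
        by (intro level_sigma_null pre_null_sets[OF e])
    qed
  next
    case Empty
    then show ?case
      by (simp add: pre_def)
  next
    case (Compl a)
    have "pre {1..s} {1..r} e (upower \<omega> X {1..r} - a) = space (level_sigma s h') - pre {1..s} {1..r} e a"
      using pull_upower[OF im] by (auto simp: pre_def space_level_sigma)
    then show ?case
      using Compl by auto
  next
    case (Union a)
    have "pre {1..s} {1..r} e (\<Union>i. a i) = (\<Union>i. pre {1..s} {1..r} e (a i))"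
      by (auto simp: pre_def)
    then show ?case
      using Union by auto
  qed
qed

lemma symmetrize_level_sigma:
  assumes "1 \<le> r"
  shows "symmetrize r (h r) \<in> borel_measurable (level_sigma r h)"
  unfolding borel_measurable_iff_le
proof
  fix t
  have "{x \<in> space (level_sigma r h). symmetrize r (h r) x \<le> t} = level_set h r t"
    by (simp add: space_level_sigma level_set_def)
  also have "\<dots> = pre {1..r} {1..r} (\<lambda>j. j) (level_set h r t)"
    by (rule pre_id[symmetric]) (auto simp: level_set_def)
  also have "\<dots> \<in> level_gens r h"
    unfolding level_gens_def using assms coord_inj_id[of "{1..r}" "{1..r}"] by blast
  finally show "{x \<in> space (level_sigma r h). symmetrize r (h r) x \<le> t} \<in> sets (level_sigma r h)"
    by (simp add: sets_level_sigma)
qed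

text \<open>Each step of the induction adds one level \<open>hs\<close>; the work lies in showing
  that nothing is lost when \<open>hs\<close> is replaced by its symmetrization.\<close>

lemma levels_exist:
  "countable \<C> \<Longrightarrow> \<C> \<subseteq> sets (loeb \<omega> X {1..r}) \<Longrightarrow> \<exists>h. good_levels r h \<and> \<C> \<subseteq> sets (level_sigma r h)"
proof (induction r arbitrary: \<C>)
  case 0
  \<comment> \<open>The power over the empty index set is a single point, so only the two trivial
    sets occur.\<close>
  have "C \<in> sets (level_sigma 0 (\<lambda>_ _. 0))" if C: "C \<in> \<C>" for C
  proof -
    have "x = y" if x: "x \<in> upower \<omega> X {1..0}" and y: "y \<in> upower \<omega> X {1..0}" for x y
    proof -
      obtain f where f: "x = cls f" "eventually (\<lambda>i. f i \<in> fpower X {1..0} i) \<omega>"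
        using x unfolding upower_def by (rule ultraproductE)
      obtain g where g: "y = cls g" "eventually (\<lambda>i. g i \<in> fpower X {1..0} i) \<omega>"
        using y unfolding upower_def by (rule ultraproductE)
      show ?thesis
        unfolding f(1) g(1) cls_eq_iff using f(2) g(2) by eventually_elim (simp add: fpower_def)
    qed
    moreover have "C \<subseteq> upower \<omega> X {1..0}"
      using 0(2) C sets.sets_into_space[of C "loeb \<omega> X {1..0}"] by auto
    ultimately have "C = {} \<or> C = upower \<omega> X {1..0}"
      by blast
    then show ?thesis
      using sets.top[of "level_sigma 0 (\<lambda>_ _. 0)"] unfolding space_level_sigma by auto
  qed
  then show ?case
    by (intro exI[of _ "\<lambda>_ _. 0"]) (auto simp: good_levels_def)
next
  case (Suc r)
  let ?s = "Suc r"
  let ?A = "{1..?s}" and ?M = "loeb \<omega> X {1..?s}" and ?\<Omega> = "upower \<omega> X {1..?s}"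
  \<comment> \<open>On the tile sorted by \<open>\<pi>\<close>, the set \<open>C\<close> is the
    pull-back along \<open>\<pi>\<close> of the sorted part of its copy under the inverse of
    \<open>\<pi>\<close>; hence all permuted copies must be generated.\<close>
  define \<C>' where "\<C>' = (\<lambda>(\<pi>, C). pre ?A ?A \<pi> C) ` ({\<pi>. \<pi> permutes ?A} \<times> \<C>)"
  have "countable \<C>'"
    unfolding \<C>'_def using Suc.prems(1) by (intro countable_image countable_SIGMA) (simp_all add: countable_finite finite_permutations)
  moreover have "\<C>' \<subseteq> sets ?M"
    unfolding \<C>'_def using Suc.prems(2) by (auto intro!: pre_in_sets coord_inj_permutes)
  ultimately obtain hs \<D> where hs: "level_uniform ?s hs" and \<D>: "countable \<D>" "\<D> \<subseteq> sets (loeb \<omega> X {1..r})"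
    and step: "\<And>C. C \<in> \<C>' \<Longrightarrow> \<exists>E\<in>sigma_sets ?\<Omega>
        ({pre ?A {1..r} e D | D e. D \<in> \<D> \<and> coord_inj {1..r} ?A e} \<union> {{x \<in> ?\<Omega>. hs x \<in> I} | I. I \<in> sets borel}).
      AE x in ?M. x \<in> E \<longleftrightarrow> x \<in> C"
    using level_step[of \<C>' r] by blast
  define U where "U q = pre {1..r} {1..1} (\<lambda>_. 1) {y \<in> upower \<omega> X {1..1}. u y \<in> {..<q}}" for q :: real
  \<comment> \<open>The rational cuts of \<open>u\<close> at one coordinate make the sorted set
    expressible by the lower levels. For \<open>r = 0\<close> there is no coordinate to cut at, and
    every point of the first power is sorted.\<close>
  define \<D>' where "\<D>' = \<D> \<union> (if 1 \<le> r then U ` \<rat> else {})"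
  have U: "U q \<in> sets (loeb \<omega> X {1..r})" if "1 \<le> r" for q
    unfolding U_def using that by (intro pre_in_sets coord_inj_const level_sets_measurable[OF u]) auto
  have "countable \<D>'" "\<D>' \<subseteq> sets (loeb \<omega> X {1..r})"
    using \<D> U countable_rat by (auto simp: \<D>'_def)
  then obtain h0 where h0: "good_levels r h0" "\<D>' \<subseteq> sets (level_sigma r h0)"
    using Suc.IH by blast
  define h where "h = h0(?s := hs)"
  have eq: "h j = h0 j" if "j \<in> {1..r}" for j
    using that by (simp add: h_def)
  have good: "good_levels ?s h"
    using h0(1) hs by (auto simp: good_levels_def h_def le_Suc_eq)
  let ?G = "level_sigma ?s h"
  have lift: "pre ?A {1..r} e D \<in> sets ?G" if "D \<in> \<D>'" "coord_inj {1..r} ?A e" for D e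
    using that h0(2) by (intro level_sigma_pre[OF that(2) eq]) auto
  have W: "sorted_points ?s \<in> sets ?G"
  proof (cases "1 \<le> r")
    case True
    show ?thesis
    proof (rule sorted_points_in_sigma_algebra[OF space_level_sigma])
      fix a
      assume a: "a \<in> ?A"
      \<comment> \<open>The transposition only serves as an injection into the larger index set that
        sends 1 to \<open>a\<close>.\<close>
      define e where "e = Transposition.transpose 1 a"
      have e: "coord_inj {1..r} ?A e" "e 1 = a"
        using a True inj_transpose[of 1 a] by (auto simp: coord_inj_def e_def inj_on_subset Transposition.transpose_def)
      have lt: "{x \<in> ?\<Omega>. val a x < q} \<in> sets ?G" if "q \<in> \<rat>" for q
      proof -
        have "pre ?A {1..r} e (U q) \<in> sets ?G"
          using that True by (intro lift e) (simp add: \<D>'_def)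
        also have "pre ?A {1..r} e (U q) = pre ?A {1..1} (\<lambda>_. a) {y \<in> upower \<omega> X {1..1}. u y \<in> {..<q}}"
          unfolding U_def using e True by (subst pre_pre) (auto simp: coord_inj_def)
        also have "\<dots> = {x \<in> ?\<Omega>. val a x < q}"
          using val_vimage[OF a, of "{..<q}"] by simp
        finally show ?thesis .
      qed
      show "val a \<in> borel_measurable ?G"
        unfolding borel_measurable_iff_less
      proof
        fix t
        have "{x \<in> space ?G. val a x < t} = (\<Union>q\<in>{q \<in> \<rat>. q < t}. {x \<in> ?\<Omega>. val a x < q})"
        proof (intro set_eqI iffI)
          fix x
          assume x: "x \<in> {x \<in> space ?G. val a x < t}"
          then obtain q where "q \<in> \<rat>" "val a x < q" "q < t"
            using Rats_dense_in_real[of "val a x" t] by auto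
          then show "x \<in> (\<Union>q\<in>{q \<in> \<rat>. q < t}. {x \<in> ?\<Omega>. val a x < q})"
            using x by (auto simp: space_level_sigma)
        qed (auto simp: space_level_sigma)
        moreover have "(\<Union>q\<in>{q \<in> \<rat>. q < t}. {x \<in> ?\<Omega>. val a x < q}) \<in> sets ?G"
          using lt countable_rat by (intro sets.countable_UN') (auto intro: countable_subset)
        ultimately show "{x \<in> space ?G. val a x < t} \<in> sets ?G"
          by simp
      qed
    qed
  next
    case False
    then have "sorted_points ?s = space ?G"
      unfolding space_level_sigma by (auto simp: sorted_points_def)
    then show ?thesis
      using sets.top[of ?G] by simp
  qed
  \<comment> \<open>On sorted points \<open>hs\<close> agrees with its symmetrization, so the trace
    of \<open>E\<close> on the sorted set can be expressed even where \<open>E\<close> cannot. The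
    generation of \<open>E\<close> is repeated with traces.\<close>
  have EW: "E \<inter> sorted_points ?s \<in> sets ?G"
    if "E \<in> sigma_sets ?\<Omega> ({pre ?A {1..r} e D | D e. D \<in> \<D> \<and> coord_inj {1..r} ?A e} \<union> {{x \<in> ?\<Omega>. hs x \<in> I} | I. I \<in> sets borel})" for E
    using that
  proof induction
    case (Basic E)
    then consider D e where "E = pre ?A {1..r} e D" "D \<in> \<D>" "coord_inj {1..r} ?A e"
      | I where "E = {x \<in> ?\<Omega>. hs x \<in> I}" "I \<in> sets borel"
      by blast
    then show ?case
    proof cases
      case 1
      then show ?thesis
        using lift[of D e] W by (simp add: \<D>'_def)
    next
      case 2
      have "E \<inter> sorted_points ?s = {x \<in> space ?G. symmetrize ?s (h ?s) x \<in> I} \<inter> sorted_points ?s"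
        unfolding 2(1) space_level_sigma using symmetrize_on_sorted by (auto simp: h_def)
      moreover have "{x \<in> space ?G. symmetrize ?s (h ?s) x \<in> I} \<in> sets ?G"
        using measurable_sets[OF symmetrize_level_sigma[of ?s h] 2(2)] by (simp add: vimage_def Collect_conj_eq Int_commute)
      ultimately show ?thesis
        using W by auto
    qed
  next
    case Empty
    then show ?case
      by simp
  next
    case (Compl E)
    have "(?\<Omega> - E) \<inter> sorted_points ?s = sorted_points ?s - E \<inter> sorted_points ?s"
      by (auto simp: sorted_points_def)
    then show ?case
      using Compl W by auto
  next
    case (Union E)
    have eq: "(\<Union>i. E i) \<inter> sorted_points ?s = (\<Union>i. E i \<inter> sorted_points ?s)"
      by blast
    show ?case
      unfolding eq using Union.IH by (intro sets.countable_UN) blast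
  qed
  have "C \<in> sets ?G" if C: "C \<in> \<C>" for C
  proof -
    have CM: "C \<in> sets ?M" and C_sub: "C \<subseteq> ?\<Omega>"
      using C Suc.prems(2) sets.sets_into_space[of C ?M] by auto
    have piece: "C \<inter> pre ?A ?A \<pi> (sorted_points ?s) \<in> sets ?G" if \<pi>: "\<pi> permutes ?A" for \<pi>
    proof -
      have "pre ?A ?A (inv \<pi>) C \<in> \<C>'"
        unfolding \<C>'_def using C permutes_inv[OF \<pi>] by force
      from step[OF this] obtain E where E: "E \<inter> sorted_points ?s \<in> sets ?G"
        "AE x in ?M. x \<in> E \<longleftrightarrow> x \<in> pre ?A ?A (inv \<pi>) C"
        using EW by blast
      have "pre ?A ?A (inv \<pi>) C \<inter> sorted_points ?s \<in> sets ?G"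
      proof (rule level_sigma_AE[OF good E(1)])
        show "pre ?A ?A (inv \<pi>) C \<inter> sorted_points ?s \<in> sets ?M"
          using sorted_points_sets[of ?s] pre_in_sets[OF coord_inj_permutes[OF permutes_inv[OF \<pi>]] CM] by auto
        show "AE x in ?M. x \<in> E \<inter> sorted_points ?s \<longleftrightarrow> x \<in> pre ?A ?A (inv \<pi>) C \<inter> sorted_points ?s"
          using E(2) by eventually_elim simp
      qed
      then have "pre ?A ?A \<pi> (pre ?A ?A (inv \<pi>) C \<inter> sorted_points ?s) \<in> sets ?G"
        by (rule level_sigma_pre[OF coord_inj_permutes[OF \<pi>] refl])
      then show ?thesis
        by (simp only: pre_Int pre_permutes_inv(1)[OF \<pi> C_sub])
    qed
    have "(\<Union>\<pi>\<in>{\<pi>. \<pi> permutes ?A}. C \<inter> pre ?A ?A \<pi> (sorted_points ?s)) \<in> sets ?G"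
      using piece by (intro sets.finite_UN finite_permutations) auto
    then show ?thesis
    proof (rule level_sigma_AE[OF good _ CM])
      show "AE x in ?M. x \<in> (\<Union>\<pi>\<in>{\<pi>. \<pi> permutes ?A}. C \<inter> pre ?A ?A \<pi> (sorted_points ?s)) \<longleftrightarrow> x \<in> C"
        using AE_sortable[of ?s] AE_space by eventually_elim (auto simp: pre_def)
    qed
  qed
  then show ?case
    using good by blast
qed

end

section \<open>Separable realizations\<close>

lemma distr_uniform_over:
  assumes "prob_space M" "subalgebra M F" and h: "uniform_over M F h"
  shows "distr M borel h = uniform_measure lborel {0..1}"
proof (rule cdf_unique)
  interpret prob_space M by fact
  have hM [measurable]: "h \<in> borel_measurable M" and bounds: "\<And>x. x \<in> space M \<Longrightarrow> h x \<in> {0..1}"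
    and meas: "\<And>t. t \<in> {0..1} \<Longrightarrow> prob ({x \<in> space M. h x \<le> t} \<inter> space M) = t * prob (space M)"
    using h assms(2) sets.top[of F] by (auto simp: uniform_over_def subalgebra_def)
  show "real_distribution (distr M borel h)"
    by (rule real_distribution_distr) (rule hM)
  interpret U: prob_space "uniform_measure lborel {0..1 :: real}"
    by (rule prob_space_uniform_measure) auto
  show "real_distribution (uniform_measure lborel {0..1 :: real})"
    by unfold_locales auto
  show "cdf (distr M borel h) = cdf (uniform_measure lborel {0..1})"
  proof
    fix t :: real
    have "cdf (distr M borel h) t = prob {x \<in> space M. h x \<le> t}"
      by (simp add: cdf_def measure_distr vimage_def Int_def conj_commute)
    also have "\<dots> = max 0 (min 1 t)"
    proof -
      consider "t < 0" | "0 \<le> t" "t \<le> 1" | "1 < t"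
        by linarith
      then show ?thesis
      proof cases
        case 1
        then have eq: "{x \<in> space M. h x \<le> t} = {}"
          using bounds by fastforce
        show ?thesis
          unfolding eq using 1 by simp
      next
        case 2
        have "{x \<in> space M. h x \<le> t} \<inter> space M = {x \<in> space M. h x \<le> t}"
          by auto
        then show ?thesis
          using meas[of t] 2 by (simp add: prob_space)
      next
        case 3
        then have eq: "{x \<in> space M. h x \<le> t} = space M"
          using bounds by fastforce
        show ?thesis
          unfolding eq using 3 by (simp add: prob_space)
      qed
    qed
    also have "\<dots> = measure lborel ({0..1} \<inter> {..t})"
    proof -
      have "{0..1} \<inter> {..t} = {0..min 1 t}"
        by auto
      then show ?thesis
        by (cases "0 \<le> min 1 t") auto
    qed
    also have "\<dots> = cdf (uniform_measure lborel {0..1}) t"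
      by (simp add: cdf_def)
    finally show "cdf (distr M borel h) t = cdf (uniform_measure lborel {0..1}) t" .
  qed
qed

text \<open>The Dynkin argument with exchanged roles: \<open>G\<close> is fixed, and the sublevel
  sets of \<open>h\<close> form the intersection-stable generator.\<close>

lemma uniform_over_borel:
  assumes M: "prob_space M" and F: "subalgebra M F" and h: "uniform_over M F h"
    and I: "I \<in> sets borel" and G: "G \<in> sets F"
  shows "measure M ({x \<in> space M. h x \<in> I} \<inter> G) = measure lborel ({0..1} \<inter> I) * measure M G"
proof -
  interpret prob_space M by fact
  have hM [measurable]: "h \<in> borel_measurable M"
    using h by (simp add: uniform_over_def)
  have meas: "\<And>t G. t \<in> {0..1} \<Longrightarrow> G \<in> sets F \<Longrightarrow> prob ({x \<in> space M. h x \<le> t} \<inter> G) = t * prob G"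
    and le1: "\<And>x. x \<in> space M \<Longrightarrow> h x \<le> 1" and ge0: "\<And>x. x \<in> space M \<Longrightarrow> 0 \<le> h x"
    using h by (auto simp: uniform_over_def)
  have GM: "G \<in> events" and spF: "space M \<in> sets F"
    using G F sets.top[of F] by (auto simp: subalgebra_def)
  define L where "L t = {x \<in> space M. h x \<le> t}" for t
  define \<G> where "\<G> = L ` {0..1}"
  have "prob (G \<inter> {x \<in> space M. h x \<in> I}) = prob G * prob (space M \<inter> {x \<in> space M. h x \<in> I})"
  proof (rule prob_proportional_sigma_sets[where \<G> = \<G>])
    show "Int_stable \<G>"
    proof (rule Int_stableI)
      fix A B
      assume "A \<in> \<G>" "B \<in> \<G>"
      then obtain s t where "s \<in> {0..1}" "t \<in> {0..1}" "A = L s" "B = L t"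
        by (auto simp: \<G>_def)
      then have "A \<inter> B = L (min s t)" "min s t \<in> {0..1}"
        by (auto simp: L_def)
      then show "A \<inter> B \<in> \<G>"
        by (auto simp: \<G>_def)
    qed
    show "\<G> \<subseteq> events"
      unfolding \<G>_def L_def by auto
    have "L 1 = space M"
      using le1 by (auto simp: L_def)
    then show "space M \<in> \<G>"
      unfolding \<G>_def by (metis atLeastAtMost_iff imageI order_refl zero_le_one)
    show "prob (G \<inter> A) = prob G * prob (space M \<inter> A)" if "A \<in> \<G>" for A
    proof -
      obtain t where t: "t \<in> {0..1}" "A = L t"
        using \<open>A \<in> \<G>\<close> by (auto simp: \<G>_def)
      have "prob (G \<inter> A) = t * prob G" "prob (space M \<inter> A) = t"
        using meas[OF t(1) G] meas[OF t(1) spF] t(2) by (simp_all add: L_def Int_commute prob_space)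
      then show ?thesis
        by simp
    qed
    have "L t \<in> sigma_sets (space M) \<G>" for t
    proof -
      consider "t < 0" | "t \<in> {0..1}" | "1 < t"
        by fastforce
      then show ?thesis
      proof cases
        case 1
        then have "L t = {}"
          using ge0 by (fastforce simp: L_def)
        then show ?thesis
          by (simp add: sigma_sets.Empty)
      next
        case 2
        then show ?thesis
          by (auto simp: \<G>_def)
      next
        case 3
        then have "L t = space M"
          using le1 by (fastforce simp: L_def)
        then show ?thesis
          by (simp add: sigma_sets_top)
      qed
    qed
    moreover have pow: "\<G> \<subseteq> Pow (space M)"
      by (auto simp: \<G>_def L_def)
    ultimately have "h \<in> borel_measurable (sigma (space M) \<G>)"
      unfolding borel_measurable_iff_le by (simp add: L_def sets_measure_of space_measure_of)
    from measurable_sets[OF this I] have "h -` I \<inter> space M \<in> sigma_sets (space M) \<G>"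
      using pow by (simp add: sets_measure_of space_measure_of)
    moreover have "h -` I \<inter> space M = {x \<in> space M. h x \<in> I}"
      by auto
    ultimately show "{x \<in> space M. h x \<in> I} \<in> sigma_sets (space M) \<G>"
      by simp
  qed (use GM in auto)
  moreover have "prob (space M \<inter> {x \<in> space M. h x \<in> I}) = measure lborel ({0..1} \<inter> I)"
  proof -
    have "prob (space M \<inter> {x \<in> space M. h x \<in> I}) = measure (distr M borel h) I"
      using I by (simp add: measure_distr vimage_def Int_def conj_commute)
    also have "\<dots> = measure lborel ({0..1} \<inter> I)"
      using I by (simp add: distr_uniform_over[OF M F h])
    finally show ?thesis .
  qed
  ultimately show ?thesis
    by (simp add: Int_commute mult.commute)
qed

text \<open>A Lebesgue set is a Borel set together with part of a Borel null set. The preimage of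
  the latter is null, so completeness of \<open>M\<close> makes the whole preimage measurable; the
  constant is the length of the Borel part within the unit interval.\<close>

lemma uniform_over_lebesgue:
  assumes M: "prob_space M" "complete_measure M" and F: "subalgebra M F" and h: "uniform_over M F h"
    and I: "I \<in> sets lebesgue"
  obtains c where "{x \<in> space M. h x \<in> I} \<in> sets M"
    "\<And>G. G \<in> sets F \<Longrightarrow> measure M ({x \<in> space M. h x \<in> I} \<inter> G) = c * measure M G"
proof -
  interpret prob_space M by fact
  interpret complete_measure M by fact
  have hM [measurable]: "h \<in> borel_measurable M"
    using h by (simp add: uniform_over_def)
  obtain S N N' where I_eq: "I = S \<union> N" and N: "N \<subseteq> N'" "N' \<in> null_sets lborel" and S: "S \<in> sets lborel"
    using I by (rule sets_completionE)
  have N'b: "N' \<in> sets borel" and Sb [measurable]: "S \<in> sets borel"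
    using N S by (auto simp: null_sets_def)
  have "measure lborel ({0..1} \<inter> N') = 0"
    using null_set_Int1[OF N(2), of "{0..1}"] by (simp add: Int_commute measure_eq_0_null_sets)
  moreover have "space M \<in> sets F"
    using F sets.top[of F] by (simp add: subalgebra_def)
  ultimately have "prob ({x \<in> space M. h x \<in> N'} \<inter> space M) = 0"
    using uniform_over_borel[OF M(1) F h N'b] by simp
  moreover have "{x \<in> space M. h x \<in> N'} \<inter> space M = {x \<in> space M. h x \<in> N'}"
    by auto
  moreover have "{x \<in> space M. h x \<in> N'} \<in> events"
    using N'b by measurable
  ultimately have null': "{x \<in> space M. h x \<in> N'} \<in> null_sets M"
    by (simp add: null_sets_def emeasure_eq_measure)
  have null: "{x \<in> space M. h x \<in> N} \<in> null_sets M"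
    by (rule complete2[OF _ null']) (use N in auto)
  have SM: "{x \<in> space M. h x \<in> S} \<in> events"
    by measurable
  have eq: "{x \<in> space M. h x \<in> I} = {x \<in> space M. h x \<in> S} \<union> {x \<in> space M. h x \<in> N}"
    by (auto simp: I_eq)
  have IM: "{x \<in> space M. h x \<in> I} \<in> events"
    unfolding eq using SM null by auto
  have ae: "AE x in M. x \<in> {x \<in> space M. h x \<in> I} \<longleftrightarrow> x \<in> {x \<in> space M. h x \<in> S}"
    by (rule AE_I'[OF null]) (auto simp: I_eq)
  show ?thesis
  proof (rule that[OF IM])
    fix G
    assume G: "G \<in> sets F"
    then have GM: "G \<in> events"
      using F by (auto simp: subalgebra_def)
    have "prob ({x \<in> space M. h x \<in> I} \<inter> G) = prob ({x \<in> space M. h x \<in> S} \<inter> G)"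
    proof (rule finite_measure_eq_AE)
      show "AE x in M. x \<in> {x \<in> space M. h x \<in> I} \<inter> G \<longleftrightarrow> x \<in> {x \<in> space M. h x \<in> S} \<inter> G"
        using ae by eventually_elim simp
    qed (use IM SM GM in auto)
    then show "prob ({x \<in> space M. h x \<in> I} \<inter> G) = measure lborel ({0..1} \<inter> S) * prob G"
      using uniform_over_borel[OF M(1) F h Sb G] by simp
  qed
qed

lemma independent_fromI:
  assumes M: "prob_space M" and F: "subalgebra M F" and P: "P \<in> sets M"
    and ind: "\<And>G. G \<in> sets F \<Longrightarrow> measure M (P \<inter> G) = c * measure M G"
  shows "independent_from M F P"
proof -
  interpret prob_space M by fact
  interpret finite_measure_subalgebra M F
    by unfold_locales fact
  have "AE x in M. real_cond_exp M F (indicator P) x = c"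
  proof (rule real_cond_exp_charact)
    fix A
    assume A: "A \<in> sets F"
    then have AM: "A \<in> events"
      using F by (auto simp: subalgebra_def)
    have "(\<integral>x\<in>A. indicator P x \<partial>M) = (\<integral>x. indicator (P \<inter> A) x \<partial>M :: real)"
      by (auto simp: set_lebesgue_integral_def indicator_def intro!: Bochner_Integration.integral_cong)
    also have "\<dots> = c * prob A"
      using ind[OF A] P AM sets.sets_into_space[OF P] by (simp add: Int_absorb2 le_infI1)
    also have "\<dots> = (\<integral>x\<in>A. c \<partial>M)"
      using AM by (simp add: set_integral_const mult.commute)
    finally show "(\<integral>x\<in>A. indicator P x \<partial>M) = (\<integral>x\<in>A. c \<partial>M)" .
  next
    show "integrable M (indicator P :: _ \<Rightarrow> real)"
      using P by (simp add: integrable_real_indicator less_top[symmetric])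
  qed simp_all
  then show ?thesis
    unfolding independent_from_def by blast
qed

section \<open>The realization, its equivariance and the joint law of its coordinates\<close>

context ordered_ultra_powers
begin

text \<open>An arbitrary enumeration; by the symmetry of the level functions the realization does
  not depend on the choice.\<close>

definition enum :: "nat set \<Rightarrow> nat \<Rightarrow> nat" where
  "enum D = (SOME e. bij_betw e {1..card D} D)"

definition realization :: "nat \<Rightarrow> (nat \<Rightarrow> 'a upoint \<Rightarrow> real) \<Rightarrow> 'a upoint \<Rightarrow> nat set \<Rightarrow> real" where
  "realization k h x = (\<lambda>D\<in>nonempty_subsets k.
     symmetrize (card D) (h (card D)) (pull {1..card D} (enum D) x))"

lemma bij_betw_enum: "finite D \<Longrightarrow> bij_betw (enum D) {1..card D} D"
  unfolding enum_def using ex_bij_betw_nat_finite_1 by (rule someI_ex)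

lemma nonempty_subsetsD:
  assumes "D \<in> nonempty_subsets k"
  shows "D \<subseteq> {1..k}" "D \<noteq> {}" "finite D" "1 \<le> card D" "card D \<le> k"
proof -
  show "D \<subseteq> {1..k}" "D \<noteq> {}" and fin: "finite D"
    using assms finite_subset[of D "{1..k}"] by (auto simp: nonempty_subsets_def)
  then show "1 \<le> card D" "card D \<le> k"
    using card_mono[of "{1..k}" D] card_gt_0_iff[of D] by auto
qed

lemma coord_inj_enum:
  assumes "D \<in> nonempty_subsets k"
  shows "coord_inj {1..card D} {1..k} (enum D)" "enum D ` {1..card D} = D"
  using bij_betw_enum[OF nonempty_subsetsD(3)[OF assms]] nonempty_subsetsD(1)[OF assms]
  by (auto simp: coord_inj_def bij_betw_def)

text \<open>\<open>e\<close> and the chosen enumeration of its image differ by a permutation of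
  \<open>{1..j}\<close>, which symmetrized functions ignore.\<close>

lemma symmetrize_pull_eq_realization:
  assumes e: "coord_inj {1..j} {1..k} e" and j: "1 \<le> j" and x: "x \<in> upower \<omega> X {1..k}"
  shows "symmetrize j (h j) (pull {1..j} e x) = realization k h x (e ` {1..j})"
proof -
  define D where "D = e ` {1..j}"
  have inj: "inj_on e {1..j}" "D \<subseteq> {1..k}"
    using e by (auto simp: coord_inj_def D_def)
  have cD: "card D = j"
    using inj by (simp add: D_def card_image)
  have D: "D \<in> nonempty_subsets k"
    using inj(2) j by (auto simp: nonempty_subsets_def D_def)
  define g where "g = enum D"
  have g: "bij_betw g {1..j} D"
    using bij_betw_enum[OF nonempty_subsetsD(3)[OF D]] by (simp add: cD g_def)
  define \<pi> where "\<pi> i = (if i \<in> {1..j} then inv_into {1..j} g (e i) else i)" for i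
  have "bij_betw (inv_into {1..j} g \<circ> e) {1..j} {1..j}"
    using inj(1) bij_betw_inv_into[OF g] by (intro bij_betw_trans[of e "{1..j}" D]) (auto simp: bij_betw_def D_def)
  then have "bij_betw \<pi> {1..j} {1..j}"
    by (rule bij_betw_cong[THEN iffD1, rotated]) (simp add: \<pi>_def)
  then have \<pi>: "\<pi> permutes {1..j}"
    by (rule bij_imp_permutes) (auto simp only: \<pi>_def if_False)
  have "g (\<pi> i) = e i" if "i \<in> {1..j}" for i
    using that bij_betw_inv_into_right[OF g, of "e i"] by (simp add: \<pi>_def D_def)
  then have "pull {1..j} e x = pull {1..j} (\<lambda>i. g (\<pi> i)) x"
    by (intro pull_cong) simp
  also have "\<dots> = pull {1..j} \<pi> (pull {1..j} g x)"
    using permutes_image[OF \<pi>] x by (intro pull_pull[symmetric]) auto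
  finally have "symmetrize j (h j) (pull {1..j} e x) = symmetrize j (h j) (pull {1..j} g x)"
    using symmetrize_pull[OF pull_upower \<pi>, of g "{1..k}" x "h j"] g inj(2) x by (simp add: bij_betw_def)
  then show ?thesis
    using D by (simp add: realization_def cD g_def D_def[symmetric])
qed

lemma realization_vimage:
  assumes D: "D \<in> nonempty_subsets k"
  shows "{x \<in> upower \<omega> X {1..k}. realization k h x D \<in> I}
    = pre {1..k} {1..card D} (enum D) {y \<in> upower \<omega> X {1..card D}. symmetrize (card D) (h (card D)) y \<in> I}"
  using D coord_inj_enum(1)[OF D] pull_upower[of "enum D" "{1..card D}" "{1..k}"]
  by (auto simp: realization_def pre_def coord_inj_def)

text \<open>\<open>\<pi>\<close> composed with the enumeration of \<open>D\<close> enumerates the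
  image of \<open>D\<close>, so equivariance amounts to independence of the enumeration.\<close>

lemma realization_perm:
  assumes \<pi>: "\<pi> permutes {1..k}" and x: "x \<in> upower \<omega> X {1..k}"
  shows "perm_cube k \<pi> (realization k h x) = realization k h (perm_point \<omega> k \<pi> x)"
proof
  fix D
  show "perm_cube k \<pi> (realization k h x) D = realization k h (perm_point \<omega> k \<pi> x) D"
  proof (cases "D \<in> nonempty_subsets k")
    case D: True
    note e = coord_inj_enum[OF D]
    have "perm_point \<omega> k \<pi> x = pull {1..k} \<pi> x"
      by (simp add: perm_point_def pull_def)
    then have "realization k h (perm_point \<omega> k \<pi> x) D
        = symmetrize (card D) (h (card D)) (pull {1..card D} (enum D) (pull {1..k} \<pi> x))"
      using D by (simp add: realization_def)
    also have "\<dots> = symmetrize (card D) (h (card D)) (pull {1..card D} (\<lambda>i. \<pi> (enum D i)) x)"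
      using e x by (subst pull_pull[of _ _ _ _ "{1..k}"]) (auto simp: coord_inj_def)
    also have "\<dots> = realization k h x ((\<lambda>i. \<pi> (enum D i)) ` {1..card D})"
      using coord_inj_comp[OF e(1) coord_inj_permutes[OF \<pi>]] nonempty_subsetsD(4)[OF D] x
      by (rule symmetrize_pull_eq_realization)
    also have "(\<lambda>i. \<pi> (enum D i)) ` {1..card D} = \<pi> ` D"
      by (subst (2) e(2)[symmetric]) (simp add: image_image)
    finally show ?thesis
      using D by (simp add: perm_cube_def)
  qed (simp add: perm_cube_def realization_def)
qed

lemma level_uniform_good:
  assumes "good_levels k h" "D \<in> nonempty_subsets k"
  shows "level_uniform (card D) (symmetrize (card D) (h (card D)))"
  using assms nonempty_subsetsD(4,5)[OF assms(2)] by (intro level_uniform_symmetrize) (auto simp: good_levels_def)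

text \<open>\<open>P\<close> is a pull-back from the power with \<open>card D\<close> factors along
  an enumeration of \<open>D\<close>, hence depends on \<open>D\<close> alone. No facet contains
  \<open>D\<close>, so independence carries over to the cylinders and from them to all of
  \<open>sigma_coord_star\<close>.\<close>

lemma realization_independent:
  assumes good: "good_levels k h" and D: "D \<in> nonempty_subsets k" and I: "I \<in> sets lebesgue"
  defines "P \<equiv> {x \<in> upower \<omega> X {1..k}. realization k h x D \<in> I}"
  shows "P \<in> sets (sigma_coord \<omega> X k D)"
    and "independent_from (loeb \<omega> X {1..k}) (sigma_coord_star \<omega> X k D) P"
proof -
  note Dk = nonempty_subsetsD[OF D] and e = coord_inj_enum[OF D]
  let ?A = "{1..card D}"
  let ?S = "{y \<in> upower \<omega> X ?A. symmetrize (card D) (h (card D)) y \<in> I}"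
  obtain c where S: "?S \<in> sets (loeb \<omega> X ?A)"
    and c: "\<And>G. G \<in> sets (star (card D)) \<Longrightarrow> measure (loeb \<omega> X ?A) (?S \<inter> G) = c * measure (loeb \<omega> X ?A) G"
    using uniform_over_lebesgue[OF prob_space_loeb complete_measure_loeb subalgebra_star[OF order_refl]
        level_uniform_good[OF good D] I] by auto
  have P: "P = pre {1..k} ?A (enum D) ?S"
    unfolding P_def by (rule realization_vimage[OF D])
  have eD: "coord_inj ?A D (enum D)"
    using e Dk by (auto simp: coord_inj_def)
  have "P = pre {1..k} D (\<lambda>j. j) (pre D ?A (enum D) ?S)"
    unfolding P using e(2) Dk(1) by (subst pre_pre) auto
  then show "P \<in> sets (sigma_coord \<omega> X k D)"
    using pre_in_sets[OF eD S] by (simp add: sets_sigma_coord[OF Dk(1)])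
  have PM: "P \<in> sets (loeb \<omega> X {1..k})"
    unfolding P by (rule pre_in_sets[OF e(1) S])
  show "independent_from (loeb \<omega> X {1..k}) (sigma_coord_star \<omega> X k D) P"
  proof (rule independent_fromI[OF prob_space_loeb subalgebra_star[OF Dk(1)] PM])
    fix G
    assume G: "G \<in> sets (sigma_coord_star \<omega> X k D)"
    have "measure (loeb \<omega> X {1..k}) (P \<inter> G) = c * measure (loeb \<omega> X {1..k}) (upower \<omega> X {1..k} \<inter> G)"
    proof (rule star_proportional[OF Dk(1) PM upower_in_sets _ G])
      fix H
      assume H: "\<And>B. B \<in> facets D \<Longrightarrow> H B \<in> sets (loeb \<omega> X B)"
      let ?Q = "{x \<in> upower \<omega> X {1..k}. \<forall>B\<in>facets D. x \<in> pre {1..k} B (\<lambda>j. j) (H B)}"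
      have "measure (loeb \<omega> X {1..k}) (pre {1..k} ?A (enum D) ?S \<inter> ?Q) = c * measure (loeb \<omega> X {1..k}) ?Q"
      proof (rule independent_of_other_coordinates[OF e(1) S c facets_finite[OF Dk(3)]])
        show "B \<subseteq> {1..k}" if "B \<in> facets D" for B
          using facets_subset[OF that] Dk(1) by simp
        show "\<not> enum D ` ?A \<subseteq> B" if "B \<in> facets D" for B
          using facet_proper[OF Dk(3,2) that] e(2) by simp
      qed (use H in auto)
      moreover have "?Q = upower \<omega> X {1..k} \<inter> (\<Inter>B\<in>facets D. pre {1..k} B (\<lambda>j. j) (H B))"
        by auto
      moreover have "pre {1..k} ?A (enum D) ?S \<inter> ?Q = P \<inter> (\<Inter>B\<in>facets D. pre {1..k} B (\<lambda>j. j) (H B))"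
        using pre_subset[of "{1..k}" ?A "enum D" ?S] unfolding P by auto
      ultimately show "measure (loeb \<omega> X {1..k}) (P \<inter> (\<Inter>B\<in>facets D. pre {1..k} B (\<lambda>j. j) (H B)))
          = c * measure (loeb \<omega> X {1..k}) (upower \<omega> X {1..k} \<inter> (\<Inter>B\<in>facets D. pre {1..k} B (\<lambda>j. j) (H B)))"
        by simp
    qed
    moreover have "upower \<omega> X {1..k} \<inter> G = G"
      using sets.sets_into_space[OF G] sets_sigma_coord_star(4)[OF Dk(1)] by auto
    ultimately show "measure (loeb \<omega> X {1..k}) (P \<inter> G) = c * measure (loeb \<omega> X {1..k}) G"
      by simp
  qed simp
qed

text \<open>A member \<open>D\<close> of maximal cardinality is split off: no other member contains
  it, so its coordinate is independent of the constraints imposed by all the others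
  together.\<close>

lemma realization_joint:
  assumes good: "good_levels k h" and "\<D> \<subseteq> nonempty_subsets k" and "\<And>D. D \<in> \<D> \<Longrightarrow> I D \<in> sets borel"
  shows "measure (loeb \<omega> X {1..k}) {x \<in> upower \<omega> X {1..k}. \<forall>D\<in>\<D>. realization k h x D \<in> I D}
    = (\<Prod>D\<in>\<D>. measure lborel ({0..1} \<inter> I D))"
  using assms(2,3)
proof (induction "card \<D>" arbitrary: \<D>)
  case 0
  have "finite \<D>"
    using 0(2) finite_subset[of \<D> "Pow {1..k}"] by (auto simp: nonempty_subsets_def)
  then have "\<D> = {}"
    using 0(1) by simp
  then show ?case
    using prob_space.prob_space[OF prob_space_loeb[of "{1..k}"]] by simp
next
  case (Suc n)
  have fin: "finite \<D>"
    using Suc(2) card.infinite by fastforce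
  have "\<D> \<noteq> {}"
    using Suc(2) by auto
  then have "Max (card ` \<D>) \<in> card ` \<D>"
    using fin by (intro Max_in) auto
  then obtain D where D: "D \<in> \<D>" "card D = Max (card ` \<D>)"
    by auto
  have max: "card E \<le> card D" if "E \<in> \<D>" for E
    using fin that D(2) by simp
  have Dn: "D \<in> nonempty_subsets k"
    using D(1) Suc.prems(1) by auto
  note Dk = nonempty_subsetsD[OF Dn] and e = coord_inj_enum[OF Dn]
  let ?J = "\<D> - {D}"
  let ?sy = "\<lambda>E. {y \<in> upower \<omega> X {1..card E}. symmetrize (card E) (h (card E)) y \<in> I E}"
  define G where "G E = pre E {1..card E} (enum E) (?sy E)" for E
  have J: "E \<in> nonempty_subsets k" "I E \<in> sets borel" if "E \<in> ?J" for E
    using that Suc.prems by auto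
  have G: "x \<in> pre {1..k} E (\<lambda>j. j) (G E) \<longleftrightarrow> x \<in> upower \<omega> X {1..k} \<and> realization k h x E \<in> I E" if "E \<in> ?J" for E x
  proof -
    note En = J(1)[OF that]
    have "pre {1..k} E (\<lambda>j. j) (G E) = pre {1..k} {1..card E} (enum E) (?sy E)"
      unfolding G_def using coord_inj_enum(2)[OF En] nonempty_subsetsD(1)[OF En] by (subst pre_pre) auto
    then show ?thesis
      using realization_vimage[OF En, of h "I E"] by blast
  qed
  have sy: "?sy E \<in> sets (loeb \<omega> X {1..card E})" if "E \<in> \<D>" for E
    using that Suc.prems by (intro level_sets_measurable level_uniform_good[OF good]) auto
  have "measure (loeb \<omega> X {1..k}) (pre {1..k} {1..card D} (enum D) (?sy D) \<inter>
        {x \<in> upower \<omega> X {1..k}. \<forall>E\<in>?J. x \<in> pre {1..k} E (\<lambda>j. j) (G E)})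
      = measure lborel ({0..1} \<inter> I D) * measure (loeb \<omega> X {1..k}) {x \<in> upower \<omega> X {1..k}. \<forall>E\<in>?J. x \<in> pre {1..k} E (\<lambda>j. j) (G E)}"
  proof (rule independent_of_other_coordinates[OF e(1) sy[OF D(1)]])
    show "measure (loeb \<omega> X {1..card D}) (?sy D \<inter> G) = measure lborel ({0..1} \<inter> I D) * measure (loeb \<omega> X {1..card D}) G"
      if "G \<in> sets (star (card D))" for G
      using uniform_over_borel[OF prob_space_loeb subalgebra_star[OF order_refl] level_uniform_good[OF good Dn] _ that]
        Suc.prems(2)[OF D(1)] by simp
    show "finite ?J"
      using fin by simp
    show "E \<subseteq> {1..k}" if "E \<in> ?J" for E
      using nonempty_subsetsD(1)[OF J(1)[OF that]] .
    show "\<not> enum D ` {1..card D} \<subseteq> E" if "E \<in> ?J" for E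
    proof
      assume "enum D ` {1..card D} \<subseteq> E"
      then have "D = E"
        using e(2) max[of E] that nonempty_subsetsD(3)[OF J(1)[OF that]] by (intro card_seteq) auto
      then show False
        using that by simp
    qed
    show "G E \<in> sets (loeb \<omega> X E)" if "E \<in> ?J" for E
    proof -
      have "coord_inj {1..card E} E (enum E)"
        using coord_inj_enum[OF J(1)[OF that]] nonempty_subsetsD(3)[OF J(1)[OF that]] by (auto simp: coord_inj_def)
      then show ?thesis
        unfolding G_def using that by (intro pre_in_sets sy) auto
    qed
  qed
  moreover have eq1: "{x \<in> upower \<omega> X {1..k}. \<forall>E\<in>?J. x \<in> pre {1..k} E (\<lambda>j. j) (G E)}
      = {x \<in> upower \<omega> X {1..k}. \<forall>E\<in>?J. realization k h x E \<in> I E}"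
    using G by blast
  moreover have "pre {1..k} {1..card D} (enum D) (?sy D) \<inter> {x \<in> upower \<omega> X {1..k}. \<forall>E\<in>?J. realization k h x E \<in> I E}
      = {x \<in> upower \<omega> X {1..k}. \<forall>D\<in>\<D>. realization k h x D \<in> I D}"
    unfolding realization_vimage[OF Dn, symmetric] using D(1) by auto
  ultimately have "measure (loeb \<omega> X {1..k}) {x \<in> upower \<omega> X {1..k}. \<forall>D\<in>\<D>. realization k h x D \<in> I D}
      = measure lborel ({0..1} \<inter> I D) * measure (loeb \<omega> X {1..k}) {x \<in> upower \<omega> X {1..k}. \<forall>E\<in>?J. realization k h x E \<in> I E}"
    by simp
  also have "measure (loeb \<omega> X {1..k}) {x \<in> upower \<omega> X {1..k}. \<forall>E\<in>?J. realization k h x E \<in> I E}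
      = (\<Prod>E\<in>?J. measure lborel ({0..1} \<inter> I E))"
    using Suc.prems Suc(2) D(1) by (intro Suc.hyps(1)) auto
  also have "measure lborel ({0..1} \<inter> I D) * (\<Prod>E\<in>?J. measure lborel ({0..1} \<inter> I E)) = (\<Prod>D\<in>\<D>. measure lborel ({0..1} \<inter> I D))"
    by (rule prod.remove[OF fin D(1), symmetric])
  finally show ?case .
qed

abbreviation unit_interval :: "real measure" where
  "unit_interval \<equiv> restrict_space lborel {0..1}"

lemma prob_space_unit_interval: "prob_space unit_interval"
  by (rule prob_spaceI) (simp add: space_restrict_space emeasure_restrict_space)

lemma finite_nonempty_subsets: "finite (nonempty_subsets k)"
  by (rule finite_subset[of _ "Pow {1..k}"]) (auto simp: nonempty_subsets_def)

lemma realization_measurable: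
  assumes good: "good_levels k h"
  shows "realization k h \<in> measurable (loeb \<omega> X {1..k}) (PiM (nonempty_subsets k) (\<lambda>_. unit_interval))"
  unfolding realization_def[abs_def]
proof (rule measurable_restrict)
  fix D
  assume D: "D \<in> nonempty_subsets k"
  note lu = level_uniform_good[OF good D] and e = coord_inj_enum(1)[OF D]
  show "(\<lambda>x. symmetrize (card D) (h (card D)) (pull {1..card D} (enum D) x)) \<in> measurable (loeb \<omega> X {1..k}) unit_interval"
  proof (rule measurable_restrict_space2)
    show "(\<lambda>x. symmetrize (card D) (h (card D)) (pull {1..card D} (enum D) x)) \<in> space (loeb \<omega> X {1..k}) \<rightarrow> {0..1}"
      using level_uniformD(2)[OF lu] pull_upower[of "enum D" "{1..card D}" "{1..k}"] e by (auto simp: coord_inj_def)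
    show "(\<lambda>x. symmetrize (card D) (h (card D)) (pull {1..card D} (enum D) x)) \<in> measurable (loeb \<omega> X {1..k}) lborel"
      using measurable_compose[OF pull_measurable[OF e] level_uniformD(1)[OF lu]] by simp
  qed
qed

text \<open>A product measure on finitely many factors is determined by boxes, and their measure is
  the joint law found above.\<close>

lemma realization_distr:
  assumes good: "good_levels k h"
  shows "distr (loeb \<omega> X {1..k}) (PiM (nonempty_subsets k) (\<lambda>_. unit_interval)) (realization k h)
    = PiM (nonempty_subsets k) (\<lambda>_. unit_interval)"
proof -
  interpret U: prob_space unit_interval
    by (rule prob_space_unit_interval)
  interpret product_sigma_finite "\<lambda>_ :: nat set. unit_interval"
    by unfold_locales
  interpret prob_space "loeb \<omega> X {1..k}"
    by (rule prob_space_loeb) simp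
  let ?I = "nonempty_subsets k"
  show ?thesis
  proof (rule PiM_eqI[OF finite_nonempty_subsets])
    fix A :: "nat set \<Rightarrow> real set"
    assume A: "\<And>D. D \<in> ?I \<Longrightarrow> A D \<in> sets unit_interval"
    have A': "A D \<in> sets borel" "A D \<subseteq> {0..1}" if "D \<in> ?I" for D
      using A[OF that] by (auto simp: sets_restrict_space)
    have "realization k h -` (Pi\<^sub>E ?I A) \<inter> space (loeb \<omega> X {1..k})
        = {x \<in> upower \<omega> X {1..k}. \<forall>D\<in>?I. realization k h x D \<in> A D}"
      by (auto simp: realization_def)
    then have "emeasure (distr (loeb \<omega> X {1..k}) (PiM ?I (\<lambda>_. unit_interval)) (realization k h)) (Pi\<^sub>E ?I A)
        = ennreal (prob {x \<in> upower \<omega> X {1..k}. \<forall>D\<in>?I. realization k h x D \<in> A D})"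
      using A realization_measurable[OF good] finite_nonempty_subsets
      by (simp add: emeasure_distr sets_PiM_I_finite emeasure_eq_measure)
    also have "\<dots> = ennreal (\<Prod>D\<in>?I. measure lborel ({0..1} \<inter> A D))"
      using A' by (subst realization_joint[OF good order_refl]) auto
    also have "\<dots> = (\<Prod>D\<in>?I. ennreal (measure lborel ({0..1} \<inter> A D)))"
      by (rule prod_ennreal[symmetric]) simp
    also have "\<dots> = (\<Prod>D\<in>?I. emeasure unit_interval (A D))"
    proof (rule prod.cong[OF refl])
      fix D
      assume D: "D \<in> ?I"
      have "emeasure unit_interval (A D) = emeasure lborel (A D)"
        using A'[OF D] by (intro emeasure_restrict_space) auto
      also have "\<dots> = ennreal (measure lborel (A D))"
      proof (rule emeasure_eq_ennreal_measure)
        have "emeasure lborel (A D) \<le> emeasure lborel {0..1 :: real}"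
          using A'[OF D] by (intro emeasure_mono) auto
        then show "emeasure lborel (A D) \<noteq> top"
          by (auto simp: top_unique)
      qed
      finally show "ennreal (measure lborel ({0..1} \<inter> A D)) = emeasure unit_interval (A D)"
        using A'(2)[OF D] by (simp add: Int_absorb1)
    qed
    finally show "emeasure (distr (loeb \<omega> X {1..k}) (PiM ?I (\<lambda>_. unit_interval)) (realization k h)) (Pi\<^sub>E ?I A)
        = (\<Prod>D\<in>?I. emeasure unit_interval (A D))" .
  qed simp
qed

text \<open>The source is complete, so measurability and law extend from the product measure to its
  completion.\<close>

lemma realization_measure_preserving:
  assumes good: "good_levels k h"
  shows "measure_preserving_map (loeb \<omega> X {1..k}) (cube k) (realization k h)"
proof -
  interpret complete_measure "loeb \<omega> X {1..k}"
    by (rule complete_measure_loeb) simp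
  note meas = realization_measurable[OF good] and distr = realization_distr[OF good]
  show ?thesis
    unfolding measure_preserving_map_def cube_def
    using measurable_completion2[OF meas] completion_distr_eq[OF meas] distr by simp
qed

lemma realization_separable:
  assumes good: "good_levels k h"
  shows "separable_realization \<omega> X k (realization k h)"
  unfolding separable_realization_def Let_def
proof (intro conjI allI impI ballI)
  fix D and I :: "real set"
  assume D: "D \<in> nonempty_subsets k" and "I \<in> sets (lebesgue_on {0..1})"
  then have I: "I \<in> sets lebesgue"
    by (auto simp: sets_restrict_space)
  show "{x \<in> upower \<omega> X {1..k}. realization k h x D \<in> I} \<in> sets (sigma_coord \<omega> X k D)"
    "independent_from (loeb \<omega> X {1..k}) (sigma_coord_star \<omega> X k D) {x \<in> upower \<omega> X {1..k}. realization k h x D \<in> I}"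
    using realization_independent[OF good D I] by auto
qed (use realization_measure_preserving[OF good] realization_perm in auto)

text \<open>The sets matched by some \<open>B\<close> up to a null set form a sigma-algebra. A
  generator is a condition on the single cube coordinate given by the image of \<open>e\<close>;
  null sets are matched by the empty set.\<close>

lemma level_sigma_realized:
  assumes good: "good_levels k h" and A: "A \<in> sets (level_sigma k h)"
  shows "\<exists>B\<in>sets (cube k). AE x in loeb \<omega> X {1..k}. realization k h x \<in> B \<longleftrightarrow> x \<in> A"
proof -
  let ?M = "loeb \<omega> X {1..k}"
  let ?N = "PiM (nonempty_subsets k) (\<lambda>_. unit_interval)"
  have sp: "realization k h x \<in> space (cube k)" if "x \<in> upower \<omega> X {1..k}" for x
    using measurable_space[OF realization_measurable[OF good], of x] that by (simp add: cube_def)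
  have "A \<in> sigma_sets (upower \<omega> X {1..k}) (level_gens k h \<union> null_sets ?M)"
    using A by (simp add: sets_level_sigma)
  then show ?thesis
  proof induction
    case (Basic G)
    then consider "G \<in> level_gens k h" | "G \<in> null_sets ?M"
      by blast
    then show ?case
    proof cases
      case 1
      then obtain j e t where G: "G = pre {1..k} {1..j} e (level_set h j t)" "1 \<le> j" "coord_inj {1..j} {1..k} e"
        by (auto simp: level_gens_def)
      define D where "D = e ` {1..j}"
      have D: "D \<in> nonempty_subsets k"
        using G(2,3) by (auto simp: nonempty_subsets_def coord_inj_def D_def)
      have "(\<lambda>y. y D) \<in> measurable ?N unit_interval"
        using D by (rule measurable_component_singleton)
      then have "(\<lambda>y. y D) -` ({..t} \<inter> {0..1}) \<inter> space ?N \<in> sets ?N"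
        by (rule measurable_sets) (auto simp: sets_restrict_space)
      moreover define B where "B = (\<lambda>y. y D) -` ({..t} \<inter> {0..1}) \<inter> space ?N"
      ultimately have B: "B \<in> sets (cube k)"
        unfolding cube_def by (intro sets_completionI_sets) simp
      have mem: "realization k h x \<in> B \<longleftrightarrow> x \<in> G"
        if x: "x \<in> upower \<omega> X {1..k}" for x
      proof -
        have "realization k h x D \<in> {0..1}"
          using sp[OF x] D by (auto simp: cube_def space_PiM space_restrict_space)
        moreover have "x \<in> G \<longleftrightarrow> realization k h x D \<le> t"
          using symmetrize_pull_eq_realization[OF G(3,2) x, of h] G(3) pull_upower[of e "{1..j}" "{1..k}" x] x
          by (auto simp: G(1) pre_def level_set_def D_def coord_inj_def)
        ultimately show ?thesis
          using sp[OF x] by (auto simp: cube_def B_def)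
      qed
      show ?thesis
        by (rule bexI[OF _ B], rule AE_I2) (use mem in simp)
    next
      case 2
      then show ?thesis
        by (intro bexI[of _ "{}"]) (auto intro: AE_I'[OF 2])
    qed
  next
    case Empty
    then show ?case
      by (intro bexI[of _ "{}"]) auto
  next
    case (Compl a)
    then obtain B where B: "B \<in> sets (cube k)" "AE x in ?M. realization k h x \<in> B \<longleftrightarrow> x \<in> a"
      by blast
    have "AE x in ?M. realization k h x \<in> space (cube k) - B \<longleftrightarrow> x \<in> upower \<omega> X {1..k} - a"
      using B(2) AE_space by eventually_elim (use sp in auto)
    then show ?case
      using B(1) by blast
  next
    case (Union a)
    have "\<exists>B. \<forall>i. B i \<in> sets (cube k) \<and> (AE x in ?M. realization k h x \<in> B i \<longleftrightarrow> x \<in> a i)"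
      using Union.IH by (intro choice allI) blast
    then obtain B where B: "\<And>i. B i \<in> sets (cube k)" "\<And>i. AE x in ?M. realization k h x \<in> B i \<longleftrightarrow> x \<in> a i"
      by blast
    have "AE x in ?M. \<forall>i. realization k h x \<in> B i \<longleftrightarrow> x \<in> a i"
      using B(2) by (simp add: AE_all_countable)
    then have "AE x in ?M. realization k h x \<in> (\<Union>i. B i) \<longleftrightarrow> x \<in> (\<Union>i. a i)"
      by (rule eventually_mono) auto
    then show ?case
      using B(1) by (intro bexI[of _ "\<Union>i. B i"]) auto
  qed
qed

text \<open>Borel-Cantelli: with approximation errors below \<open>(1 / 2) ^ n\<close>, almost every
  point belongs to \<open>A\<close> exactly if it belongs to all late \<open>C n\<close>, so
  \<open>A\<close> is their lower limit up to a null set.\<close>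

lemma separable_in_level_sigma:
  assumes good: "good_levels k h" and \<C>: "\<C> \<subseteq> sets (level_sigma k h)"
    and A: "A \<in> sets (loeb \<omega> X {1..k})"
    and dense: "\<And>\<epsilon>. 0 < \<epsilon> \<Longrightarrow> \<exists>C\<in>\<C>. measure (loeb \<omega> X {1..k}) (sym_diff A C) < \<epsilon>"
  shows "A \<in> sets (level_sigma k h)"
proof -
  let ?M = "loeb \<omega> X {1..k}"
  interpret prob_space ?M
    by (rule prob_space_loeb) simp
  have "\<forall>n. \<exists>C. C \<in> \<C> \<and> prob (sym_diff A C) < (1 / 2) ^ n"
    using dense by (metis zero_less_divide_1_iff zero_less_numeral zero_less_power)
  then obtain C where C: "\<And>n. C n \<in> \<C>" "\<And>n. prob (sym_diff A (C n)) < (1 / 2) ^ n"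
    by metis
  have CM: "C n \<in> events" for n
    using C(1) \<C> level_sigma_sets_loeb[OF good] by blast
  have "AE x in ?M. eventually (\<lambda>n. x \<in> space ?M - sym_diff A (C n)) sequentially"
  proof (rule borel_cantelli_AE1)
    show "sym_diff A (C n) \<in> events" for n
      using A CM by auto
    show "emeasure ?M (sym_diff A (C n)) < \<infinity>" for n
      by (simp add: emeasure_eq_measure)
    show "summable (\<lambda>n. prob (sym_diff A (C n)))"
    proof (rule summable_comparison_test')
      show "summable (\<lambda>n. (1 / 2 :: real) ^ n)"
        by (rule summable_geometric) simp
      show "norm (prob (sym_diff A (C n))) \<le> (1 / 2) ^ n" if "0 \<le> n" for n
        using C(2)[of n] by simp
    qed
  qed
  then have ae: "AE x in ?M. x \<in> (\<Union>m. \<Inter>n. C (m + n)) \<longleftrightarrow> x \<in> A"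
  proof eventually_elim
    case (elim x)
    then obtain N where N: "\<And>n. N \<le> n \<Longrightarrow> x \<in> A \<longleftrightarrow> x \<in> C n"
      by (auto simp: eventually_sequentially)
    show ?case
    proof
      assume "x \<in> (\<Union>m. \<Inter>n. C (m + n))"
      then obtain m where "\<And>n. x \<in> C (m + n)"
        by auto
      from this[of N] show "x \<in> A"
        using N[of "m + N"] by simp
    next
      assume "x \<in> A"
      then have "x \<in> C (N + n)" for n
        using N[of "N + n"] by simp
      then show "x \<in> (\<Union>m. \<Inter>n. C (m + n))"
        by blast
    qed
  qed
  have "C n \<in> sets (level_sigma k h)" for n
    using C(1) \<C> by blast
  then have "(\<Union>m. \<Inter>n. C (m + n)) \<in> sets (level_sigma k h)"
    by auto
  then show ?thesis
    using A ae by (rule level_sigma_AE[OF good])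
qed

lemma separable_realization_exists:
  assumes sub: "\<A> \<subseteq> sets (sigma_coord \<omega> X k {1..k})" and sep: "separable_algebra (loeb \<omega> X {1..k}) \<A>"
  shows "\<exists>\<phi>. separable_realization \<omega> X k \<phi> \<and>
    (\<forall>A\<in>\<A>. \<exists>B\<in>sets (cube k). emeasure (loeb \<omega> X {1..k}) (sym_diff (\<phi> -` B \<inter> upower \<omega> X {1..k}) A) = 0)"
proof -
  let ?M = "loeb \<omega> X {1..k}"
  interpret complete_measure ?M
    by (rule complete_measure_loeb) simp
  \<comment> \<open>The projection to all coordinates is the identity, so the coordinate
    sigma-algebra of the full index set is the Loeb sigma-algebra.\<close>
  have AM: "\<A> \<subseteq> sets ?M"
    using sub sets.sets_into_space[of _ ?M] by (auto simp: sets_sigma_coord pre_id)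
  obtain \<C> where \<C>: "\<C> \<subseteq> \<A>" "countable \<C>" "\<And>A \<epsilon>. A \<in> \<A> \<Longrightarrow> 0 < \<epsilon> \<Longrightarrow> \<exists>C\<in>\<C>. measure ?M (sym_diff A C) < \<epsilon>"
    using sep unfolding separable_algebra_def by blast
  obtain h where good: "good_levels k h" and Ch: "\<C> \<subseteq> sets (level_sigma k h)"
    using levels_exist[OF \<C>(2), of k] \<C>(1) AM by blast
  have "\<exists>B\<in>sets (cube k). emeasure ?M (sym_diff (realization k h -` B \<inter> upower \<omega> X {1..k}) A) = 0"
    if A: "A \<in> \<A>" for A
  proof -
    have "A \<in> sets ?M"
      using A AM by blast
    from level_sigma_realized[OF good separable_in_level_sigma[OF good Ch this \<C>(3)[OF A]]]
    obtain B where B: "B \<in> sets (cube k)" "AE x in ?M. realization k h x \<in> B \<longleftrightarrow> x \<in> A"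
      by blast
    have "sym_diff (realization k h -` B \<inter> upower \<omega> X {1..k}) A
        = {x \<in> space ?M. \<not> (realization k h x \<in> B \<longleftrightarrow> x \<in> A)}"
      using A AM sets.sets_into_space[of A ?M] by auto
    moreover have "{x \<in> space ?M. \<not> (realization k h x \<in> B \<longleftrightarrow> x \<in> A)} \<in> null_sets ?M"
      using B(2) by (simp add: AE_iff_null_sets)
    ultimately have "emeasure ?M (sym_diff (realization k h -` B \<inter> upower \<omega> X {1..k}) A) = 0"
      by (simp only: null_setsD1)
    then show ?thesis
      using B(1) by (rule bexI)
  qed
  then show ?thesis
    using realization_separable[OF good] by blast
qed

end

theorem mainTheorem11:
  fixes X :: "nat \<Rightarrow> 'a set" and \<omega> :: "nat filter" and k :: nat
    and \<A> :: "'a upoint set set"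
  assumes "\<And>i. finite (X i)"
    and "\<And>i. card (X i) < card (X (Suc i))"
    and "nonprincipal_ultrafilter \<omega>"
    and "sigma_algebra (upower \<omega> X {1..k}) \<A>"
    and "\<A> \<subseteq> sets (sigma_coord \<omega> X k {1..k})"
    and "separable_algebra (loeb \<omega> X {1..k}) \<A>"
  shows "\<exists>\<phi>. separable_realization \<omega> X k \<phi> \<and>
           (\<forall>A\<in>\<A>. \<exists>B\<in>sets (cube k).
              emeasure (loeb \<omega> X {1..k}) (sym_diff (\<phi> -` B \<inter> upower \<omega> X {1..k}) A) = 0)"
proof -
  interpret ultra_powers \<omega> X
    by (rule ultra_powers.intro[of X \<omega>, OF assms(1-3)])
  \<comment> \<open>Any uniform function on the first power can do the sorting, so the family to be
    generated is taken trivial.\<close>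
  obtain u where "level_uniform 1 u"
    using level_uniform_exists[of 1 "\<lambda>_. {}"] by auto
  then interpret ordered_ultra_powers \<omega> X u
    by unfold_locales
  show ?thesis
    using assms(5,6) by (rule separable_realization_exists)
qed

end
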